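(* Let $a>0$ and $R\in\{0,1,2,\dots\}$. Then $$W_R^{(0,2)}(a,z)=W_R^{(2,3)}(a,z)+ie^{-3R\pi i/4}\Lambda_R(ia)\,W_2(a,z),$$ where $$\Lambda_R(b)=2^{-\frac12b+\frac32R+\frac14}\sqrt\pi\,e^{\left(\frac12b+\frac12R-\frac34\right)\pi i}\,\Gamma\left(b+\tfrac12\right)\mathbf F\left(\tfrac12-\tfrac12R,-\tfrac12R;\tfrac12b-\tfrac12R+\tfrac34;\tfrac12\right).$$
   Context: $U(a,z)$ is the parabolic cylinder function: the solution of $y''-(\tfrac14z^2+a)y=0$ with $U(a,z)\sim z^{-a-1/2}e^{-z^2/4}$ as $z\to\infty$, $|\arg z|\le\frac34\pi-\delta$. $W_j(a,z)=U((-1)^jia,(-i)^jze^{-\pi i/4})$, $j=0,1,2,3$, are solutions of $y''-(a-\frac14z^2)y=0$, and for $j<k$ $$W_R^{(j,k)}(a,z)=\frac1{\mathscr W\{W_j(a,z),W_k(a,z)\}}\left[W_k(a,z)\int_{e^{\pi i/4}i^j\infty}^zt^RW_j(a,t)dt-W_j(a,z)\int_{e^{\pi i/4}i^k\infty}^zt^RW_k(a,t)dt\right]$$ ($\mathscr W$ the Wronskian) is a particular solution of $y''-(a-\frac14z^2)y=z^R$. $\mathbf{F}(a,b;c;z)=\sum_{s\ge0}\frac{(a)_s(b)_sz^s}{\Gamma(c+s)s!}$. *)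

theory Defs
  imports "HOL-Complex_Analysis.Complex_Analysis" "HOL-Library.Landau_Symbols"
begin

definition pcf_sector :: "real \<Rightarrow> complex set" where
  "pcf_sector \<delta> = {z. \<bar>Arg z\<bar> \<le> 3 / 4 * pi - \<delta>}"

text \<open>All powers with complex exponent are principal values. All solutions of the Weber equation
  are entire, so ``solution'' means an entire function satisfying the equation on the whole
  plane.\<close>

definition is_pcfU :: "complex \<Rightarrow> (complex \<Rightarrow> complex) \<Rightarrow> bool" where
  "is_pcfU a f \<longleftrightarrow>
     f holomorphic_on UNIV \<and>
     (\<forall>z. (deriv ^^ 2) f z - (z\<^sup>2 / 4 + a) * f z = 0) \<and>
     (\<forall>\<delta>>0. f \<sim>[inf at_infinity (principal (pcf_sector \<delta>))]
              (\<lambda>z. z powr (- a - 1 / 2) * exp (- (z\<^sup>2) / 4)))"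

definition pcfU :: "complex \<Rightarrow> complex \<Rightarrow> complex" where
  "pcfU a = (THE f. is_pcfU a f)"

definition pcfW :: "nat \<Rightarrow> complex \<Rightarrow> complex \<Rightarrow> complex" where
  "pcfW j a z = pcfU ((- 1) ^ j * \<i> * a) ((- \<i>) ^ j * z * exp (- (of_real pi * \<i> / 4)))"

definition wronskian :: "(complex \<Rightarrow> complex) \<Rightarrow> (complex \<Rightarrow> complex) \<Rightarrow> complex \<Rightarrow> complex" where
  "wronskian f g z = f z * deriv g z - deriv f z * g z"

text \<open>The integral of an entire function \<open>f\<close> from infinity, along the direction \<open>d\<close>, to \<open>z\<close>.
  By path independence the finite parts may be taken over straight segments.\<close>

definition integral_from_infinity :: "complex \<Rightarrow> complex \<Rightarrow> (complex \<Rightarrow> complex) \<Rightarrow> complex" where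
  "integral_from_infinity d z f =
     Lim at_top (\<lambda>s::real. contour_integral (linepath (of_real s * d) z) f)"

definition pcfW_inhom :: "nat \<Rightarrow> nat \<Rightarrow> nat \<Rightarrow> complex \<Rightarrow> complex \<Rightarrow> complex" where
  "pcfW_inhom R j k a z =
     1 / wronskian (pcfW j a) (pcfW k a) z *
     (pcfW k a z *
        integral_from_infinity (exp (of_real pi * \<i> / 4) * \<i> ^ j) z (\<lambda>t. t ^ R * pcfW j a t) -
      pcfW j a z *
        integral_from_infinity (exp (of_real pi * \<i> / 4) * \<i> ^ k) z (\<lambda>t. t ^ R * pcfW k a t))"

definition hypergeo_reg :: "complex \<Rightarrow> complex \<Rightarrow> complex \<Rightarrow> complex \<Rightarrow> complex" where
  "hypergeo_reg a b c z =
     (\<Sum>s. pochhammer a s * pochhammer b s * z ^ s * rGamma (c + of_nat s) / fact s)"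

definition Lambda :: "nat \<Rightarrow> complex \<Rightarrow> complex" where
  "Lambda R b =
     2 powr (- b / 2 + 3 / 2 * of_nat R + 1 / 4) * of_real (sqrt pi) *
     exp ((b / 2 + of_nat R / 2 - 3 / 4) * of_real pi * \<i>) * Gamma (b + 1 / 2) *
     hypergeo_reg (1 / 2 - of_nat R / 2) (- of_nat R / 2)
       (b / 2 - of_nat R / 2 + 3 / 4) (1 / 2)"

end

theory Submission
  imports Defs "HOL-Real_Asymp.Real_Asymp"
begin

text \<open>Put \<open>s = i a + 1/2\<close> and \<open>t = 1 - s\<close>. For \<open>Re s > 0\<close> the function
  \<open>\<Gamma>(s) U(s - 1/2, z)\<close> is \<open>exp(-z\<^sup>2/4)\<close> times the integral of
  \<open>u\<^bsup>s-1\<^esup> exp(-u\<^sup>2/2 - z u)\<close> over the positive axis; rotating the ray and comparing with a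
  Laplace integral gives the asymptotics in the full sector.

  By constancy of Wronskians \<open>W\<^sub>3\<close> is a combination of \<open>W\<^sub>0\<close> and \<open>W\<^sub>2\<close>, and substituting it
  shows that the difference of the two particular solutions is \<open>W\<^sub>2\<close> times a linear combination of
  the moments of \<open>U(\<plusminus>ia, x)\<close> of order \<open>R\<close> on the positive axis. Integrating the differential
  equation against powers, that combination satisfies a recursion in \<open>R\<close> with step 2, which is
  also satisfied by the right-hand side because the hypergeometric equation at the point 1/2 relates
  \<open>F\<close> to its derivatives, all of which are again functions \<open>F\<close> with shifted parameters.

  It remains to treat \<open>R = 0\<close> and \<open>R = 1\<close>. There each moment is an incomplete beta integral over
  \<open>(0, 1)\<close>; the one belonging to \<open>-ia\<close> is the remaining part, over \<open>(1, \<infinity>)\<close>, of the integral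
  belonging to \<open>ia\<close>, so that the combination is a complete beta integral.\<close>

section \<open>Integrals of Gaussian type\<close>

text \<open>For real \<open>a\<close> both \<open>s\<close> and \<open>t\<close> have real part 1/2,
  so one integral representation covers U(ia, .) and U(-ia, .), and the reflection formula pairs the
  Gamma values at \<open>s / 2\<close> and \<open>(t + 1) / 2\<close>, and those at
  \<open>(s + 1) / 2\<close> and \<open>t / 2\<close>. A Laplace comparison alone reaches |arg z| <
  pi/2; the ray may be turned by less than pi/4 before the Gaussian factor stops decaying, and both
  together give the required 3 pi/4.

  In the step-2 recursion the boundary terms at 0 are the value and the derivative at 0 of the
  linear relation between W_0, W_2 and W_3, so they cancel; this is why the combination, unlike a
  single moment, satisfies a homogeneous recursion.

  Gluing (0, 1) to (1, \<infinity>) by r -> 1/r sends the parameter \<open>s\<close> to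
  \<open>2 * k - s\<close>, so the exponent \<open>k\<close> must be half the sum of the two
  parameters: 1/2 for \<open>s\<close>, \<open>t\<close> (R = 0) and 3/2 for \<open>s + 1\<close>,
  \<open>t + 1\<close> (R = 1). The first moment arises with exponent 1/2 at \<open>s + 1\<close>
  and is brought to 3/2 by an integration by parts.\<close>

lemma set_integrable_lborel_iff_continuous:
  fixes f :: "real \<Rightarrow> 'a::euclidean_space"
  assumes "S \<in> sets borel" "continuous_on S f"
  shows "set_integrable lborel S f \<longleftrightarrow> f absolutely_integrable_on S"
proof -
  have "(\<lambda>x. indicator S x *\<^sub>R f x) \<in> borel_measurable lborel"
    using borel_measurable_continuous_on_indicator[OF assms] by simp
  then show ?thesis
    unfolding set_integrable_def by (simp add: integrable_completion)
qed

text \<open>Continuity makes both integrands Borel, which transfers the substitution rule for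
  absolutely integrable functions to \<open>lborel\<close>. As continuity is asked only on the sets
  themselves, the integrands may blow up at the ends of an open interval.\<close>

lemma set_integral_change_of_variables:
  fixes f :: "real \<Rightarrow> 'a::euclidean_space"
  assumes S: "S \<in> sets borel" and T: "T \<in> sets borel" and img: "g ` S = T" and inj: "inj_on g S"
    and g: "\<And>x. x \<in> S \<Longrightarrow> (g has_field_derivative g' x) (at x)"
    and f: "continuous_on T f" and g': "continuous_on S g'"
  shows "set_integrable lborel S (\<lambda>x. \<bar>g' x\<bar> *\<^sub>R f (g x)) \<longleftrightarrow> set_integrable lborel T f"
    and "set_integrable lborel T f \<Longrightarrow>
      (LINT x:S|lborel. \<bar>g' x\<bar> *\<^sub>R f (g x)) = (LINT x:T|lborel. f x)"
proof -
  have "continuous_on S g"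
    using g by (meson DERIV_isCont continuous_at_imp_continuous_on)
  then have c: "continuous_on S (\<lambda>x. \<bar>g' x\<bar> *\<^sub>R f (g x))"
    using f g' img by (intro continuous_intros continuous_on_compose2[OF f]) auto
  have gw: "(g has_field_derivative g' x) (at x within S)" if "x \<in> S" for x
    using g[OF that] by (rule has_field_derivative_at_within)
  have SL: "S \<in> sets lebesgue" using S by simp
  show iff: "set_integrable lborel S (\<lambda>x. \<bar>g' x\<bar> *\<^sub>R f (g x)) \<longleftrightarrow> set_integrable lborel T f"
    using set_integrable_lborel_iff_continuous[OF S c] set_integrable_lborel_iff_continuous[OF T f]
      absolutely_integrable_change_of_variables_real[OF SL gw inj, of f] img by simp
  assume i: "set_integrable lborel T f"
  then show "(LINT x:S|lborel. \<bar>g' x\<bar> *\<^sub>R f (g x)) = (LINT x:T|lborel. f x)"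
    using iff set_integrable_lborel_iff_continuous[OF T f] img
      has_absolute_integral_change_of_variables_real[OF SL gw inj, of f "integral T f"]
    by (simp add: set_borel_integral_eq_integral)
qed

text \<open>For holomorphic integrands a majorant of the function itself suffices: Cauchy's estimate
  turns it into a majorant of the derivative on a smaller ball, hence of the difference quotients,
  and dominated convergence applies along sequences.\<close>

lemma has_field_derivative_integral:
  fixes f :: "complex \<Rightarrow> 'a \<Rightarrow> complex"
  assumes r: "r > 0"
    and meas: "\<And>w. w \<in> ball w0 r \<Longrightarrow> f w \<in> borel_measurable M"
    and hol: "\<And>t. t \<in> space M \<Longrightarrow> (\<lambda>w. f w t) holomorphic_on ball w0 r"
    and bound: "\<And>w t. \<lbrakk>w \<in> ball w0 r; t \<in> space M\<rbrakk> \<Longrightarrow> norm (f w t) \<le> g t"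
    and g: "integrable M g"
  shows "((\<lambda>w. \<integral>t. f w t \<partial>M) has_field_derivative (\<integral>t. deriv (\<lambda>w. f w t) w0 \<partial>M)) (at w0)"
proof -
  have w0: "w0 \<in> ball w0 r" using r by simp
  define D where "D t = deriv (\<lambda>w. f w t) w0" for t
  have D: "((\<lambda>w. f w t) has_field_derivative D t) (at w0)" if "t \<in> space M" for t
    unfolding D_def using hol[OF that] w0 by (rule holomorphic_derivI[OF _ open_ball])
  \<comment> \<open>A disc of radius \<open>r / 3\<close> about a point of the half-size ball stays
    inside the big one, since 1/2 + 1/3 < 1; Cauchy's estimate on it gives the factor
    \<open>3 / r\<close>.\<close>
  have quot: "norm ((f w t - f w0 t) / (w - w0)) \<le> 3 / r * g t"
    if t: "t \<in> space M" and w: "w \<in> ball w0 (r/2) - {w0}" for w t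
  proof -
    have gt0: "0 \<le> g t" using order_trans[OF norm_ge_zero bound[OF w0 t]] .
    have d: "norm (deriv (\<lambda>w. f w t) u) \<le> 3 / r * g t" if u: "u \<in> ball w0 (r/2)" for u
    proof -
      have sub: "cball u (r/3) \<subseteq> ball w0 r"
      proof
        fix v assume "v \<in> cball u (r/3)"
        then show "v \<in> ball w0 r"
          using u r dist_triangle[of w0 v u] by auto
      qed
      have "norm ((deriv ^^ 1) (\<lambda>w. f w t) u) \<le> fact 1 * g t / (r/3) ^ 1"
      proof (rule Cauchy_inequality)
        show "(\<lambda>w. f w t) holomorphic_on ball u (r/3)"
          using hol[OF t] sub by (meson ball_subset_cball holomorphic_on_subset order_trans)
        show "continuous_on (cball u (r/3)) (\<lambda>w. f w t)"
          using hol[OF t] sub holomorphic_on_imp_continuous_on holomorphic_on_subset by blast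
        show "norm (f x t) \<le> g t" if "norm (u - x) = r/3" for x
          using bound[OF _ t, of x] sub that by (auto simp: dist_norm)
      qed (use r in auto)
      then show ?thesis by (simp add: field_simps)
    qed
    have "norm (f w t - f w0 t) \<le> 3 / r * g t * norm (w - w0)"
    proof (rule field_differentiable_bound[where S = "ball w0 (r/2)" and f = "\<lambda>w. f w t" and f' = "deriv (\<lambda>w. f w t)"])
      show "((\<lambda>w. f w t) has_field_derivative deriv (\<lambda>w. f w t) u) (at u within ball w0 (r/2))"
        if "u \<in> ball w0 (r/2)" for u
      proof (rule has_field_derivative_at_within, rule holomorphic_derivI[OF hol[OF t] open_ball])
        show "u \<in> ball w0 r" using that r by auto
      qed
    qed (use w d r in auto)
    then show ?thesis using w r by (auto simp: norm_divide divide_simps)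
  qed
  have lim: "(\<lambda>n. \<integral>t. (f (X n) t - f w0 t) / (X n - w0) \<partial>M) \<longlonglongrightarrow> (\<integral>t. D t \<partial>M)"
    if X: "\<forall>n. X n \<in> ball w0 (r/2) - {w0}" "X \<longlonglongrightarrow> w0" for X
  proof -
    have Xr: "X n \<in> ball w0 r" for n using X(1) r by (auto dest!: spec[of _ n])
    have m: "(\<lambda>t. (f (X n) t - f w0 t) / (X n - w0)) \<in> borel_measurable M" for n
      using meas[OF Xr[of n]] meas[OF w0] by measurable
    have c: "(\<lambda>n. (f (X n) t - f w0 t) / (X n - w0)) \<longlonglongrightarrow> D t" if "t \<in> space M" for t
      using D[OF that] X unfolding has_field_derivative_iff tendsto_at_iff_sequentially
      by (auto simp: o_def)
    have Dm: "D \<in> borel_measurable M"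
      by (rule borel_measurable_LIMSEQ_metric[OF m c])
    show ?thesis
      by (rule integral_dominated_convergence[where w = "\<lambda>t. 3 / r * g t"])
        (use m c Dm g quot X(1) in auto)
  qed
  have int: "integrable M (f w)" if "w \<in> ball w0 r" for w
    using g meas[OF that] bound[OF that]
    by (intro Bochner_Integration.integrable_bound[OF g]) (auto intro!: AE_I2 order_trans[OF _ abs_ge_self])
  have "((\<lambda>w. ((\<integral>t. f w t \<partial>M) - (\<integral>t. f w0 t \<partial>M)) / (w - w0)) \<longlongrightarrow> (\<integral>t. D t \<partial>M)) (at w0 within ball w0 (r/2))"
    unfolding tendsto_at_iff_sequentially
  proof (intro allI impI)
    fix X assume X: "\<forall>i. X i \<in> ball w0 (r / 2) - {w0}" "X \<longlonglongrightarrow> w0"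
    have "((\<integral>t. f (X n) t \<partial>M) - (\<integral>t. f w0 t \<partial>M)) / (X n - w0) =
        (\<integral>t. (f (X n) t - f w0 t) / (X n - w0) \<partial>M)" for n
    proof -
      have "X n \<in> ball w0 r" using X(1) r by (auto dest!: spec[of _ n])
      then show ?thesis using int w0 by simp
    qed
    then show "((\<lambda>w. ((\<integral>t. f w t \<partial>M) - (\<integral>t. f w0 t \<partial>M)) / (w - w0)) \<circ> X) \<longlonglongrightarrow> (\<integral>t. D t \<partial>M)"
      using lim[OF X] by (simp only: o_def)
  qed
  then have "((\<lambda>w. \<integral>t. f w t \<partial>M) has_field_derivative (\<integral>t. D t \<partial>M)) (at w0 within ball w0 (r/2))"
    by (simp add: has_field_derivative_iff)
  then show ?thesis
    using r at_within_open[of w0 "ball w0 (r/2)"] by (simp add: D_def)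
qed

text \<open>The values of interest are \<open>p = 1/2\<close> (parabolic cylinder functions) and \<open>p = 0\<close>
  (Laplace transform of a power).\<close>

definition gauss_int :: "complex \<Rightarrow> complex \<Rightarrow> complex \<Rightarrow> complex" where
  "gauss_int s p z = (LINT t:{0<..}|lborel. of_real t powr (s - 1) * exp (- p * of_real t ^ 2 - z * of_real t))"

section \<open>Integrability and differentiation in the parameters\<close>

lemma set_integrable_powr_exp:
  fixes s :: complex
  assumes "Re s > 0" "c > 0"
  shows "set_integrable lborel {0<..} (\<lambda>t. of_real t powr (s - 1) * of_real (exp (- c * t)))"
proof -
  have "continuous_on {0<..} (\<lambda>t::real. of_real t powr (s - 1) * complex_of_real (exp (- c * t)))"
    by (intro continuous_intros) auto
  moreover have "(\<lambda>t. of_real t powr (s - 1) * complex_of_real (exp (- c * t))) absolutely_integrable_on {0<..}"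
    using absolutely_integrable_Gamma_integral[OF assms] by (simp add: exp_minus field_simps)
  ultimately show ?thesis
    by (subst set_integrable_lborel_iff_continuous) auto
qed

lemma norm_of_real_powr: "t > 0 \<Longrightarrow> norm (of_real t powr s :: complex) = t powr Re s" for t :: real
  by (simp add: norm_powr_real_powr)

lemma set_integrable_powr_exp_real:
  fixes \<sigma> c :: real
  assumes "\<sigma> > 0" "c > 0"
  shows "set_integrable lborel {0<..} (\<lambda>t. t powr (\<sigma> - 1) * exp (- c * t))"
proof -
  have "set_integrable lborel {0<..} (\<lambda>t. norm (of_real t powr (of_real \<sigma> - 1) * complex_of_real (exp (- c * t))))"
    by (intro set_integrable_norm set_integrable_powr_exp) (use assms in auto)
  then show ?thesis
    by (rule set_integrable_cong[THEN iffD1, rotated -1]) (auto simp: norm_mult norm_of_real_powr)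
qed

text \<open>Both \<open>p\<close> and \<open>z\<close> vary with \<open>w\<close> because turning
  the ray changes them simultaneously. Differentiation brings down factors t^2 and t, which raise
  the order \<open>s\<close> by 2 and by 1.\<close>

lemma gauss_int_has_field_derivative:
  assumes s: "Re s > 0" and r: "r > 0" and c: "c > 0"
    and p: "p holomorphic_on ball w0 r" and z: "z holomorphic_on ball w0 r"
    and bound: "\<And>w t. \<lbrakk>w \<in> ball w0 r; t > 0\<rbrakk> \<Longrightarrow> norm (exp (- p w * of_real t ^ 2 - z w * of_real t)) \<le> K * exp (- c * t)"
  shows "((\<lambda>w. gauss_int s (p w) (z w)) has_field_derivative
      (- deriv p w0 * gauss_int (s + 2) (p w0) (z w0) - deriv z w0 * gauss_int (s + 1) (p w0) (z w0))) (at w0)"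
proof -
  have w0: "w0 \<in> ball w0 r" using r by simp
  let ?e = "\<lambda>w t. exp (- p w * of_real t ^ 2 - z w * of_real t) :: complex"
  let ?f = "\<lambda>w t. indicator {0<..} t *\<^sub>R (of_real t powr (s - 1) * ?e w t) :: complex"
  let ?g = "\<lambda>t. indicator {0<..} t *\<^sub>R (K * (t powr (Re s - 1) * exp (- c * t)))"
  have int: "set_integrable lborel {0<..} (\<lambda>t. of_real t powr (s' - 1) * ?e w0 t)" if "Re s' > 0" for s'
  proof -
    have "set_integrable lborel {0<..} (\<lambda>t. K * (t powr (Re s' - 1) * exp (- c * t)))"
      by (intro set_integrable_mult_right impI set_integrable_powr_exp_real that c)
    then show ?thesis
    proof (rule set_integrable_bound)
      have "continuous_on {0<..} (\<lambda>t::real. of_real t powr (s' - 1) * ?e w0 t)"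
        by (intro continuous_intros) auto
      then show "set_borel_measurable lborel {0<..} (\<lambda>t::real. of_real t powr (s' - 1) * ?e w0 t)"
        unfolding set_borel_measurable_def
        using borel_measurable_continuous_on_indicator[of "{0<..}"] by simp
      show "AE x in lborel. x \<in> {0<..} \<longrightarrow> norm (of_real x powr (s' - 1) * ?e w0 x)
        \<le> norm (K * (x powr (Re s' - 1) * exp (- c * x)))"
      proof (intro AE_I2 impI)
        fix x :: real assume x: "x \<in> {0<..}"
        have "norm (of_real x powr (s' - 1) * ?e w0 x) \<le> x powr (Re s' - 1) * (K * exp (- c * x))"
          unfolding norm_mult using x bound[OF w0, of x]
          by (intro mult_mono) (auto simp: norm_of_real_powr)
        then show "norm (of_real x powr (s' - 1) * ?e w0 x)
          \<le> norm (K * (x powr (Re s' - 1) * exp (- c * x)))"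
          by (simp add: mult_ac)
      qed
    qed
  qed
  have hp: "(p has_field_derivative deriv p w0) (at w0)" "(z has_field_derivative deriv z w0) (at w0)"
    using holomorphic_derivI[OF p open_ball w0] holomorphic_derivI[OF z open_ball w0] by auto
  have "((\<lambda>w. \<integral>t. ?f w t \<partial>lborel) has_field_derivative (\<integral>t. deriv (\<lambda>w. ?f w t) w0 \<partial>lborel)) (at w0)"
  proof (rule has_field_derivative_integral[OF r])
    show "?f w \<in> borel_measurable lborel" for w
    proof -
      have "continuous_on {0<..} (\<lambda>t::real. of_real t powr (s - 1) * ?e w t)"
        by (intro continuous_intros) auto
      then show ?thesis
        using borel_measurable_continuous_on_indicator[of "{0<..}"] by simp
    qed
    show "(\<lambda>w. ?f w t) holomorphic_on ball w0 r" for t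
      using p z by (auto simp: indicator_def scaleR_conv_of_real intro!: holomorphic_intros)
    show "norm (?f w t) \<le> ?g t" if "w \<in> ball w0 r" for w t
    proof (cases "t > 0")
      case True
      have "norm (of_real t powr (s - 1) * ?e w t) \<le> t powr (Re s - 1) * (K * exp (- c * t))"
        unfolding norm_mult using True bound[OF that, of t]
        by (intro mult_mono) (auto simp: norm_of_real_powr)
      then show ?thesis using True by (simp add: mult_ac)
    qed simp
    have "set_integrable lborel {0<..} (\<lambda>t. K * (t powr (Re s - 1) * exp (- c * t)))"
      by (intro set_integrable_mult_right impI set_integrable_powr_exp_real s c)
    then show "integrable lborel ?g" by (simp add: set_integrable_def)
  qed
  moreover have deriv_f: "deriv (\<lambda>w. ?f w t) w0 =
      - deriv p w0 * (indicator {0<..} t *\<^sub>R (of_real t powr (s + 2 - 1) * ?e w0 t))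
      - deriv z w0 * (indicator {0<..} t *\<^sub>R (of_real t powr (s + 1 - 1) * ?e w0 t))" for t :: real
  proof (cases "t > 0")
    case True
    have pw: "of_real t powr (s + 1 - 1) = (of_real t powr (s - 1) * of_real t :: complex)"
      "of_real t powr (s + 2 - 1) = (of_real t powr (s - 1) * of_real t ^ 2 :: complex)"
      using True powr_add[of "of_real t :: complex" "s - 1" 1] powr_add[of "of_real t :: complex" "s - 1" 2]
      by (simp_all add: algebra_simps)
    have "((\<lambda>w. ?f w t) has_field_derivative
      (of_real t powr (s - 1) * (?e w0 t * (- deriv p w0 * of_real t ^ 2 - deriv z w0 * of_real t)))) (at w0)"
      using True by (auto intro!: derivative_eq_intros hp)
    then show ?thesis using True pw by (simp add: DERIV_imp_deriv algebra_simps)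
  qed (simp add: indicator_def)
  ultimately have "((\<lambda>w. \<integral>t. ?f w t \<partial>lborel) has_field_derivative
      (\<integral>t. - deriv p w0 * (indicator {0<..} t *\<^sub>R (of_real t powr (s + 2 - 1) * ?e w0 t))
        - deriv z w0 * (indicator {0<..} t *\<^sub>R (of_real t powr (s + 1 - 1) * ?e w0 t)) \<partial>lborel)) (at w0)"
    by (simp only: deriv_f)
  moreover have int': "integrable lborel (\<lambda>t. c * (indicator {0<..} t *\<^sub>R (of_real t powr (s' - 1) * ?e w0 t)))"
    if "Re s' > 0" for s' c
    using int[OF that] unfolding set_integrable_def by (intro integrable_mult_right)
  moreover have "Re (s + 2) > 0" "Re (s + 1) > 0" using s by auto
  ultimately show ?thesis
    by (simp only: gauss_int_def set_lebesgue_integral_def int'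
        Bochner_Integration.integral_diff integral_mult_right_zero)
qed

text \<open>A common condition for the two sources of decay: a Gaussian factor with
  \<open>Re p > 0\<close>, or \<open>Re z > 0\<close> when \<open>p\<close> is only known to satisfy
  \<open>Re p \<ge> 0\<close>.\<close>

definition gauss_dominated :: "complex \<Rightarrow> complex \<Rightarrow> bool" where
  "gauss_dominated p z \<longleftrightarrow>
     (\<exists>K c. c > 0 \<and> (\<forall>t>0. norm (exp (- p * of_real t ^ 2 - z * of_real t)) \<le> K * exp (- c * t)))"

text \<open>Complete the square in \<open>(Z + 1) * t - q * t\<^sup>2\<close>; the 1 added to
  \<open>Z\<close> pays for the factor exp(-t). The bound is uniform in \<open>p\<close> and
  \<open>z\<close>, as differentiation in a parameter requires.\<close>

lemma norm_gauss_le: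
  assumes "q > 0" "q \<le> Re p" "norm z \<le> Z" "t > 0"
  shows "norm (exp (- p * of_real t ^ 2 - z * of_real t)) \<le> exp ((Z + 1)\<^sup>2 / (4 * q)) * exp (- 1 * t)"
proof -
  have "Re (- p * of_real t ^ 2 - z * of_real t) = - Re p * t\<^sup>2 - Re z * t"
    by (simp flip: of_real_power)
  also have "\<dots> \<le> - q * t\<^sup>2 + Z * t"
  proof -
    have "q * t\<^sup>2 \<le> Re p * t\<^sup>2" using assms by (intro mult_right_mono) auto
    moreover have "- Re z * t \<le> Z * t"
      using assms abs_Re_le_cmod[of z] by (intro mult_right_mono) auto
    ultimately show ?thesis by simp
  qed
  also have "\<dots> \<le> (Z + 1)\<^sup>2 / (4 * q) - t"
  proof -
    have "0 \<le> (2 * q * t - (Z + 1))\<^sup>2" by simp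
    then have "4 * q * (Z + 1) * t \<le> (Z + 1)\<^sup>2 + 4 * q * (q * t\<^sup>2)"
      by (simp add: power2_eq_square algebra_simps)
    then show ?thesis using \<open>q > 0\<close> by (simp add: field_simps)
  qed
  finally show ?thesis by (simp flip: exp_add)
qed

lemma norm_gauss_le_exp:
  assumes "0 \<le> Re p" "t > 0"
  shows "norm (exp (- p * of_real t ^ 2 - z * of_real t)) \<le> exp (- Re z * t)"
  using assms by (simp flip: of_real_power)

lemma gauss_dominated_Re_pos: "Re p > 0 \<Longrightarrow> gauss_dominated p z"
  unfolding gauss_dominated_def using norm_gauss_le[of "Re p" p z "norm z"] by (meson order_refl zero_less_one)

lemma gauss_dominated_Re_nonneg: "\<lbrakk>Re p \<ge> 0; Re z > 0\<rbrakk> \<Longrightarrow> gauss_dominated p z"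
  unfolding gauss_dominated_def using norm_gauss_le_exp[of p _ z] by (metis mult_1)

lemma set_integrable_gauss:
  assumes "Re s > 0" "gauss_dominated p z"
  shows "set_integrable lborel {0<..} (\<lambda>t. of_real t powr (s - 1) * exp (- p * of_real t ^ 2 - z * of_real t))"
proof -
  obtain K c where c: "c > 0"
    and bound: "\<And>t. t > 0 \<Longrightarrow> norm (exp (- p * of_real t ^ 2 - z * of_real t)) \<le> K * exp (- c * t)"
    using assms by (auto simp: gauss_dominated_def)
  have "set_integrable lborel {0<..} (\<lambda>t. K * (t powr (Re s - 1) * exp (- c * t)))"
    by (intro set_integrable_mult_right impI set_integrable_powr_exp_real assms c)
  then show ?thesis
  proof (rule set_integrable_bound)
    have "continuous_on {0<..} (\<lambda>t::real. of_real t powr (s - 1) * exp (- p * of_real t ^ 2 - z * of_real t))"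
      by (intro continuous_intros) auto
    then show "set_borel_measurable lborel {0<..} (\<lambda>t::real. of_real t powr (s - 1) * exp (- p * of_real t ^ 2 - z * of_real t))"
      unfolding set_borel_measurable_def
      using borel_measurable_continuous_on_indicator[of "{0<..}"] by simp
    show "AE x in lborel. x \<in> {0<..} \<longrightarrow> norm (of_real x powr (s - 1) * exp (- p * of_real x ^ 2 - z * of_real x))
      \<le> norm (K * (x powr (Re s - 1) * exp (- c * x)))"
    proof (intro AE_I2 impI)
      fix x :: real assume x: "x \<in> {0<..}"
      have "norm (of_real x powr (s - 1) * exp (- p * of_real x ^ 2 - z * of_real x)) \<le> x powr (Re s - 1) * (K * exp (- c * x))"
        unfolding norm_mult using x bound[of x]
        by (intro mult_mono) (auto simp: norm_of_real_powr)
      also have "\<dots> \<le> norm (K * (x powr (Re s - 1) * exp (- c * x)))"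
        using abs_ge_self[of "K * (x powr (Re s - 1) * exp (- c * x))"] by (simp add: mult_ac)
      finally show "norm (of_real x powr (s - 1) * exp (- p * of_real x ^ 2 - z * of_real x))
        \<le> norm (K * (x powr (Re s - 1) * exp (- c * x)))" .
    qed
  qed
qed

lemma gauss_int_has_field_derivative_Re_pos:
  assumes s: "Re s > 0" and S: "open S" "w0 \<in> S" and p: "p holomorphic_on S" and z: "z holomorphic_on S"
    and "Re (p w0) > 0"
  shows "((\<lambda>w. gauss_int s (p w) (z w)) has_field_derivative
      (- deriv p w0 * gauss_int (s + 2) (p w0) (z w0) - deriv z w0 * gauss_int (s + 1) (p w0) (z w0))) (at w0)"
proof -
  let ?q = "Re (p w0) / 2"
  have cont: "isCont p w0" "isCont z w0"
    using p z S holomorphic_on_imp_continuous_on continuous_on_eq_continuous_at by blast+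
  have "\<forall>\<^sub>F w in nhds w0. w \<in> S" using S by (rule eventually_nhds_in_open)
  moreover have "\<forall>\<^sub>F w in nhds w0. ?q < Re (p w)"
    using cont(1) \<open>Re (p w0) > 0\<close>
    by (intro order_tendstoD(1)[where y = "Re (p w0)"] tendsto_Re) (auto simp: continuous_at tendsto_at_iff_tendsto_nhds)
  moreover have "\<forall>\<^sub>F w in nhds w0. norm (z w) < norm (z w0) + 1"
    using cont(2) by (intro order_tendstoD(2)[where y = "norm (z w0)"] tendsto_norm) (auto simp: continuous_at tendsto_at_iff_tendsto_nhds)
  ultimately have "\<forall>\<^sub>F w in nhds w0. w \<in> S \<and> ?q < Re (p w) \<and> norm (z w) < norm (z w0) + 1"
    by eventually_elim auto
  then obtain r where r: "r > 0" and ball: "\<And>w. w \<in> ball w0 r \<Longrightarrow> w \<in> S \<and> ?q < Re (p w) \<and> norm (z w) < norm (z w0) + 1"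
    by (auto simp: eventually_nhds_metric dist_commute)
  show ?thesis
  proof (rule gauss_int_has_field_derivative[OF s r, of 1])
    show "p holomorphic_on ball w0 r" "z holomorphic_on ball w0 r"
      using p z ball by (auto elim!: holomorphic_on_subset)
    show "norm (exp (- p w * of_real t ^ 2 - z w * of_real t))
        \<le> exp ((norm (z w0) + 1 + 1)\<^sup>2 / (4 * ?q)) * exp (- 1 * t)" if "w \<in> ball w0 r" "t > 0" for w t
      using ball[OF that(1)] that(2) \<open>Re (p w0) > 0\<close> by (intro norm_gauss_le) auto
  qed simp
qed

text \<open>At \<open>p = 0\<close> no Gaussian factor helps; the decay comes from
  \<open>Re w \<ge> Re z / 2\<close> on the ball of radius \<open>Re z / 2\<close>.\<close>

lemma gauss_int_0_has_field_derivative: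
  assumes s: "Re s > 0" and "Re z > 0"
  shows "(gauss_int s 0 has_field_derivative - gauss_int (s + 1) 0 z) (at z)"
proof -
  have "((\<lambda>w. gauss_int s ((\<lambda>_. 0) w) ((\<lambda>w. w) w)) has_field_derivative
      (- deriv (\<lambda>_. 0) z * gauss_int (s + 2) ((\<lambda>_. 0) z) ((\<lambda>w. w) z) - deriv (\<lambda>w. w) z * gauss_int (s + 1) ((\<lambda>_. 0) z) ((\<lambda>w. w) z))) (at z)"
  proof (rule gauss_int_has_field_derivative[OF s, of "Re z / 2" "Re z / 2"])
    show "norm (exp (- 0 * of_real t ^ 2 - w * of_real t)) \<le> 1 * exp (- (Re z / 2) * t)"
      if "w \<in> ball z (Re z / 2)" "t > 0" for w t
    proof -
      have "Re (z - w) < Re z / 2"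
        using that complex_Re_le_cmod[of "z - w"] by (simp add: dist_norm)
      then have "Re z / 2 \<le> Re w" by simp
      then show ?thesis using that by simp
    qed
  qed (use \<open>Re z > 0\<close> in auto)
  then show ?thesis by simp
qed

lemma set_integral_FTC_halfline:
  fixes f F :: "real \<Rightarrow> 'a::euclidean_space"
  assumes F: "\<And>x. x > 0 \<Longrightarrow> (F has_vector_derivative f x) (at x)"
    and f: "continuous_on {0<..} f" and int: "set_integrable lborel {0<..} f"
    and A: "(F \<longlongrightarrow> A) (at_right 0)" and B: "(F \<longlongrightarrow> B) at_top"
  shows "(LINT x:{0<..}|lborel. f x) = B - A"
proof -
  have "(LBINT x=ereal 0..\<infinity>. f x) = B - A"
  proof (rule interval_integral_FTC_integrable)
    show "isCont f x" if "ereal 0 < ereal x" for x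
      using f that by (simp add: continuous_on_eq_continuous_at)
  qed (use F int A B in \<open>auto simp: einterval_eq ereal_tendsto_simps\<close>)
  then show ?thesis
    by (simp add: interval_lebesgue_integral_def einterval_eq)
qed

text \<open>Integrate the derivative of t^s exp(-p t^2 - z t): both boundary terms vanish, at 0
  because \<open>Re s > 0\<close>. This one relation yields the Laplace transform, the rotation of
  the ray and Weber's equation.\<close>

lemma gauss_int_parts:
  assumes s: "Re s > 0" and dom: "gauss_dominated p z"
  shows "s * gauss_int s p z = 2 * p * gauss_int (s + 2) p z + z * gauss_int (s + 1) p z"
proof -
  let ?e = "\<lambda>t::real. exp (- p * of_real t ^ 2 - z * of_real t)"
  let ?F = "\<lambda>t::real. of_real t powr s * ?e t"
  let ?f = "\<lambda>t::real. s * (of_real t powr (s - 1) * ?e t) - 2 * p * (of_real t powr (s + 2 - 1) * ?e t)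
    - z * (of_real t powr (s + 1 - 1) * ?e t)"
  have i: "set_integrable lborel {0<..} (\<lambda>t. c * (of_real t powr (s' - 1) * ?e t))" if "Re s' > 0" for s' c
    by (intro set_integrable_mult_right impI set_integrable_gauss that dom)
  have pos: "Re (s + 1) > 0" "Re (s + 2) > 0" using s by auto
  obtain K c where c: "c > 0" and bound: "\<And>t. t > 0 \<Longrightarrow> norm (?e t) \<le> K * exp (- c * t)"
    using dom by (auto simp: gauss_dominated_def)
  have bF: "norm (?F t) \<le> t powr Re s * (K * exp (- c * t))" if "t > 0" for t
    unfolding norm_mult using that bound[OF that] by (intro mult_mono) (auto simp: norm_of_real_powr)
  have "(LINT t:{0<..}|lborel. ?f t) = 0 - 0"
  proof (rule set_integral_FTC_halfline)
    show "(?F has_vector_derivative ?f t) (at t)" if "t > 0" for t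
    proof -
      have pw: "of_real t powr s = (of_real t powr (s - 1) * of_real t :: complex)"
        "of_real t powr (1 + s) = (of_real t powr (s - 1) * of_real t ^ 2 :: complex)"
        using that powr_add[of "of_real t :: complex" "s - 1" 1] powr_add[of "of_real t :: complex" "s - 1" 2]
        by (simp_all add: algebra_simps)
      have "((\<lambda>u. u powr s * exp (- p * u ^ 2 - z * u)) has_field_derivative ?f t) (at (of_real t))"
        using that by (auto intro!: derivative_eq_intros simp: pw power2_eq_square algebra_simps)
      then show ?thesis by (rule has_vector_derivative_real_field)
    qed
    show "continuous_on {0<..} ?f" by (intro continuous_intros) auto
    show "set_integrable lborel {0<..} ?f" by (intro set_integral_diff i s pos)
    have "((\<lambda>t. t powr Re s * (K * exp (- c * t))) \<longlongrightarrow> 0) (at_right 0)"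
      using s by real_asymp
    then show "(?F \<longlongrightarrow> 0) (at_right 0)"
      by (rule Lim_null_comparison[rotated]) (use bF in \<open>auto simp: eventually_at_right_less intro: eventually_mono[OF eventually_at_right_less]\<close>)
    have "((\<lambda>t. t powr Re s * (K * exp (- c * t))) \<longlongrightarrow> 0) at_top"
      using c by real_asymp
    then show "(?F \<longlongrightarrow> 0) at_top"
      by (rule Lim_null_comparison[rotated]) (use bF in \<open>auto intro: eventually_mono[OF eventually_gt_at_top[of 0]]\<close>)
  qed
  moreover have "(LINT t:{0<..}|lborel. ?f t) = s * gauss_int s p z - 2 * p * gauss_int (s + 2) p z - z * gauss_int (s + 1) p z"
    unfolding gauss_int_def
    by (simp only: set_integral_diff i s pos set_integral_mult_right)
  ultimately show ?thesis by (simp add: algebra_simps)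
qed

text \<open>By \<open>gauss_int_parts\<close> the product of \<open>z powr s\<close> with the
  integral has derivative 0 on the right half-plane; its constant value is read off at
  \<open>z = 1\<close> from Euler's integral.\<close>

lemma gauss_int_0:
  assumes s: "Re s > 0" and z: "Re z > 0"
  shows "gauss_int s 0 z = Gamma s * z powr (- s)"
proof -
  let ?H = "{z. Re z > 0}"
  have "\<exists>c. \<forall>z\<in>?H. z powr s * gauss_int s 0 z = c"
  proof (rule has_field_derivative_zero_constant)
    show "convex ?H" by (rule convex_halfspace_Re_gt)
    show "((\<lambda>z. z powr s * gauss_int s 0 z) has_field_derivative 0) (at z within ?H)" if "z \<in> ?H" for z
    proof (rule has_field_derivative_at_within)
      have z: "Re z > 0" using that by simp
      then have nz: "z \<notin> \<real>\<^sub>\<le>\<^sub>0" "z \<noteq> 0" by (auto simp: complex_nonpos_Reals_iff)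
      have "((\<lambda>z. z powr s * gauss_int s 0 z) has_field_derivative
          s * z powr (s - 1) * gauss_int s 0 z - z powr s * gauss_int (s + 1) 0 z) (at z)"
        using gauss_int_0_has_field_derivative[OF s z] nz by (auto intro!: derivative_eq_intros)
      moreover have "s * gauss_int s 0 z = z * gauss_int (s + 1) 0 z"
        using gauss_int_parts[OF s gauss_dominated_Re_nonneg[of 0, OF _ z]] by simp
      then have "s * z powr (s - 1) * gauss_int s 0 z = z powr (s - 1) * z * gauss_int (s + 1) 0 z"
        by (simp add: mult_ac)
      moreover have "z powr s = z powr (s - 1) * z"
        using powr_add[of z "s - 1" 1] nz by simp
      ultimately show "((\<lambda>z. z powr s * gauss_int s 0 z) has_field_derivative 0) (at z)" by simp
    qed
  qed
  then obtain c where c: "\<And>z. Re z > 0 \<Longrightarrow> z powr s * gauss_int s 0 z = c" by auto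
  have "gauss_int s 0 1 = Gamma s"
  proof -
    have "gauss_int s 0 1 = integral {0<..} (\<lambda>t. of_real t powr (s - 1) * exp (- of_real t))"
      unfolding gauss_int_def
      using set_borel_integral_eq_integral(2)[OF set_integrable_gauss[OF s gauss_dominated_Re_nonneg[of 0 1]]] by simp
    also have "\<dots> = integral {0<..} (\<lambda>t. of_real t powr (s - 1) / of_real (exp t))"
      by (simp add: exp_minus field_simps flip: exp_of_real)
    also have "\<dots> = Gamma s"
      using Gamma_integral_complex'[OF s] by (rule integral_unique)
    finally show ?thesis .
  qed
  then have "z powr s * gauss_int s 0 z = Gamma s" using c[of 1] c[OF z] by simp
  moreover have "z \<noteq> 0" using z by auto
  ultimately show ?thesis by (simp add: powr_minus field_simps)
qed

text \<open>This is the substitution t -> w t along a complex direction. Instead of closing a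
  contour, the left-hand side is differentiated in \<open>w\<close>: its derivative vanishes by
  \<open>gauss_int_parts\<close>, and at \<open>w = 1\<close> it is the right-hand side. The sector
  |arg w| < pi/4 is where \<open>w\<^sup>2\<close> keeps a positive real part.\<close>

lemma gauss_int_rotate:
  assumes s: "Re s > 0" and p: "p > 0" and w: "Re w > \<bar>Im w\<bar>"
  shows "w powr s * gauss_int s (of_real p * w\<^sup>2) (w * z) = gauss_int s (of_real p) z"
proof -
  let ?H = "{w. Re w > \<bar>Im w\<bar>}"
  \<comment> \<open>Written as an intersection of two half-planes, the sector is visibly
    convex.\<close>
  have H: "?H = {w. (1 + \<i>) \<bullet> w > 0} \<inter> {w. (1 - \<i>) \<bullet> w > 0}" by (auto simp: inner_complex_def)
  have "\<exists>c. \<forall>w\<in>?H. w powr s * gauss_int s (of_real p * w\<^sup>2) (w * z) = c"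
  proof (rule has_field_derivative_zero_constant)
    show "convex ?H" unfolding H by (intro convex_Int convex_halfspace_gt)
    show "((\<lambda>w. w powr s * gauss_int s (of_real p * w\<^sup>2) (w * z)) has_field_derivative 0) (at w within ?H)" if "w \<in> ?H" for w
    proof (rule has_field_derivative_at_within)
      have w: "w \<notin> \<real>\<^sub>\<le>\<^sub>0" "w \<noteq> 0" using that by (auto simp: complex_nonpos_Reals_iff)
      have "(Re w)\<^sup>2 > (Im w)\<^sup>2"
        using that power_strict_mono[of "\<bar>Im w\<bar>" "Re w" 2] by simp
      then have pos: "Re (of_real p * w\<^sup>2) > 0" using p by (simp add: Re_power2)
      have dw: "deriv (\<lambda>w. of_real p * w\<^sup>2) w = 2 * of_real p * w"
        by (rule DERIV_imp_deriv) (auto intro!: derivative_eq_intros)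
      have d: "((\<lambda>w. gauss_int s (of_real p * w\<^sup>2) (w * z)) has_field_derivative
          - (2 * of_real p * w) * gauss_int (s + 2) (of_real p * w\<^sup>2) (w * z) - z * gauss_int (s + 1) (of_real p * w\<^sup>2) (w * z)) (at w)"
        using gauss_int_has_field_derivative_Re_pos[OF s open_UNIV UNIV_I, of "\<lambda>w. of_real p * w\<^sup>2" "\<lambda>w. w * z" w] pos
          dw
        by (simp add: holomorphic_intros)
      show "((\<lambda>w. w powr s * gauss_int s (of_real p * w\<^sup>2) (w * z)) has_field_derivative 0) (at w)"
      proof -
        have "((\<lambda>w. w powr s * gauss_int s (of_real p * w\<^sup>2) (w * z)) has_field_derivative
          s * w powr (s - 1) * gauss_int s (of_real p * w\<^sup>2) (w * z)
          + w powr s * (- (2 * of_real p * w) * gauss_int (s + 2) (of_real p * w\<^sup>2) (w * z) - z * gauss_int (s + 1) (of_real p * w\<^sup>2) (w * z))) (at w)"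
          using d w by (auto intro!: derivative_eq_intros)
        moreover have "s * w powr (s - 1) * gauss_int s (of_real p * w\<^sup>2) (w * z) = w powr (s - 1) * (s * gauss_int s (of_real p * w\<^sup>2) (w * z))"
          by simp
        moreover have "w powr s = w powr (s - 1) * w"
          using powr_add[of w "s - 1" 1] w by simp
        ultimately show ?thesis
          unfolding gauss_int_parts[OF s gauss_dominated_Re_pos[OF pos]]
          by (simp add: algebra_simps power2_eq_square)
      qed
    qed
  qed
  then obtain c where c: "\<And>w. Re w > \<bar>Im w\<bar> \<Longrightarrow> w powr s * gauss_int s (of_real p * w\<^sup>2) (w * z) = c" by auto
  show ?thesis using c[OF w] c[of 1] by simp
qed

section \<open>The integral representation of U\<close>

text \<open>This is \<open>\<Gamma>(s) U(s - 1/2, z)\<close> for \<open>Re s > 0\<close>.\<close>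

definition pcf_int :: "complex \<Rightarrow> complex \<Rightarrow> complex" where
  "pcf_int s z = exp (- z\<^sup>2 / 4) * gauss_int s (1 / 2) z"

lemma gauss_dominated_half [simp]: "gauss_dominated (1 / 2) z"
  by (rule gauss_dominated_Re_pos) simp

lemma pcf_int_parts:
  assumes "Re s > 0"
  shows "s * pcf_int s z = pcf_int (s + 2) z + z * pcf_int (s + 1) z"
proof -
  have "s * pcf_int s z = exp (- z\<^sup>2 / 4) * (s * gauss_int s (1 / 2) z)"
    by (simp add: pcf_int_def)
  then show ?thesis
    by (simp only: gauss_int_parts[OF assms gauss_dominated_half]) (simp add: pcf_int_def distrib_left)
qed

lemma pcf_int_has_field_derivative:
  assumes s: "Re s > 0"
  shows "(pcf_int s has_field_derivative (- (z / 2) * pcf_int s z - pcf_int (s + 1) z)) (at z)"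
proof -
  have "((\<lambda>w. gauss_int s ((\<lambda>_. 1 / 2) w) ((\<lambda>w. w) w)) has_field_derivative
      (- deriv (\<lambda>_. 1 / 2) z * gauss_int (s + 2) ((\<lambda>_. 1 / 2) z) ((\<lambda>w. w) z)
       - deriv (\<lambda>w. w) z * gauss_int (s + 1) ((\<lambda>_. 1 / 2) z) ((\<lambda>w. w) z))) (at z)"
    by (rule gauss_int_has_field_derivative_Re_pos[OF s open_UNIV]) auto
  then have d: "(gauss_int s (1 / 2) has_field_derivative - gauss_int (s + 1) (1 / 2) z) (at z)"
    by simp
  show ?thesis
    unfolding pcf_int_def [abs_def]
    by (auto intro!: derivative_eq_intros d simp: algebra_simps)
qed

lemma deriv_pcf_int:
  assumes "Re s > 0"
  shows "deriv (pcf_int s) = (\<lambda>z. - (z / 2) * pcf_int s z - pcf_int (s + 1) z)"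
  using DERIV_imp_deriv[OF pcf_int_has_field_derivative[OF assms]] by (intro ext)

text \<open>Two differentiations produce the orders \<open>s\<close>, \<open>s + 1\<close> and
  \<open>s + 2\<close>; eliminating \<open>s + 2\<close> by \<open>pcf_int_parts\<close> also
  cancels \<open>s + 1\<close> and leaves Weber's equation with parameter
  \<open>s - 1 / 2\<close>.\<close>

lemma pcf_int_has_field_derivative2:
  assumes s: "Re s > 0"
  shows "(deriv (pcf_int s) has_field_derivative (z\<^sup>2 / 4 + s - 1 / 2) * pcf_int s z) (at z)"
proof -
  have s1: "Re (s + 1) > 0" using s by simp
  have "(deriv (pcf_int s) has_field_derivative
      (- (1 / 2) * pcf_int s z + - (z / 2) * (- (z / 2) * pcf_int s z - pcf_int (s + 1) z)
       - (- (z / 2) * pcf_int (s + 1) z - pcf_int (s + 2) z))) (at z)"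
    unfolding deriv_pcf_int[OF s]
    using DERIV_diff[OF DERIV_mult'[OF DERIV_minus[OF DERIV_cdivide[OF DERIV_ident, of 2]]
          pcf_int_has_field_derivative[OF s]] pcf_int_has_field_derivative[OF s1], of z]
    by (simp add: add.assoc algebra_simps)
  moreover have "pcf_int (s + 2) z = s * pcf_int s z - z * pcf_int (s + 1) z"
    using pcf_int_parts[OF s, of z] by simp
  ultimately show ?thesis by (simp add: algebra_simps power2_eq_square)
qed

lemma holomorphic_pcf_int: "Re s > 0 \<Longrightarrow> pcf_int s holomorphic_on A"
  by (rule holomorphic_on_subset[of _ UNIV])
    (auto simp: holomorphic_on_open intro!: exI pcf_int_has_field_derivative)

section \<open>Asymptotics in the full sector\<close>

lemma norm_exp_minus_1_le:
  assumes "Re u \<le> 0"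
  shows "norm (exp u - 1) \<le> norm (u :: complex)"
proof -
  have "norm (exp u - exp 0) \<le> 1 * norm (u - 0)"
    by (rule field_differentiable_bound[OF convex_halfspace_Re_le[of 0], where f' = exp])
      (use assms in \<open>auto intro: DERIV_subset[OF DERIV_exp]\<close>)
  then show ?thesis by simp
qed

text \<open>Dropping the Gaussian factor costs at most |p| t^2 pointwise, so the error is a Laplace
  integral of order \<open>Re s + 2\<close>: two powers of |z| smaller than the main term.\<close>

lemma gauss_int_diff_le:
  assumes s: "Re s > 0" and p: "Re p \<ge> 0" and z: "Re z > 0"
  shows "norm (gauss_int s p z - gauss_int s 0 z) \<le> norm p * norm (gauss_int (of_real (Re s + 2)) 0 (of_real (Re z)))"
proof -
  let ?e = "\<lambda>p t. of_real t powr (s - 1) * exp (- p * of_real t ^ 2 - z * of_real t)"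
  let ?g = "\<lambda>t::real. t powr (Re s + 2 - 1) * exp (- Re z * t)"
  have i: "set_integrable lborel {0<..} (?e p)" "set_integrable lborel {0<..} (?e 0)"
    using set_integrable_gauss[OF s gauss_dominated_Re_nonneg[OF p z]]
      set_integrable_gauss[OF s gauss_dominated_Re_nonneg[OF _ z, of 0]] by simp_all
  have ig: "set_integrable lborel {0<..} ?g"
    using set_integrable_powr_exp_real[of "Re s + 2" "Re z"] s z by simp
  have diff: "gauss_int s p z - gauss_int s 0 z = (LINT t:{0<..}|lborel. ?e p t - ?e 0 t)"
    unfolding gauss_int_def using i by (simp only: set_integral_diff)
  have "norm (gauss_int s p z - gauss_int s 0 z) \<le> (LINT t:{0<..}|lborel. norm (?e p t - ?e 0 t))"
    unfolding diff by (rule set_integral_norm_bound) (intro set_integral_diff i)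
  also have "\<dots> \<le> (LINT t:{0<..}|lborel. norm p * ?g t)"
  proof (rule set_integral_mono)
    show "set_integrable lborel {0<..} (\<lambda>t. norm (?e p t - ?e 0 t))"
      by (intro set_integrable_norm set_integral_diff i)
    show "set_integrable lborel {0<..} (\<lambda>t. norm p * ?g t)"
      by (intro set_integrable_mult_right impI ig)
    show "norm (?e p t - ?e 0 t) \<le> norm p * ?g t" if "t \<in> {0<..}" for t
    proof -
      have t: "t > 0" using that by simp
      have e: "?e p t - ?e 0 t = of_real t powr (s - 1) * exp (- z * of_real t) * (exp (- p * of_real t ^ 2) - 1)"
      proof -
        have "exp (- p * of_real t ^ 2 - z * of_real t) = exp (- z * of_real t) * exp (- p * of_real t ^ 2)"
          unfolding exp_add[symmetric] by (rule arg_cong[of _ _ exp]) simp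
        then show ?thesis by (simp only:) (simp add: right_diff_distrib)
      qed
      have "norm (?e p t - ?e 0 t) \<le> t powr (Re s - 1) * exp (- Re z * t) * norm (- p * of_real t ^ 2)"
      proof -
        have "Re (- p * of_real t ^ 2) \<le> 0" using p by (simp flip: of_real_power)
        from norm_exp_minus_1_le[OF this] show ?thesis
          unfolding e norm_mult[of "_ * _" "exp _ - 1"] using t
          by (intro mult_mono) (simp_all add: norm_mult norm_of_real_powr)
      qed
      also have "\<dots> = norm p * ?g t"
      proof -
        have "t powr (Re s + 2 - 1) = t powr (Re s - 1) * t\<^sup>2"
          using t powr_add[of t "Re s - 1" 2] by (simp add: algebra_simps)
        then show ?thesis by (simp only: norm_mult norm_minus_cancel norm_power norm_of_real) simp
      qed
      finally show ?thesis .
    qed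
  qed
  also have "\<dots> = norm p * norm (gauss_int (of_real (Re s + 2)) 0 (of_real (Re z)))"
  proof -
    have "gauss_int (of_real (Re s + 2)) 0 (of_real (Re z)) = (LINT t:{0<..}|lborel. complex_of_real (?g t))"
      unfolding gauss_int_def
    proof (rule set_lebesgue_integral_cong)
      have "complex_of_real t powr (of_real (Re s + 2) - 1) = of_real (t powr (Re s + 2 - 1))" if "t > 0" for t
        using that powr_of_real[of t "Re s + 2 - 1"] by simp
      moreover have "exp (- 0 * of_real t ^ 2 - of_real (Re z) * of_real t) = complex_of_real (exp (- Re z * t))" for t
        unfolding exp_of_real[symmetric] by simp
      ultimately show "\<forall>t. t \<in> {0<..} \<longrightarrow> complex_of_real t powr (of_real (Re s + 2) - 1)
          * exp (- 0 * of_real t ^ 2 - of_real (Re z) * of_real t) = of_real (?g t)"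
        by (simp only: of_real_mult greaterThan_iff) simp
    qed simp
    also have "\<dots> = of_real (LINT t:{0<..}|lborel. ?g t)"
      by (rule set_integral_complex_of_real)
    also have "norm \<dots> = (LINT t:{0<..}|lborel. ?g t)"
      by (auto intro!: abs_of_nonneg Bochner_Integration.integral_nonneg simp: set_lebesgue_integral_def)
    finally show ?thesis by simp
  qed
  finally show ?thesis .
qed

text \<open>Turn the ray by an angle \<open>\<theta>\<close> below pi/4, against the sign of
  \<open>Arg z\<close>, so that \<open>w * z\<close> lies strictly inside the right half-plane; then
  compare with the Laplace transform. The error is O(1 / |z|^2), uniformly in the sector.\<close>

lemma tendsto_powr_gauss_int:
  assumes s: "Re s > 0" and \<delta>: "\<delta> > 0"
  shows "((\<lambda>z. z powr s * gauss_int s (1 / 2) z) \<longlongrightarrow> Gamma s) (inf at_infinity (principal (pcf_sector \<delta>)))"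
proof -
  \<comment> \<open>Shrinking \<open>\<delta>\<close> only enlarges the sector; the cap pi/4 keeps
    \<open>\<theta>\<close> positive. The choice of \<open>\<theta>\<close> splits the margin
    evenly: 3 pi/4 - \<open>\<delta>'\<close> - \<open>\<theta>\<close> = pi/2 -
    \<open>\<delta>'\<close> / 2.\<close>
  define \<delta>' where "\<delta>' = min \<delta> (pi / 4)"
  have \<delta>': "0 < \<delta>'" "\<delta>' \<le> \<delta>" "\<delta>' \<le> pi / 4" using \<delta> by (auto simp: \<delta>'_def)
  define \<theta> where "\<theta> = pi / 4 - \<delta>' / 2"
  have \<theta>: "0 < \<theta>" "\<theta> < pi / 4" using \<delta>' by (auto simp: \<theta>_def)
  define c where "c = sin (\<delta>' / 2)"
  have c: "c > 0" unfolding c_def using \<delta>' by (intro sin_gt_zero) auto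
  \<comment> \<open>The exponential bounds the arguments' contribution to \<open>z powr s\<close>
    and \<open>w powr s\<close>; \<open>c\<close> is the lower bound of Re(w z) / |z| in the
    sector.\<close>
  define C where "C = exp (2 * pi * \<bar>Im s\<bar>) * norm (Gamma (of_real (Re s + 2) :: complex)) * c powr (- (Re s + 2))"
  have main: "norm (z powr s * gauss_int s (1 / 2) z - Gamma s) \<le> C / norm z ^ 2"
    if z: "z \<noteq> 0" and sec: "z \<in> pcf_sector \<delta>" for z
  proof -
    define w where "w = cis (if Arg z \<ge> 0 then - \<theta> else \<theta>)"
    have Argw: "Arg w = (if Arg z \<ge> 0 then - \<theta> else \<theta>)"
      unfolding w_def using \<theta> by (intro Arg_cis) auto
    have nw: "norm w = 1" "w \<noteq> 0" by (auto simp: w_def)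
    have ang: "\<bar>Arg z + Arg w\<bar> \<le> pi / 2 - \<delta>' / 2"
      using sec \<delta>' unfolding Argw pcf_sector_def \<theta>_def by (auto simp: abs_le_iff)
    \<comment> \<open>The sum of the arguments stays within the principal branch, so the principal
      powers of \<open>w\<close> and \<open>z\<close> multiply.\<close>
    have LnW: "Ln (w * z) = Ln w + Ln z"
      using ang z nw \<delta>' by (intro Ln_times_simple) (auto simp: Arg_eq_Im_Ln[symmetric] abs_le_iff)
    have Rewz: "Re (w * z) \<ge> c * norm z"
    proof -
      have "w * z = rcis (norm z) (Arg z + Arg w)"
      proof -
        have "w * z = rcis (norm w) (Arg w) * rcis (norm z) (Arg z)" by (simp only: rcis_cmod_Arg)
        then show ?thesis by (simp add: rcis_mult nw add.commute)
      qed
      moreover have "c \<le> cos (Arg z + Arg w)"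
      proof -
        have "c = cos (pi / 2 - \<delta>' / 2)" by (simp add: c_def cos_diff)
        also have "\<dots> \<le> cos \<bar>Arg z + Arg w\<bar>"
          using ang \<delta>' by (intro cos_monotone_0_pi_le) auto
        finally show ?thesis by simp
      qed
      ultimately show ?thesis
        using mult_left_mono[of c "cos (Arg z + Arg w)" "norm z"] by (simp add: mult.commute)
    qed
    have pos: "Re (w * z) > 0"
      using Rewz c z by (smt (verit) mult_pos_pos zero_less_norm_iff)
    have Rew: "Re w > \<bar>Im w\<bar>"
    proof -
      have "sin \<theta> < cos \<theta>"
      proof -
        have "sin \<theta> < sin (pi / 2 - \<theta>)" using \<theta> by (intro sin_monotone_2pi) auto
        then show ?thesis by (simp add: sin_diff)
      qed
      moreover have "0 \<le> sin \<theta>" using \<theta> by (intro sin_ge_zero) auto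
      ultimately show ?thesis by (simp add: w_def)
    qed
    have Rew2: "Re (w\<^sup>2 / 2) \<ge> 0"
      using Rew power_mono[of "\<bar>Im w\<bar>" "Re w" 2] by (simp add: Re_power2)
    have "z powr s * gauss_int s (1 / 2) z - Gamma s
        = z powr s * w powr s * (gauss_int s (w\<^sup>2 / 2) (w * z) - gauss_int s 0 (w * z))"
    proof -
      have "z powr s * w powr s * gauss_int s 0 (w * z) = Gamma s"
        using LnW z nw
        by (simp add: gauss_int_0[OF s pos] powr_def exp_add[symmetric] ring_distribs)
      moreover have "z powr s * w powr s * gauss_int s (w\<^sup>2 / 2) (w * z) = z powr s * gauss_int s (1 / 2) z"
        using gauss_int_rotate[OF s _ Rew, of "1 / 2" z] by (simp add: mult.assoc)
      ultimately show ?thesis by (simp only: right_diff_distrib)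
    qed
    also have "norm \<dots> \<le> (norm z powr Re s * exp (pi * \<bar>Im s\<bar>) * exp (pi * \<bar>Im s\<bar>))
        * (1 * norm (gauss_int (of_real (Re s + 2)) 0 (of_real (Re (w * z)))))"
      unfolding norm_mult
    proof (intro mult_mono)
      have e: "- Im s * Arg u \<le> pi * \<bar>Im s\<bar>" for u
      proof -
        have "- Im s * Arg u \<le> \<bar>Im s * Arg u\<bar>" by simp
        also have "\<dots> \<le> \<bar>Im s\<bar> * pi"
          unfolding abs_mult using Arg_bounded[of u] by (intro mult_left_mono) auto
        finally show ?thesis by (simp add: mult.commute)
      qed
      show "norm (z powr s) \<le> norm z powr Re s * exp (pi * \<bar>Im s\<bar>)"
        unfolding norm_powr_complex using e[of z] by (intro mult_left_mono) auto
      show "norm (w powr s) \<le> exp (pi * \<bar>Im s\<bar>)"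
        unfolding norm_powr_complex using e[of w] by (simp add: nw)
      have "norm (w\<^sup>2 / 2) \<le> 1" by (simp add: norm_power norm_divide nw)
      then show "norm (gauss_int s (w\<^sup>2 / 2) (w * z) - gauss_int s 0 (w * z))
          \<le> 1 * norm (gauss_int (of_real (Re s + 2)) 0 (of_real (Re (w * z))))"
        using order_trans[OF gauss_int_diff_le[OF s Rew2 pos] mult_right_mono] by (metis norm_ge_zero)
    qed auto
    also have "norm (gauss_int (of_real (Re s + 2)) 0 (of_real (Re (w * z))))
        = norm (Gamma (of_real (Re s + 2) :: complex)) * Re (w * z) powr (- (Re s + 2))"
    proof -
      have "Re (of_real (Re s + 2)) > 0" "Re (complex_of_real (Re (w * z))) > 0" using s pos by auto
      note eq = gauss_int_0[OF this] norm_of_real_powr[OF pos, of "- of_real (Re s + 2)"]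
      show ?thesis unfolding eq norm_mult by (simp del: times_complex.simps)
    qed
    also have "Re (w * z) powr (- (Re s + 2)) \<le> (c * norm z) powr (- (Re s + 2))"
      using Rewz c z s by (intro powr_mono2') auto
    also have "(norm z powr Re s * exp (pi * \<bar>Im s\<bar>) * exp (pi * \<bar>Im s\<bar>))
        * (1 * (norm (Gamma (of_real (Re s + 2) :: complex)) * (c * norm z) powr (- (Re s + 2)))) = C / norm z ^ 2"
    proof -
      have "norm z powr Re s * norm z powr (- (Re s + 2)) = norm z powr (- 2)"
        unfolding powr_add[symmetric] by simp
      then have "norm z powr Re s * norm z powr (- (Re s + 2)) = 1 / norm z ^ 2"
        using z by (simp add: powr_minus_divide)
      note eq = this
      have E: "exp (pi * \<bar>Im s\<bar>) * exp (pi * \<bar>Im s\<bar>) = exp (2 * pi * \<bar>Im s\<bar>)"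
        unfolding exp_add[symmetric] by simp
      have "(norm z powr Re s * exp (pi * \<bar>Im s\<bar>) * exp (pi * \<bar>Im s\<bar>))
          * (1 * (norm (Gamma (of_real (Re s + 2) :: complex)) * (c * norm z) powr (- (Re s + 2))))
          = (exp (pi * \<bar>Im s\<bar>) * exp (pi * \<bar>Im s\<bar>)) * norm (Gamma (of_real (Re s + 2) :: complex))
            * c powr (- (Re s + 2)) * (norm z powr Re s * norm z powr (- (Re s + 2)))"
        using c by (simp add: powr_mult mult_ac)
      then show ?thesis unfolding eq E by (simp add: C_def)
    qed
    finally show ?thesis by (simp add: mult_left_mono)
  qed
  have "((\<lambda>z::complex. C / norm z ^ 2) \<longlongrightarrow> 0) at_infinity"
    by (intro real_tendsto_divide_at_top[OF tendsto_const] filterlim_pow_at_top filterlim_norm_at_top) auto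
  then have "((\<lambda>z::complex. C / norm z ^ 2) \<longlongrightarrow> 0) (inf at_infinity (principal (pcf_sector \<delta>)))"
    by (rule tendsto_mono[rotated]) simp
  moreover have "\<forall>\<^sub>F z in inf at_infinity (principal (pcf_sector \<delta>)).
      norm (z powr s * gauss_int s (1 / 2) z - Gamma s) \<le> C / norm z ^ 2"
    unfolding eventually_inf_principal
    using eventually_not_equal_at_infinity[of 0] by eventually_elim (use main in auto)
  ultimately have "((\<lambda>z. z powr s * gauss_int s (1 / 2) z - Gamma s) \<longlongrightarrow> 0) (inf at_infinity (principal (pcf_sector \<delta>)))"
    by (rule Lim_null_comparison[rotated])
  then show ?thesis by (simp add: LIM_zero_iff)
qed

section \<open>Linear second order equations and uniqueness of U\<close>

definition ode_solution :: "(complex \<Rightarrow> complex) \<Rightarrow> (complex \<Rightarrow> complex) \<Rightarrow> bool" where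
  "ode_solution q f \<longleftrightarrow> f holomorphic_on UNIV \<and> (\<forall>z. (deriv f has_field_derivative q z * f z) (at z))"

lemma ode_solution_has_field_derivative:
  assumes "ode_solution q f"
  shows "(f has_field_derivative deriv f z) (at z)" "(deriv f has_field_derivative q z * f z) (at z)"
  using assms holomorphic_derivI[OF _ open_UNIV] by (auto simp: ode_solution_def)

text \<open>The equation has no first-order term. Wronskians can therefore be evaluated at 0, where
  Gamma values are available.\<close>

lemma ode_solution_wronskian_constant:
  assumes f: "ode_solution q f" and g: "ode_solution q g"
  shows "wronskian f g z = wronskian f g z'"
proof -
  have "\<exists>c. \<forall>z\<in>UNIV. wronskian f g z = c"
  proof (rule has_field_derivative_zero_constant)
    fix z
    have "((\<lambda>z. f z * deriv g z - deriv f z * g z) has_field_derivative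
        (f z * (q z * g z) + deriv f z * deriv g z) - (deriv f z * deriv g z + q z * f z * g z)) (at z)"
      by (intro DERIV_diff DERIV_mult' ode_solution_has_field_derivative[OF f] ode_solution_has_field_derivative[OF g])
    then show "(wronskian f g has_field_derivative 0) (at z within UNIV)"
      by (simp add: wronskian_def [abs_def] algebra_simps)
  qed simp
  then show ?thesis by auto
qed

lemma ode_solution_cmult_arg:
  assumes "ode_solution q f"
  shows "ode_solution (\<lambda>z. c\<^sup>2 * q (c * z)) (\<lambda>z. f (c * z))"
    and "deriv (\<lambda>z. f (c * z)) z = c * deriv f (c * z)"
proof -
  note d = ode_solution_has_field_derivative[OF assms]
  have 1: "((\<lambda>z. f (c * z)) has_field_derivative c * deriv f (c * z)) (at z)" for z
    using DERIV_chain'[OF DERIV_cmult_Id[of c] d(1)[of "c * z"]] by (simp add: mult.commute[of _ c])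
  then have D: "deriv (\<lambda>z. f (c * z)) = (\<lambda>z. c * deriv f (c * z))"
    by (auto intro!: ext DERIV_imp_deriv)
  then show "deriv (\<lambda>z. f (c * z)) z = c * deriv f (c * z)" by simp
  have "((\<lambda>z. c * deriv f (c * z)) has_field_derivative c * (q (c * z) * f (c * z) * c)) (at z)" for z
    using DERIV_cmult[OF DERIV_chain'[OF DERIV_cmult_Id[of c] d(2)[of "c * z"]], of c] by (simp only:)
  then show "ode_solution (\<lambda>z. c\<^sup>2 * q (c * z)) (\<lambda>z. f (c * z))"
    unfolding ode_solution_def D
    using 1 by (auto simp: holomorphic_on_open power2_eq_square mult_ac(1,2,3))
qed

lemma ode_solution_pcf_int: "Re s > 0 \<Longrightarrow> ode_solution (\<lambda>z. z\<^sup>2 / 4 + (s - 1 / 2)) (pcf_int s)"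
  using pcf_int_has_field_derivative2[of s] by (auto simp: ode_solution_def holomorphic_pcf_int algebra_simps)

lemma is_pcfU_imp_ode_solution:
  assumes "is_pcfU a f"
  shows "ode_solution (\<lambda>z. z\<^sup>2 / 4 + a) f"
proof -
  have hol: "f holomorphic_on UNIV" and ode: "\<And>z. deriv (deriv f) z = (z\<^sup>2 / 4 + a) * f z"
    using assms by (auto simp: is_pcfU_def eval_nat_numeral)
  have "deriv f holomorphic_on UNIV" using hol by (intro holomorphic_deriv) auto
  then have "(deriv f has_field_derivative deriv (deriv f) z) (at z)" for z
    by (rule holomorphic_derivI) auto
  then show ?thesis using hol ode by (simp add: ode_solution_def)
qed

section \<open>The solution characterised by its asymptotics: existence and uniqueness\<close>

lemma Re_pos_not_nonpos_Ints: "Re s > 0 \<Longrightarrow> s \<notin> \<int>\<^sub>\<le>\<^sub>0"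
  by (auto elim!: nonpos_Ints_cases)

lemma Gamma_nonzero_Re_pos: "Re s > 0 \<Longrightarrow> Gamma s \<noteq> 0"
  using Re_pos_not_nonpos_Ints by (simp add: Gamma_eq_zero_iff)

lemma is_pcfU_pcf_int:
  assumes "Re a > - 1 / 2"
  shows "is_pcfU a (\<lambda>z. pcf_int (a + 1 / 2) z / Gamma (a + 1 / 2))"
  unfolding is_pcfU_def
proof (intro conjI allI impI)
  let ?s = "a + 1 / 2"
  have s: "Re ?s > 0" using assms by simp
  have G: "Gamma ?s \<noteq> 0" by (rule Gamma_nonzero_Re_pos[OF s])
  have D1: "((\<lambda>z. pcf_int ?s z / Gamma ?s) has_field_derivative deriv (pcf_int ?s) z / Gamma ?s) (at z)" for z
    by (intro DERIV_cdivide ode_solution_has_field_derivative[OF ode_solution_pcf_int[OF s]])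
  have D2: "((\<lambda>z. deriv (pcf_int ?s) z / Gamma ?s) has_field_derivative
      (z\<^sup>2 / 4 + ?s - 1 / 2) * pcf_int ?s z / Gamma ?s) (at z)" for z
    by (intro DERIV_cdivide pcf_int_has_field_derivative2 s)
  show "(\<lambda>z. pcf_int ?s z / Gamma ?s) holomorphic_on UNIV"
    by (intro holomorphic_intros holomorphic_pcf_int s G)
  have "deriv (\<lambda>z. pcf_int ?s z / Gamma ?s) = (\<lambda>z. deriv (pcf_int ?s) z / Gamma ?s)"
    by (intro ext DERIV_imp_deriv D1)
  then show "(deriv ^^ 2) (\<lambda>z. pcf_int ?s z / Gamma ?s) z - (z\<^sup>2 / 4 + a) * (pcf_int ?s z / Gamma ?s) = 0" for z
    using DERIV_imp_deriv[OF D2, of z] by (simp add: numeral_2_eq_2)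
  fix \<delta> :: real assume "\<delta> > 0"
  from tendsto_divide[OF tendsto_powr_gauss_int[OF s this] tendsto_const[of "Gamma ?s"] G]
  have "((\<lambda>z. z powr ?s * gauss_int ?s (1 / 2) z / Gamma ?s) \<longlongrightarrow> 1) (inf at_infinity (principal (pcf_sector \<delta>)))"
    using G by simp
  moreover have "\<forall>\<^sub>F z in inf at_infinity (principal (pcf_sector \<delta>)).
      z powr ?s * gauss_int ?s (1 / 2) z / Gamma ?s
      = (pcf_int ?s z / Gamma ?s) / (z powr (- a - 1 / 2) * exp (- (z\<^sup>2) / 4))"
    unfolding eventually_inf_principal using eventually_not_equal_at_infinity[of 0]
  proof eventually_elim
    case (elim z)
    have "z powr (- a - 1 / 2) = inverse (z powr ?s)"
      unfolding powr_minus[symmetric] by (rule arg_cong[of _ _ "(powr) z"]) simp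
    moreover have "x * g / G = (e * g / G) / (inverse x * e)" if "e \<noteq> 0" for x g G e :: complex
      using that by (simp add: divide_simps)
    ultimately show ?case unfolding pcf_int_def by (metis exp_not_eq_zero)
  qed
  ultimately show "(\<lambda>z. pcf_int ?s z / Gamma ?s) \<sim>[inf at_infinity (principal (pcf_sector \<delta>))]
      (\<lambda>z. z powr (- a - 1 / 2) * exp (- (z\<^sup>2) / 4))"
    by (intro asymp_equivI') (rule Lim_transform_eventually)
qed

text \<open>Taking \<open>\<delta>\<close> = pi/2 leaves the sector |arg z| \<le> pi/4, wide enough
  to contain a half-strip around the positive axis, which is all that uniqueness uses.\<close>

lemma in_pcf_sector_half_pi:
  assumes "Re z > 0" "\<bar>Im z\<bar> \<le> Re z"
  shows "z \<in> pcf_sector (pi / 2)"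
proof -
  have "- 1 \<le> Im z / Re z" "Im z / Re z \<le> 1" using assms by (auto simp: field_simps abs_le_iff)
  then have "arctan (- 1) \<le> arctan (Im z / Re z)" "arctan (Im z / Re z) \<le> arctan 1"
    unfolding arctan_le_iff by auto
  then show ?thesis using assms(1) by (simp add: pcf_sector_def arg_conv_arctan arctan_minus arctan_one)
qed

text \<open>In a sector the quotient of two solutions tends to 1, so by Cauchy's estimate its derivative,
  which is the Wronskian divided by the square of the recessive solution, stays bounded.\<close>

lemma is_pcfU_unique:
  assumes f: "is_pcfU a f" and g: "is_pcfU a g"
  shows "f = g"
proof -
  let ?F = "inf at_infinity (principal (pcf_sector (pi / 2)))"
  let ?E = "\<lambda>z::complex. z powr (- a - 1 / 2) * exp (- (z\<^sup>2) / 4)"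
  note sf = is_pcfU_imp_ode_solution[OF f] and sg = is_pcfU_imp_ode_solution[OF g]
  have df: "(f has_field_derivative deriv f z) (at z)" and dg: "(g has_field_derivative deriv g z) (at z)" for z
    by (rule ode_solution_has_field_derivative[OF sf] ode_solution_has_field_derivative[OF sg])+
  have fE: "f \<sim>[?F] ?E" and gE: "g \<sim>[?F] ?E" using f g by (simp_all add: is_pcfU_def)
  have "\<forall>\<^sub>F z in ?F. z \<noteq> 0"
    by (rule filter_leD[OF inf_le1 eventually_not_equal_at_infinity])
  then have nzE: "\<forall>\<^sub>F z in ?F. ?E z \<noteq> 0" by eventually_elim simp
  have nz: "\<forall>\<^sub>F z in ?F. f z \<noteq> 0"
    using asymp_equiv_eventually_zeros[OF fE] nzE by eventually_elim simp
  have Q: "((\<lambda>z. g z / f z) \<longlongrightarrow> 1) ?F"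
    by (rule asymp_equivD_strong[OF asymp_equiv_trans[OF gE asymp_equiv_symI[OF fE]]])
      (use nz in eventually_elim, simp)
  have "\<forall>\<^sub>F z in ?F. norm (g z / f z) < 2"
    using order_tendstoD(2)[OF tendsto_norm[OF Q], of 2] by simp
  with nz have "\<forall>\<^sub>F z in ?F. f z \<noteq> 0 \<and> norm (g z / f z) \<le> 2" by eventually_elim simp
  then obtain B where B: "\<And>z. \<lbrakk>norm z \<ge> B; z \<in> pcf_sector (pi / 2)\<rbrakk> \<Longrightarrow> f z \<noteq> 0 \<and> norm (g z / f z) \<le> 2"
    by (auto simp: eventually_inf_principal eventually_at_infinity)
  \<comment> \<open>\<open>Re z > B\<close> puts the half-strip beyond the radius \<open>B\<close>,
    and \<open>Re z > 1 > \<bar>Im z\<bar>\<close> puts it into the sector.\<close>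
  define X where "X = max B 1"
  define H where "H = {z. Re z > X} \<inter> ({z. Im z < 1} \<inter> {z. Im z > - 1})"
  have H: "f z \<noteq> 0 \<and> norm (g z / f z) \<le> 2" if "z \<in> H" for z
  proof (rule B)
    have z: "Re z > B" "Re z > 1" "\<bar>Im z\<bar> < 1" using that by (auto simp: H_def X_def)
    show "norm z \<ge> B" using z complex_Re_le_cmod[of z] by linarith
    show "z \<in> pcf_sector (pi / 2)" by (rule in_pcf_sector_half_pi) (use z in auto)
  qed
  have oH: "open H" unfolding H_def
    by (intro open_Int open_halfspace_Re_gt open_halfspace_Im_gt open_halfspace_Im_lt)
  have cH: "convex H" unfolding H_def
    by (intro convex_Int convex_halfspace_Re_gt convex_halfspace_Im_gt convex_halfspace_Im_lt)
  have real_F: "filterlim complex_of_real ?F at_top"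
  proof -
    have "\<forall>\<^sub>F x::real in at_top. complex_of_real x \<in> pcf_sector (pi / 2)"
      using eventually_gt_at_top[of 0] by eventually_elim (auto intro: in_pcf_sector_half_pi)
    then show ?thesis
      using filterlim_of_real_at_infinity
      by (auto simp: filterlim_inf filterlim_principal)
  qed
  define w where "w = wronskian f g 0"
  have w: "wronskian f g z = w" for z
    unfolding w_def by (rule ode_solution_wronskian_constant[OF sf sg])
  have dQ: "((\<lambda>z. g z / f z) has_field_derivative w / (f z)\<^sup>2) (at z)" if "z \<in> H" for z
    using DERIV_divide[OF dg df, of z] H[OF that] w[of z]
    by (simp add: wronskian_def power2_eq_square mult_ac)
  \<comment> \<open>A disc of radius 1/2 about \<open>x\<close> fits into the strip, so Cauchy's
    estimate with the bound 2 gives 2 / (1/2) = 4.\<close>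
  have "norm w \<le> 4 * norm (f (of_real x)) ^ 2" if "x > X + 1" for x
  proof -
    have sub: "cball (of_real x) (1/2) \<subseteq> H"
    proof
      fix z assume "z \<in> cball (complex_of_real x) (1/2)"
      then have "norm (of_real x - z) \<le> 1/2" by (simp add: dist_norm)
      then have "\<bar>Re (of_real x - z)\<bar> \<le> 1/2" "\<bar>Im (of_real x - z)\<bar> \<le> 1/2"
        using abs_Re_le_cmod abs_Im_le_cmod order_trans by blast+
      then show "z \<in> H" using that by (auto simp: H_def abs_if split: if_splits)
    qed
    have hol: "(\<lambda>z. g z / f z) holomorphic_on H"
      using dQ oH by (auto simp: holomorphic_on_open)
    have xH: "of_real x \<in> H" using sub by auto
    have "norm ((deriv ^^ 1) (\<lambda>z. g z / f z) (of_real x)) \<le> fact 1 * 2 / (1/2) ^ 1"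
    proof (rule Cauchy_inequality)
      show "(\<lambda>z. g z / f z) holomorphic_on ball (of_real x) (1/2)"
        using hol sub by (meson ball_subset_cball holomorphic_on_subset order_trans)
      show "continuous_on (cball (of_real x) (1/2)) (\<lambda>z. g z / f z)"
        using hol sub holomorphic_on_imp_continuous_on holomorphic_on_subset by blast
      show "norm (g y / f y) \<le> 2" if "norm (of_real x - y) = 1/2" for y
      proof -
        have "y \<in> cball (of_real x) (1/2)" using that by (simp only: mem_cball dist_norm)
        then show ?thesis using H sub by auto
      qed
    qed simp
    then have "norm (w / (f (of_real x))\<^sup>2) \<le> 4" using DERIV_imp_deriv[OF dQ[OF xH]] by simp
    then show ?thesis using H[OF xH] by (simp add: norm_divide norm_power divide_simps)
  qed
  then have "\<forall>\<^sub>F x in at_top. norm w \<le> 4 * norm (f (of_real x)) ^ 2"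
    by (rule eventually_mono[OF eventually_gt_at_top[of "X + 1"]])
  \<comment> \<open>\<open>f\<close> is recessive on the positive axis, so the bound on the constant
    \<open>w\<close> tends to 0; the quotient is then constant, and its limit 1 identifies the
    constant.\<close>
  moreover have "((\<lambda>x::real. 4 * norm (f (of_real x)) ^ 2) \<longlongrightarrow> 4 * norm (0 :: complex) ^ 2) at_top"
  proof (intro tendsto_intros)
    have "((\<lambda>x::real. x powr (Re (- a - 1 / 2)) * exp (- (x\<^sup>2) / 4)) \<longlongrightarrow> 0) at_top"
      by real_asymp
    moreover have "\<forall>\<^sub>F x::real in at_top. x powr (Re (- a - 1 / 2)) * exp (- (x\<^sup>2) / 4) = norm (?E (of_real x))"
      using eventually_gt_at_top[of 0]
      by eventually_elim (simp add: norm_mult norm_of_real_powr flip: of_real_power)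
    ultimately have "((\<lambda>x. norm (?E (of_real x))) \<longlongrightarrow> 0) at_top"
      by (rule Lim_transform_eventually)
    then have "((\<lambda>x. ?E (of_real x)) \<longlongrightarrow> 0) at_top" by (rule tendsto_norm_zero_cancel)
    moreover have "(\<lambda>x. f (of_real x)) \<sim>[at_top] (\<lambda>x. ?E (of_real x))"
      by (rule asymp_equiv_compose'[OF fE real_F])
    ultimately show "((\<lambda>x. f (of_real x)) \<longlongrightarrow> 0) at_top"
      using asymp_equiv_tendsto_transfer asymp_equiv_symI by blast
  qed
  ultimately have "norm w \<le> 4 * norm (0 :: complex) ^ 2"
    by (intro tendsto_lowerbound) (auto simp: trivial_limit_at_top_linorder)
  then have w0: "w = 0" by simp
  have "\<exists>c. \<forall>z\<in>H. g z / f z = c"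
    by (rule has_field_derivative_zero_constant[OF cH])
      (use dQ w0 in \<open>auto intro: has_field_derivative_at_within\<close>)
  then obtain c where c: "\<And>z. z \<in> H \<Longrightarrow> g z / f z = c" by auto
  have "((\<lambda>x. g (of_real x) / f (of_real x)) \<longlongrightarrow> 1) at_top"
    by (rule filterlim_compose[OF Q real_F])
  moreover have "\<forall>\<^sub>F x::real in at_top. g (of_real x) / f (of_real x) = c"
    using eventually_gt_at_top[of X] by eventually_elim (auto intro!: c simp: H_def)
  ultimately have "((\<lambda>_::real. c) \<longlongrightarrow> 1) at_top" by (rule Lim_transform_eventually)
  then have "c = 1" by (simp add: tendsto_const_iff)
  show "f = g"
  proof
    fix z
    have "of_real (X + 1) \<in> H" by (simp add: H_def)
    show "f z = g z"
      by (rule analytic_continuation_open[OF oH open_UNIV _ connected_UNIV subset_UNIV])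
        (use f g c H \<open>c = 1\<close> \<open>of_real (X + 1) \<in> H\<close> in \<open>auto simp: is_pcfU_def divide_simps split: if_splits\<close>)
  qed
qed

lemma pcfU_eq:
  assumes "Re a > - 1 / 2"
  shows "pcfU a = (\<lambda>z. pcf_int (a + 1 / 2) z / Gamma (a + 1 / 2))"
  unfolding pcfU_def using is_pcfU_pcf_int[OF assms] is_pcfU_unique by blast

section \<open>Moments on the positive axis\<close>

text \<open>The substitution u = p t^2 reduces the integral to Euler's at
  \<open>s / 2\<close>.\<close>

lemma gauss_int_at_0:
  assumes s: "Re s > 0" and p: "p > 0"
  shows "gauss_int s (of_real p) 0 = Gamma (s / 2) / (2 * of_real p powr (s / 2))"
proof -
  let ?f = "\<lambda>u::real. of_real u powr (s / 2 - 1) * exp (- 0 * of_real u ^ 2 - 1 * of_real u) :: complex"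
  let ?g = "\<lambda>t::real. p * t\<^sup>2"
  have s2: "Re (s / 2) > 0" using s by simp
  have sub: "(LINT t:{0<..}|lborel. \<bar>2 * p * t\<bar> *\<^sub>R ?f (?g t)) = (LINT u:{0<..}|lborel. ?f u)"
  proof (rule set_integral_change_of_variables(2))
    show "?g ` {0<..} = {0<..}"
    proof safe
      fix u :: real assume u: "u > 0"
      then have "u = ?g (sqrt (u / p))" "sqrt (u / p) > 0" using p by simp_all
      then show "u \<in> ?g ` {0<..}" by blast
    qed (use p in simp)
    show "inj_on ?g {0<..}" using p by (auto simp: inj_on_def)
    show "(?g has_field_derivative 2 * p * t) (at t)" for t
      by (auto intro!: derivative_eq_intros)
    show "continuous_on {0<..} ?f" by (intro continuous_intros) auto
    show "set_integrable lborel {0<..} ?f"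
      by (rule set_integrable_gauss[OF s2]) (rule gauss_dominated_Re_nonneg, auto)
  qed (auto intro!: continuous_intros)
  have eq: "\<bar>2 * p * t\<bar> *\<^sub>R ?f (?g t) = (2 * of_real p powr (s / 2)) *
      (of_real t powr (s - 1) * exp (- of_real p * of_real t ^ 2 - 0 * of_real t))" if "t > 0" for t
  proof -
    have "complex_of_real (?g t) powr (s / 2 - 1) = of_real p powr (s / 2 - 1) * of_real (t\<^sup>2) powr (s / 2 - 1)"
      using p that by (simp only: of_real_mult) (rule powr_times_real, auto)
    also have "complex_of_real (t\<^sup>2) powr (s / 2 - 1) = of_real t powr (s - 2)"
      using that by (simp add: powr_def Ln_of_real ln_realpow algebra_simps del: of_real_power)
    finally have "complex_of_real (?g t) powr (s / 2 - 1) = of_real p powr (s / 2 - 1) * of_real t powr (s - 2)" .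
    moreover have "complex_of_real p powr (s / 2) = of_real p powr (s / 2 - 1) * of_real p"
      using p powr_add[of "complex_of_real p" "s / 2 - 1" 1] by simp
    moreover have "complex_of_real t powr (s - 1) = of_real t powr (s - 2) * of_real t"
      using that powr_add[of "complex_of_real t" "s - 2" 1] by simp
    ultimately show ?thesis
      using that p by (simp add: scaleR_conv_of_real mult_ac)
  qed
  have "Gamma (s / 2) = gauss_int (s / 2) 0 1" using gauss_int_0[OF s2, of 1] by simp
  also have "\<dots> = (LINT t:{0<..}|lborel. \<bar>2 * p * t\<bar> *\<^sub>R ?f (?g t))"
    unfolding gauss_int_def sub ..
  also have "\<dots> = (LINT t:{0<..}|lborel. (2 * of_real p powr (s / 2)) *
      (of_real t powr (s - 1) * exp (- of_real p * of_real t ^ 2 - 0 * of_real t)))"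
    by (rule set_lebesgue_integral_cong) (use eq in auto)
  also have "\<dots> = (2 * of_real p powr (s / 2)) * gauss_int s (of_real p) 0"
    unfolding gauss_int_def by (rule set_integral_mult_right)
  finally show ?thesis using p by simp
qed

text \<open>Through \<open>deriv_pcf_int\<close> this also gives the derivative at 0, namely
  \<open>- pcf_int (s + 1) 0\<close>; these values determine every Wronskian below.\<close>

lemma pcf_int_at_0: "Re s > 0 \<Longrightarrow> pcf_int s 0 = 2 powr (s / 2 - 1) * Gamma (s / 2)"
proof -
  assume s: "Re s > 0"
  have "(1 / 2 :: complex) powr (s / 2) = 1 / 2 powr (s / 2)"
    using Ln_of_real[of "1 / 2"] Ln_of_real[of 2]
    by (simp add: powr_def ln_div exp_minus inverse_eq_divide)
  moreover have "(2::complex) powr (s / 2 - 1) = 2 powr (s / 2) / 2" by (simp add: powr_diff)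
  moreover have "pcf_int s 0 = Gamma (s / 2) / (2 * (1 / 2) powr (s / 2))"
    using gauss_int_at_0[OF s, of "1 / 2"] by (simp add: pcf_int_def)
  ultimately show ?thesis by (simp only:) simp
qed

text \<open>For \<open>x \<ge> 0\<close> the factor exp(-x t) is at most 1, so the inner integral is
  bounded by that of the absolute value at \<open>x = 0\<close>; the decay is that of the
  prefactor.\<close>

lemma norm_pcf_int_le:
  assumes s: "Re s > 0"
  shows "\<exists>K. \<forall>x\<ge>0. norm (pcf_int s (of_real x)) \<le> K * exp (- (x\<^sup>2 / 4))"
proof (intro exI allI impI)
  let ?e = "\<lambda>z t. of_real t powr (s - 1) * exp (- (1 / 2) * of_real t ^ 2 - z * of_real t)"
  fix x :: real assume x: "x \<ge> 0"
  note i = set_integrable_gauss[OF s gauss_dominated_half]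
  have "norm (gauss_int s (1 / 2) (of_real x)) \<le> (LINT t:{0<..}|lborel. norm (?e (of_real x) t))"
    unfolding gauss_int_def by (rule set_integral_norm_bound[OF i])
  also have "\<dots> \<le> (LINT t:{0<..}|lborel. norm (?e 0 t))"
  proof (rule set_integral_mono)
    show "norm (?e (of_real x) t) \<le> norm (?e 0 t)" if "t \<in> {0<..}" for t
      unfolding norm_mult using that x by (intro mult_left_mono) (auto simp flip: of_real_power)
  qed (intro set_integrable_norm i)+
  finally have "norm (gauss_int s (1 / 2) (of_real x)) \<le> (LINT t:{0<..}|lborel. norm (?e 0 t))" .
  moreover have "norm (exp (- (of_real x)\<^sup>2 / 4 :: complex)) = exp (- (x\<^sup>2 / 4))"
    by (simp flip: of_real_power)
  ultimately show "norm (pcf_int s (of_real x)) \<le> (LINT t:{0<..}|lborel. norm (?e 0 t)) * exp (- (x\<^sup>2 / 4))"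
    unfolding pcf_int_def norm_mult by (simp add: mult.commute mult_left_mono)
qed

lemma tendsto_power_pcf_int:
  assumes s: "Re s > 0"
  shows "((\<lambda>x. of_real x ^ n * pcf_int s (of_real x)) \<longlongrightarrow> 0) at_top"
proof -
  obtain K where K: "\<And>x. x \<ge> 0 \<Longrightarrow> norm (pcf_int s (of_real x)) \<le> K * exp (- (x\<^sup>2 / 4))"
    using norm_pcf_int_le[OF s] by auto
  have "((\<lambda>x::real. x powr real n * (K * exp (- (x\<^sup>2 / 4)))) \<longlongrightarrow> 0) at_top"
    by real_asymp
  moreover have "\<forall>\<^sub>F x in at_top. norm (of_real x ^ n * pcf_int s (of_real x)) \<le> x powr real n * (K * exp (- (x\<^sup>2 / 4)))"
    using eventually_gt_at_top[of 0]
    by eventually_elim (auto simp: norm_mult norm_power powr_realpow intro!: mult_left_mono K)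
  ultimately show ?thesis by (rule Lim_null_comparison[rotated])
qed

definition pcf_moment :: "complex \<Rightarrow> nat \<Rightarrow> complex" where
  "pcf_moment s n = (LINT x:{0<..}|lborel. of_real x ^ n * pcf_int s (of_real x))"

section \<open>Moments: existence, recursion and integrals from infinity\<close>

lemma continuous_on_pcf_int_of_real: "Re s > 0 \<Longrightarrow> continuous_on A (\<lambda>x. pcf_int s (of_real x))"
  by (rule continuous_on_compose2[OF holomorphic_on_imp_continuous_on[OF holomorphic_pcf_int[of s UNIV]]
        continuous_on_of_real_id]) auto

lemma set_integrable_power_pcf_int:
  assumes s: "Re s > 0"
  shows "set_integrable lborel {0<..} (\<lambda>x. of_real x ^ n * pcf_int s (of_real x))"
proof -
  obtain K where K: "\<And>x. x \<ge> 0 \<Longrightarrow> norm (pcf_int s (of_real x)) \<le> K * exp (- (x\<^sup>2 / 4))"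
    using norm_pcf_int_le[OF s] by auto
  have "set_integrable lborel {0<..} (\<lambda>x. of_real K * (of_real x powr (of_nat (n + 1) - 1) * exp (- (1 / 4) * of_real x ^ 2 - 0 * of_real x)) :: complex)"
    by (intro set_integrable_mult_right impI set_integrable_gauss gauss_dominated_Re_pos) auto
  then show ?thesis
  proof (rule set_integrable_bound)
    have c: "continuous_on {0<..} (\<lambda>x. of_real x ^ n * pcf_int s (of_real x))"
      by (intro continuous_intros continuous_on_pcf_int_of_real s)
    show "set_borel_measurable lborel {0<..} (\<lambda>x. of_real x ^ n * pcf_int s (of_real x))"
      unfolding set_borel_measurable_def
      using borel_measurable_continuous_on_indicator[OF _ c] by simp
    show "AE x in lborel. x \<in> {0<..} \<longrightarrow> norm (of_real x ^ n * pcf_int s (of_real x))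
      \<le> norm (of_real K * (of_real x powr (of_nat (n + 1) - 1) * exp (- (1 / 4) * of_real x ^ 2 - 0 * of_real x)) :: complex)"
    proof (intro AE_I2 impI)
      fix x :: real assume x: "x \<in> {0<..}"
      have "norm (of_real x ^ n * pcf_int s (of_real x)) \<le> x ^ n * (K * exp (- (x\<^sup>2 / 4)))"
        unfolding norm_mult using x K[of x] by (auto simp: norm_power intro!: mult_left_mono)
      also have "\<dots> \<le> \<bar>K\<bar> * (x ^ n * exp (- (x\<^sup>2 / 4)))"
        using x by (simp add: mult.left_commute mult_right_mono)
      also have "\<dots> = norm (of_real K * (of_real x powr (of_nat (n + 1) - 1) * exp (- (1 / 4) * of_real x ^ 2 - 0 * of_real x)) :: complex)"
        using x by (simp add: norm_mult norm_of_real_powr powr_realpow flip: of_real_power)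
      finally show "norm (of_real x ^ n * pcf_int s (of_real x))
        \<le> norm (of_real K * (of_real x powr (of_nat (n + 1) - 1) * exp (- (1 / 4) * of_real x ^ 2 - 0 * of_real x)) :: complex)" .
    qed
  qed
qed

text \<open>An entire primitive serves two purposes: its limit along the positive axis is the
  moment, and its values give all contour integrals along rotated rays. Normalising it at 0 later
  fixes a constant of integration.\<close>

lemma pcf_moment_primitive:
  assumes s: "Re s > 0"
  obtains P where "\<And>z. (P has_field_derivative z ^ n * pcf_int s z) (at z)" "P 0 = 0"
    "((\<lambda>x. P (of_real x)) \<longlongrightarrow> pcf_moment s n) at_top"
proof -
  let ?f = "\<lambda>z. z ^ n * pcf_int s z"
  have "?f holomorphic_on UNIV" by (intro holomorphic_intros holomorphic_pcf_int s)
  then obtain Q where Q: "\<And>z. (Q has_field_derivative ?f z) (at z)"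
    using holomorphic_convex_primitive'[OF convex_UNIV open_UNIV, of ?f] by auto
  define P where "P z = Q z - Q 0" for z
  have P: "(P has_field_derivative ?f z) (at z)" for z
    unfolding P_def [abs_def] using DERIV_diff[OF Q DERIV_const] by simp
  have P0: "P 0 = 0" by (simp add: P_def)
  let ?g = "\<lambda>x. ?f (of_real x)"
  have int: "set_integrable lborel {0..} ?g"
    using set_integrable_power_pcf_int[OF s, of n]
    by (subst set_integrable_discrete_difference[where B = "{0<..}" and X = "{0}"]) auto
  have Pb: "(LINT x:{0..b}|lborel. ?g x) = P (of_real b)" if "b \<ge> 0" for b
  proof -
    have "(\<integral>x. indicator {0..b} x *\<^sub>R ?g x \<partial>lborel) = P (of_real b) - P (of_real 0)"
    proof (rule integral_FTC_Icc[OF that])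
      show "((\<lambda>x. P (of_real x)) has_vector_derivative ?g x) (at x within {0..b})" for x
        by (rule has_vector_derivative_real_field[OF P])
      show "continuous_on {0..b} ?g" by (intro continuous_intros continuous_on_pcf_int_of_real s)
    qed
    then show ?thesis unfolding set_lebesgue_integral_def by (simp only: P0 of_real_0 diff_zero)
  qed
  have ev: "\<forall>\<^sub>F b in at_top. (LINT x:{0..b}|lborel. ?g x) = P (of_real b)"
    by (rule eventually_mono[OF eventually_ge_at_top[of 0]]) (rule Pb)
  have lim: "((\<lambda>x. P (of_real x)) \<longlongrightarrow> (LINT x:{0..}|lborel. ?g x)) at_top"
    by (rule Lim_transform_eventually[OF tendsto_set_lebesgue_integral_at_top[OF _ int] ev]) simp
  have moment: "(LINT x:{0..}|lborel. ?g x) = pcf_moment s n"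
    unfolding pcf_moment_def by (rule set_integral_discrete_difference[where X = "{0}"]) auto
  have "((\<lambda>x. P (of_real x)) \<longlongrightarrow> pcf_moment s n) at_top"
    using lim unfolding moment .
  then show ?thesis using that P P0 by blast
qed

lemma of_real_at_right_0: "(complex_of_real \<longlongrightarrow> 0) (at_right 0)"
  using tendsto_of_real[OF tendsto_ident_at, of 0 "{0<..}"] by simp

text \<open>Integrate (x^n f' - n x^(n-1) f)' = x^n f'' - n (n - 1) x^(n-2) f and insert the
  differential equation for f''. With \<open>0 ^ 0 = 1\<close> the boundary term is -f'(0) for
  \<open>n = 0\<close>, f(0) for \<open>n = 1\<close> and 0 afterwards; for \<open>n < 2\<close> the
  truncated \<open>n - 2\<close> is multiplied by 0.\<close>

lemma pcf_moment_rec: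
  assumes s: "Re s > 0"
  shows "pcf_moment s (n + 2) / 4 + (s - 1 / 2) * pcf_moment s n
      - of_nat n * of_nat (n - 1) * pcf_moment s (n - 2)
    = of_nat n * 0 ^ (n - 1) * pcf_int s 0 - 0 ^ n * deriv (pcf_int s) 0"
proof -
  let ?f = "\<lambda>x. pcf_int s (of_real x)"
  let ?F = "\<lambda>z. z ^ n * deriv (pcf_int s) z - of_nat n * (z ^ (n - 1) * pcf_int s z)"
  let ?m = "\<lambda>k x. of_real x ^ k * ?f x"
  let ?h = "\<lambda>x. (1 / 4) * ?m (n + 2) x + (s - 1 / 2) * ?m n x - (of_nat n * of_nat (n - 1)) * ?m (n - 2) x"
  note i = set_integrable_power_pcf_int[OF s]
  have i': "set_integrable lborel {0<..} (\<lambda>x. c * ?m k x)" for c k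
    by (intro set_integrable_mult_right impI i)
  have s1: "Re (s + 1) > 0" using s by simp
  have d: "(pcf_int s has_field_derivative deriv (pcf_int s) z) (at z)" for z
    by (rule ode_solution_has_field_derivative[OF ode_solution_pcf_int[OF s]])
  have FD: "(?F has_field_derivative (1 / 4) * (z ^ (n + 2) * pcf_int s z) + (s - 1 / 2) * (z ^ n * pcf_int s z)
      - (of_nat n * of_nat (n - 1)) * (z ^ (n - 2) * pcf_int s z)) (at z)" for z
  proof -
    have pw: "((\<lambda>z. z ^ k) has_field_derivative of_nat k * z ^ (k - 1)) (at z)" for k
      using DERIV_power[OF DERIV_ident, of k z UNIV] by simp
    have "(?F has_field_derivative (z ^ n * ((z\<^sup>2 / 4 + s - 1 / 2) * pcf_int s z) + of_nat n * z ^ (n - 1) * deriv (pcf_int s) z)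
        - of_nat n * (z ^ (n - 1) * deriv (pcf_int s) z + of_nat (n - 1) * z ^ (n - 1 - 1) * pcf_int s z)) (at z)"
      by (intro DERIV_diff DERIV_mult' DERIV_cmult pw pcf_int_has_field_derivative2 s d)
    moreover have "n - 1 - 1 = n - 2" by simp
    ultimately show ?thesis by (simp add: algebra_simps power_add power2_eq_square)
  qed
  have cF: "isCont ?F 0" using FD by (rule DERIV_isCont)
  have integral_h: "(LINT x:{0<..}|lborel. ?h x) = 0 - ?F 0"
  proof (rule set_integral_FTC_halfline)
    show "((\<lambda>x. ?F (of_real x)) has_vector_derivative ?h x) (at x)" for x
      by (rule has_vector_derivative_real_field[OF FD])
    show "continuous_on {0<..} ?h" by (intro continuous_intros continuous_on_pcf_int_of_real s)
    show "set_integrable lborel {0<..} ?h"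
      by (intro set_integral_add set_integral_diff i')
    show "((\<lambda>x. ?F (of_real x)) \<longlongrightarrow> ?F 0) (at_right 0)"
      by (rule isCont_tendsto_compose[OF cF of_real_at_right_0])
    have "((\<lambda>x. - (1 / 2) * ?m (n + 1) x - of_real x ^ n * pcf_int (s + 1) (of_real x) - of_nat n * ?m (n - 1) x) \<longlongrightarrow>
        - (1 / 2) * 0 - 0 - of_nat n * 0) at_top"
      by (intro tendsto_intros tendsto_power_pcf_int s s1)
    then show "((\<lambda>x. ?F (of_real x)) \<longlongrightarrow> 0) at_top"
      by (simp add: deriv_pcf_int[OF s] algebra_simps)
  qed
  have "(1 / 4) * pcf_moment s (n + 2) + (s - 1 / 2) * pcf_moment s n
      - (of_nat n * of_nat (n - 1)) * pcf_moment s (n - 2) = (LINT x:{0<..}|lborel. ?h x)"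
    unfolding pcf_moment_def by (simp only: set_integral_add set_integral_diff i' set_integral_mult_right)
  also have "\<dots> = 0 - ?F 0"
    by (rule integral_h)
  finally show ?thesis by (simp add: algebra_simps)
qed

text \<open>Integrate the first-order relation for the derivative of \<open>pcf_int s\<close>: the
  first moment becomes a value at 0 and a moment of order 0 at \<open>s + 1\<close>, for which there
  is a double integral with \<open>\<beta> = 1\<close>.\<close>

lemma pcf_moment_1:
  assumes s: "Re s > 0"
  shows "pcf_moment s 1 = 2 * pcf_int s 0 - 2 * pcf_moment (s + 1) 0"
proof -
  let ?f = "\<lambda>s x. pcf_int s (of_real x)"
  let ?h = "\<lambda>x. - (1 / 2) * (of_real x ^ 1 * ?f s x) - of_real x ^ 0 * ?f (s + 1) x"
  have s1: "Re (s + 1) > 0" using s by simp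
  note i = set_integrable_power_pcf_int[OF s1, of 0]
  have i': "set_integrable lborel {0<..} (\<lambda>x. - (1 / 2) * (of_real x ^ 1 * ?f s x))"
    by (intro set_integrable_mult_right impI set_integrable_power_pcf_int s)
  have d: "(pcf_int s has_field_derivative (- (1 / 2) * (z ^ 1 * pcf_int s z) - z ^ 0 * pcf_int (s + 1) z)) (at z)" for z
    using pcf_int_has_field_derivative[OF s, of z] by simp
  have "(LINT x:{0<..}|lborel. ?h x) = 0 - pcf_int s 0"
  proof (rule set_integral_FTC_halfline)
    show "(?f s has_vector_derivative ?h x) (at x)" for x
      by (rule has_vector_derivative_real_field[OF d])
    show "continuous_on {0<..} ?h" by (intro continuous_intros continuous_on_pcf_int_of_real s s1)
    show "set_integrable lborel {0<..} ?h" by (intro set_integral_diff i i')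
    show "(?f s \<longlongrightarrow> pcf_int s 0) (at_right 0)"
      by (rule isCont_tendsto_compose[OF DERIV_isCont[OF d] of_real_at_right_0])
    show "(?f s \<longlongrightarrow> 0) at_top" using tendsto_power_pcf_int[OF s, of 0] by simp
  qed
  moreover have "(LINT x:{0<..}|lborel. ?h x) = - (1 / 2) * pcf_moment s 1 - pcf_moment (s + 1) 0"
    unfolding pcf_moment_def by (simp only: set_integral_diff i i' set_integral_mult_right)
  ultimately show ?thesis by (simp add: field_simps)
qed

text \<open>Since \<open>c * d = 1\<close>, the substitution u = c t carries the ray in direction
  \<open>d\<close> to the positive axis; the factor \<open>d ^ (n + 1)\<close> comes from t^n
  dt.\<close>

lemma integral_from_infinity_cmult_arg:
  assumes P: "\<And>z. (P has_field_derivative z ^ n * f z) (at z)"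
    and lim: "((\<lambda>x. P (of_real x)) \<longlongrightarrow> m) at_top" and cd: "c * d = 1"
  shows "integral_from_infinity d z (\<lambda>t. t ^ n * f (c * t)) = d ^ (n + 1) * (P (c * z) - m)"
proof -
  let ?F = "\<lambda>t. d ^ (n + 1) * P (c * t)"
  have F: "(?F has_field_derivative t ^ n * f (c * t)) (at t)" for t
  proof -
    have "(?F has_field_derivative d ^ (n + 1) * ((c * t) ^ n * f (c * t) * c)) (at t)"
      by (rule DERIV_cmult[OF DERIV_chain'[OF DERIV_cmult_Id P]])
    moreover have "d ^ (n + 1) * ((c * t) ^ n * f (c * t) * c) = (c * d) ^ (n + 1) * (t ^ n * f (c * t))"
      by (simp add: power_mult_distrib mult_ac)
    ultimately show ?thesis by (simp only: cd power_one mult_1)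
  qed
  have "contour_integral (linepath (of_real x * d) z) (\<lambda>t. t ^ n * f (c * t))
      = d ^ (n + 1) * (P (c * z) - P (of_real x))" for x :: real
  proof -
    have "((\<lambda>t. t ^ n * f (c * t)) has_contour_integral
        (?F (pathfinish (linepath (of_real x * d) z)) - ?F (pathstart (linepath (of_real x * d) z)))) (linepath (of_real x * d) z)"
      by (rule contour_integral_primitive[where S = UNIV, OF has_field_derivative_at_within[OF F]]) auto
    moreover have "c * (of_real x * d) = of_real x" using cd by (simp add: mult_ac)
    ultimately show ?thesis
      by (simp only: contour_integral_unique pathstart_linepath pathfinish_linepath right_diff_distrib)
  qed
  moreover have "((\<lambda>x::real. d ^ (n + 1) * (P (c * z) - P (of_real x))) \<longlongrightarrow> d ^ (n + 1) * (P (c * z) - m)) at_top"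
    by (intro tendsto_intros lim)
  ultimately show ?thesis
    unfolding integral_from_infinity_def by (simp add: tendsto_Lim)
qed

section \<open>Moments of order 0 and 1\<close>

text \<open>The point is that \<open>K\<close> does not depend on \<open>p\<close>: the scaling in
  \<open>p\<close> supplies the power of x in the majorant for Fubini's theorem.\<close>

lemma gaussian_moment_real:
  fixes \<sigma> :: real
  assumes "\<sigma> > 0"
  shows "\<exists>K. \<forall>p>0. (LINT t:{0<..}|lborel. t powr (\<sigma> - 1) * exp (- p * t\<^sup>2)) = K / p powr (\<sigma> / 2)"
proof (intro exI allI impI)
  fix p :: real assume p: "p > 0"
  let ?I = "LINT t:{0<..}|lborel. t powr (\<sigma> - 1) * exp (- p * t\<^sup>2)"
  have eq: "of_real t powr (of_real \<sigma> - 1) * exp (- of_real p * of_real t ^ 2 - 0 * of_real t)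
      = complex_of_real (t powr (\<sigma> - 1) * exp (- p * t\<^sup>2))" if "t > 0" for t
  proof -
    have "of_real t powr (of_real \<sigma> - 1) = complex_of_real (t powr (\<sigma> - 1))"
      using that powr_of_real[of t "\<sigma> - 1"] by simp
    moreover have "exp (- of_real p * of_real t ^ 2 - 0 * of_real t) = complex_of_real (exp (- p * t\<^sup>2))"
      unfolding exp_of_real[symmetric] by simp
    ultimately show ?thesis by (simp only: of_real_mult)
  qed
  have "gauss_int (of_real \<sigma>) (of_real p) 0 = (LINT t:{0<..}|lborel. complex_of_real (t powr (\<sigma> - 1) * exp (- p * t\<^sup>2)))"
    unfolding gauss_int_def by (rule set_lebesgue_integral_cong) (use eq in auto)
  then have "gauss_int (of_real \<sigma>) (of_real p) 0 = of_real ?I"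
    by (simp only: set_integral_complex_of_real)
  then have "complex_of_real ?I = Gamma (of_real \<sigma> / 2) / (2 * of_real p powr (of_real \<sigma> / 2))"
    using gauss_int_at_0[of "of_real \<sigma>" p] assms p by simp
  also have "\<dots> = complex_of_real (Gamma (\<sigma> / 2) / 2 / p powr (\<sigma> / 2))"
    using p powr_of_real[of p "\<sigma> / 2"] Gamma_complex_of_real[of "\<sigma> / 2"] by simp
  finally show "?I = Gamma (\<sigma> / 2) / 2 / p powr (\<sigma> / 2)"
    by (simp only: of_real_eq_iff)
qed

text \<open>Substituting \<open>u = x \<tau>\<close> in the double integral of \<open>x\<^bsup>\<beta>-1\<^esup> u\<^bsup>s-1\<^esup> exp(-Q(x, u))\<close>, with the
  quadratic form \<open>Q(x, u) = x\<^sup>2 q(u/x)\<close>, separates the variables.\<close>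

lemma gauss_double_integral:
  fixes \<alpha> \<gamma> \<kappa> :: real and \<beta> s :: complex
  defines "q \<equiv> \<lambda>\<tau>. \<alpha> + \<gamma> * \<tau> + \<kappa> * \<tau>\<^sup>2"
  assumes \<alpha>: "\<alpha> > 0" and \<gamma>: "\<gamma> \<ge> 0" and \<kappa>: "\<kappa> > 0" and \<beta>: "Re \<beta> > 0" and s: "Re s > 0"
  shows "set_integrable lborel {0<..} (\<lambda>\<tau>. of_real \<tau> powr (s - 1) / of_real (q \<tau>) powr ((\<beta> + s) / 2))"
    and "(LINT x:{0<..}|lborel. of_real x powr (\<beta> - 1) * exp (- of_real \<alpha> * of_real x ^ 2) * gauss_int s (of_real \<kappa>) (of_real (\<gamma> * x)))
      = Gamma ((\<beta> + s) / 2) / 2 * (LINT \<tau>:{0<..}|lborel. of_real \<tau> powr (s - 1) / of_real (q \<tau>) powr ((\<beta> + s) / 2))"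
proof -
  define E where "E x \<tau> = exp (- q \<tau> * x\<^sup>2)" for x \<tau> :: real
  \<comment> \<open>The substitution turns u^(s-1) du into x^s \<tau>^(s-1) d\<tau>, hence the
    exponent \<open>\<beta> + s - 1\<close>. \<open>f1\<close> and \<open>f2\<close> below read this
    as a Gaussian in \<open>\<tau>\<close> and as a Gaussian in \<open>x\<close>.\<close>
  define f where "f x \<tau> = of_real x powr (\<beta> + s - 1) * (of_real \<tau> powr (s - 1) * complex_of_real (E x \<tau>))" for x \<tau> :: real
  define F where "F x \<tau> = indicator {0<..} x *\<^sub>R (indicator {0<..} \<tau> *\<^sub>R f x \<tau>)" for x \<tau> :: real
  have q: "q \<tau> > 0" if "\<tau> > 0" for \<tau>
    using that \<alpha> \<gamma> \<kappa> by (auto simp: q_def intro!: add_pos_nonneg)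
  have \<beta>s: "Re (\<beta> + s) > 0" using \<beta> s by simp
  have gi: "set_integrable lborel {0<..} (\<lambda>t. c * (of_real t powr (s' - 1) * exp (- of_real p * of_real t ^ 2 - z * of_real t)))"
    if "Re s' > 0" "p > 0" for s' z c and p :: real
    using that by (intro set_integrable_mult_right impI set_integrable_gauss gauss_dominated_Re_pos) auto
  have f1: "f x \<tau> = (of_real x powr (\<beta> + s - 1) * of_real (exp (- \<alpha> * x\<^sup>2))) *
      (of_real \<tau> powr (s - 1) * exp (- of_real (\<kappa> * x\<^sup>2) * of_real \<tau> ^ 2 - of_real (\<gamma> * x\<^sup>2) * of_real \<tau>))" for x \<tau>
  proof -
    have "E x \<tau> = exp (- \<alpha> * x\<^sup>2) * exp (- (\<kappa> * x\<^sup>2) * \<tau>\<^sup>2 - (\<gamma> * x\<^sup>2) * \<tau>)"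
      unfolding E_def q_def exp_add[symmetric] by (rule arg_cong[of _ _ exp]) (simp add: algebra_simps)
    then have "complex_of_real (E x \<tau>) = of_real (exp (- \<alpha> * x\<^sup>2)) * exp (- of_real (\<kappa> * x\<^sup>2) * of_real \<tau> ^ 2 - of_real (\<gamma> * x\<^sup>2) * of_real \<tau>)"
      by (simp flip: exp_of_real)
    then show ?thesis by (simp add: f_def mult_ac)
  qed
  have f2: "f x \<tau> = of_real \<tau> powr (s - 1) * (of_real x powr (\<beta> + s - 1) * exp (- of_real (q \<tau>) * of_real x ^ 2 - 0 * of_real x))" for x \<tau>
    by (simp add: f_def E_def flip: exp_of_real)
  have int_\<tau>: "integrable lborel (F x)" for x
  proof (cases "x > 0")
    case True
    then have "set_integrable lborel {0<..} (f x)"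
      unfolding f1 [abs_def] using s \<kappa> by (intro gi) auto
    then show ?thesis using True by (simp add: F_def [abs_def] set_integrable_def)
  qed (simp add: F_def [abs_def])
  have meas: "(\<lambda>(x, \<tau>). F x \<tau>) \<in> borel_measurable (lborel \<Otimes>\<^sub>M lborel)"
    unfolding F_def f_def E_def q_def powr_def by measurable
  obtain K where K: "\<And>p. p > 0 \<Longrightarrow> (LINT t:{0<..}|lborel. t powr (Re s - 1) * exp (- p * t\<^sup>2)) = K / p powr (Re s / 2)"
    using gaussian_moment_real[OF s] by auto
  \<comment> \<open>After discarding the mixed term, the inner integral scales like x^(-Re s), which
    leaves x^(Re \<beta> - 1) times a Gaussian.\<close>
  let ?b = "\<lambda>x::real. K / \<kappa> powr (Re s / 2) * norm (indicator {0<..} x *\<^sub>R (of_real x powr (\<beta> - 1) * exp (- of_real \<alpha> * of_real x ^ 2 - 0 * of_real x)) :: complex)"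
  have bound: "(\<integral>\<tau>. norm (F x \<tau>) \<partial>lborel) \<le> ?b x" for x
  proof (cases "x > 0")
    case x: True
    have gr: "set_integrable lborel {0<..} (\<lambda>\<tau>. \<tau> powr (Re s - 1) * exp (- (\<kappa> * x\<^sup>2) * \<tau>\<^sup>2))"
    proof -
      have "set_integrable lborel {0<..} (\<lambda>t. norm (1 * (of_real t powr (s - 1) * exp (- of_real (\<kappa> * x\<^sup>2) * of_real t ^ 2 - 0 * of_real t))))"
        using s \<kappa> x by (intro set_integrable_norm gi) auto
      then show ?thesis
        by (rule set_integrable_cong[THEN iffD1, rotated -1])
          (auto simp: norm_mult norm_of_real_powr simp flip: of_real_power of_real_mult)
    qed
    let ?c = "x powr (Re (\<beta> + s) - 1) * exp (- \<alpha> * x\<^sup>2)"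
    have "(\<integral>\<tau>. norm (F x \<tau>) \<partial>lborel) = (LINT \<tau>:{0<..}|lborel. norm (f x \<tau>))"
      using x by (simp add: F_def set_lebesgue_integral_def)
    also have "\<dots> \<le> (LINT \<tau>:{0<..}|lborel. ?c * (\<tau> powr (Re s - 1) * exp (- (\<kappa> * x\<^sup>2) * \<tau>\<^sup>2)))"
    proof (rule set_integral_mono)
      show "set_integrable lborel {0<..} (\<lambda>\<tau>. norm (f x \<tau>))"
        unfolding f1 using s \<kappa> x by (intro set_integrable_norm gi) auto
      show "set_integrable lborel {0<..} (\<lambda>\<tau>. ?c * (\<tau> powr (Re s - 1) * exp (- (\<kappa> * x\<^sup>2) * \<tau>\<^sup>2)))"
        by (intro set_integrable_mult_right impI gr)
      show "norm (f x \<tau>) \<le> ?c * (\<tau> powr (Re s - 1) * exp (- (\<kappa> * x\<^sup>2) * \<tau>\<^sup>2))" if "\<tau> \<in> {0<..}" for \<tau>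
      proof -
        have \<tau>: "\<tau> > 0" using that by simp
        have "E x \<tau> \<le> exp (- \<alpha> * x\<^sup>2) * exp (- (\<kappa> * x\<^sup>2) * \<tau>\<^sup>2)"
          unfolding E_def exp_add[symmetric] q_def using x \<tau> \<gamma> by (simp add: algebra_simps)
        moreover have "norm (f x \<tau>) = x powr (Re (\<beta> + s) - 1) * (\<tau> powr (Re s - 1) * E x \<tau>)"
          using x \<tau> by (simp add: f_def norm_mult norm_of_real_powr E_def)
        ultimately show ?thesis
          using x \<tau> by (simp add: mult_ac mult_left_mono)
      qed
    qed
    also have "\<dots> = ?c * (LINT \<tau>:{0<..}|lborel. \<tau> powr (Re s - 1) * exp (- (\<kappa> * x\<^sup>2) * \<tau>\<^sup>2))"
      by (rule set_integral_mult_right)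
    also have "\<dots> = ?c * (K / (\<kappa> * x\<^sup>2) powr (Re s / 2))"
      using K[of "\<kappa> * x\<^sup>2"] x \<kappa> by simp
    also have "\<dots> = ?b x"
    proof -
      have "(x\<^sup>2) powr (Re s / 2) = x powr Re s"
        using x by (simp add: powr_def ln_realpow)
      then have "(\<kappa> * x\<^sup>2) powr (Re s / 2) = \<kappa> powr (Re s / 2) * x powr Re s"
        using x \<kappa> by (simp add: powr_mult)
      moreover have "x powr (Re (\<beta> + s) - 1) = x powr (Re \<beta> - 1) * x powr Re s"
        unfolding powr_add[symmetric] by (simp add: algebra_simps)
      ultimately show ?thesis
        using x by (simp add: norm_mult norm_of_real_powr flip: of_real_power of_real_mult)
    qed
    finally show ?thesis .
  qed (simp add: F_def)
  have "integrable lborel ?b"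
  proof -
    have "set_integrable lborel {0<..} (\<lambda>x. 1 * (of_real x powr (\<beta> - 1) * exp (- of_real \<alpha> * of_real x ^ 2 - 0 * of_real x)))"
      by (rule gi[OF \<beta> \<alpha>])
    then show ?thesis
      unfolding set_integrable_def by (intro integrable_mult_right integrable_norm) simp
  qed
  then have "integrable lborel (\<lambda>x. \<integral>\<tau>. norm (F x \<tau>) \<partial>lborel)"
  proof (rule Bochner_Integration.integrable_bound)
    show "(\<lambda>x. \<integral>\<tau>. norm (F x \<tau>) \<partial>lborel) \<in> borel_measurable lborel"
      using meas by measurable
    show "AE x in lborel. norm (\<integral>\<tau>. norm (F x \<tau>) \<partial>lborel) \<le> norm (?b x)"
    proof (intro AE_I2)
      fix x
      have "0 \<le> (\<integral>\<tau>. norm (F x \<tau>) \<partial>lborel)" by (rule Bochner_Integration.integral_nonneg) simp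
      then show "norm (\<integral>\<tau>. norm (F x \<tau>) \<partial>lborel) \<le> norm (?b x)"
        using bound[of x] unfolding real_norm_def by linarith
    qed
  qed
  then have int: "integrable (lborel \<Otimes>\<^sub>M lborel) (\<lambda>(x, \<tau>). F x \<tau>)"
    by (intro lborel_pair.Fubini_integrable meas) (use int_\<tau> in auto)
  have left: "(\<integral>\<tau>. F x \<tau> \<partial>lborel) = indicator {0<..} x *\<^sub>R (of_real x powr (\<beta> - 1) * exp (- of_real \<alpha> * of_real x ^ 2) * gauss_int s (of_real \<kappa>) (of_real (\<gamma> * x)))" for x
  proof (cases "x > 0")
    case x: True
    have "(\<integral>\<tau>. F x \<tau> \<partial>lborel) = (LINT \<tau>:{0<..}|lborel. f x \<tau>)"
      using x by (simp add: F_def set_lebesgue_integral_def)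
    also have "\<dots> = (of_real x powr (\<beta> + s - 1) * of_real (exp (- \<alpha> * x\<^sup>2))) * gauss_int s (of_real (\<kappa> * x\<^sup>2)) (of_real (\<gamma> * x\<^sup>2))"
      unfolding f1 gauss_int_def by (rule set_integral_mult_right)
    also have "of_real x powr (\<beta> + s - 1) = of_real x powr (\<beta> - 1) * of_real x powr s"
      unfolding powr_add[symmetric] by (simp add: algebra_simps)
    finally have "(\<integral>\<tau>. F x \<tau> \<partial>lborel) = of_real x powr (\<beta> - 1) * of_real (exp (- \<alpha> * x\<^sup>2)) *
        (of_real x powr s * gauss_int s (of_real (\<kappa> * x\<^sup>2)) (of_real (\<gamma> * x\<^sup>2)))"
      by (simp only: mult_ac)
    \<comment> \<open>For a positive real direction the rotation lemma is plain rescaling and undoes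
      u = x \<tau>.\<close>
    also have "of_real x powr s * gauss_int s (of_real (\<kappa> * x\<^sup>2)) (of_real (\<gamma> * x\<^sup>2)) = gauss_int s (of_real \<kappa>) (of_real (\<gamma> * x))"
      using gauss_int_rotate[OF s \<kappa>, of "of_real x" "of_real (\<gamma> * x)"] x by (simp add: power2_eq_square mult_ac)
    finally show ?thesis using x by (simp flip: exp_of_real)
  qed (simp add: F_def)
  have right: "(\<integral>x. F x \<tau> \<partial>lborel) = Gamma ((\<beta> + s) / 2) / 2 * (indicator {0<..} \<tau> *\<^sub>R (of_real \<tau> powr (s - 1) / of_real (q \<tau>) powr ((\<beta> + s) / 2)))" for \<tau>
  proof (cases "\<tau> > 0")
    case \<tau>: True
    have "(\<integral>x. F x \<tau> \<partial>lborel) = (LINT x:{0<..}|lborel. f x \<tau>)"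
      using \<tau> by (simp add: F_def set_lebesgue_integral_def)
    also have "\<dots> = of_real \<tau> powr (s - 1) * gauss_int (\<beta> + s) (of_real (q \<tau>)) 0"
      unfolding f2 gauss_int_def by (rule set_integral_mult_right)
    also have "\<dots> = of_real \<tau> powr (s - 1) * (Gamma ((\<beta> + s) / 2) / (2 * of_real (q \<tau>) powr ((\<beta> + s) / 2)))"
      by (simp only: gauss_int_at_0[OF \<beta>s q[OF \<tau>]])
    finally show ?thesis using \<tau> by simp
  qed (simp add: F_def)
  have G: "Gamma ((\<beta> + s) / 2) / 2 \<noteq> 0" using Gamma_nonzero_Re_pos[of "(\<beta> + s) / 2"] \<beta>s by simp
  show "set_integrable lborel {0<..} (\<lambda>\<tau>. of_real \<tau> powr (s - 1) / of_real (q \<tau>) powr ((\<beta> + s) / 2))"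
  proof -
    have "integrable lborel (\<lambda>\<tau>. inverse (Gamma ((\<beta> + s) / 2) / 2) * (\<integral>x. F x \<tau> \<partial>lborel))"
      using lborel_pair.integrable_snd[OF int] by (intro integrable_mult_right) simp
    then show ?thesis
      unfolding right mult.assoc[symmetric] left_inverse[OF G] mult_1 set_integrable_def .
  qed
  show "(LINT x:{0<..}|lborel. of_real x powr (\<beta> - 1) * exp (- of_real \<alpha> * of_real x ^ 2) * gauss_int s (of_real \<kappa>) (of_real (\<gamma> * x)))
      = Gamma ((\<beta> + s) / 2) / 2 * (LINT \<tau>:{0<..}|lborel. of_real \<tau> powr (s - 1) / of_real (q \<tau>) powr ((\<beta> + s) / 2))"
    using lborel_pair.Fubini_integral[OF int]
    unfolding left right integral_mult_right_zero set_lebesgue_integral_def by (rule sym)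
qed

text \<open>With v = r^2 / (1 + r^2) this is half the incomplete beta function B_{1/2}(s/2, k -
  s/2).\<close>

definition half_beta :: "complex \<Rightarrow> complex \<Rightarrow> complex" where
  "half_beta k s = (LINT r:{0<..<1}|lborel. of_real r powr (s - 1) / of_real (1 + r\<^sup>2) powr k)"

section \<open>Principal powers of positive reals and incomplete beta integrals\<close>

lemma powr_of_real_mult:
  "\<lbrakk>x > 0; y > 0\<rbrakk> \<Longrightarrow> of_real (x * y) powr s = of_real x powr s * (of_real y powr s :: complex)" for x y :: real
  by (simp only: of_real_mult) (rule powr_times_real, auto)

lemma powr_of_real_divide:
  "\<lbrakk>x > 0; y > 0\<rbrakk> \<Longrightarrow> of_real (x / y) powr s = of_real x powr s / (of_real y powr s :: complex)" for x y :: real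
  by (simp add: powr_def Ln_of_real ln_div right_diff_distrib exp_diff del: of_real_divide)

lemma powr_of_real_sqrt:
  "x > 0 \<Longrightarrow> of_real (sqrt x) powr s = (of_real x powr (s / 2) :: complex)" for x :: real
  by (simp add: powr_def Ln_of_real ln_sqrt)

lemma powr_of_real_square:
  "x > 0 \<Longrightarrow> of_real (x\<^sup>2) powr s = (of_real x powr (2 * s) :: complex)" for x :: real
  by (simp add: powr_def Ln_of_real ln_realpow mult_ac del: of_real_power)

lemma of_real_sqrt_eq_powr: "x > 0 \<Longrightarrow> complex_of_real (sqrt x) = of_real x powr (1 / 2)"
  using powr_of_real_sqrt[of x 1] by simp

lemma one_plus_square_notin_nonpos_Reals:
  "complex_of_real (1 + r\<^sup>2) \<notin> \<real>\<^sub>\<le>\<^sub>0" "1 + complex_of_real r ^ 2 \<notin> \<real>\<^sub>\<le>\<^sub>0" "1 + complex_of_real r ^ 2 \<noteq> 0"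
proof -
  show 1: "complex_of_real (1 + r\<^sup>2) \<notin> \<real>\<^sub>\<le>\<^sub>0" "1 + complex_of_real r ^ 2 \<notin> \<real>\<^sub>\<le>\<^sub>0"
    by (auto simp: complex_nonpos_Reals_iff not_le add_pos_nonneg simp flip: of_real_power)
  then show "1 + complex_of_real r ^ 2 \<noteq> 0" by auto
qed

lemma continuous_on_half_beta:
  "A \<subseteq> {0<..} \<Longrightarrow> continuous_on A (\<lambda>r. of_real r powr s / complex_of_real (1 + r\<^sup>2) powr k)"
  using one_plus_square_notin_nonpos_Reals by (intro continuous_intros) (auto dest: subsetD)

text \<open>The substitution \<open>r = \<tau> / sqrt (\<tau>\<^sup>2 + 2 * \<tau> + 1 / 2)\<close> gives
  \<open>1 + r\<^sup>2 = 2 * (\<tau> + 1 / 2)\<^sup>2 / (\<tau>\<^sup>2 + 2 * \<tau> + 1 / 2)\<close>, so the factor \<open>\<tau> + 1 / 2\<close> of \<open>dr\<close> cancels.\<close>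

lemma half_beta_substitution:
  assumes s: "Re s > 0"
  shows "set_integrable lborel {0<..<1} (\<lambda>r. of_real r powr (s - 1) / of_real (1 + r\<^sup>2) powr (1 / 2))"
    and "(LINT \<tau>:{0<..}|lborel. of_real \<tau> powr (s - 1) / of_real (1 / 4 + 1 * \<tau> + 1 / 2 * \<tau>\<^sup>2) powr ((1 + s) / 2))
      = 2 powr (s / 2 + 1) * half_beta (1 / 2) s"
proof -
  \<comment> \<open>\<open>D\<close> is twice the form 1/4 + \<tau> + \<tau>^2 / 2, which stems from
    the exponent -x^2/4 - x u - u^2/2.\<close>
  define D where "D \<tau> = \<tau>\<^sup>2 + 2 * \<tau> + 1 / 2" for \<tau> :: real
  define g where "g \<tau> = \<tau> / sqrt (D \<tau>)" for \<tau>
  define g' where "g' \<tau> = (\<tau> + 1 / 2) / (D \<tau> * sqrt (D \<tau>))" for \<tau>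
  let ?f = "\<lambda>r::real. of_real r powr (s - 1) / of_real (1 + r\<^sup>2) powr (1 / 2) :: complex"
  have D: "D \<tau> > 0" if "\<tau> > 0" for \<tau> using that by (simp add: D_def add_pos_pos)
  have img: "g ` {0<..} = {0<..<1}"
  proof (intro equalityI subsetI)
    fix r assume "r \<in> g ` {0<..}"
    then obtain \<tau> where "\<tau> > 0" and r: "r = g \<tau>" by auto
    then have "g \<tau> > 0" using D by (simp add: g_def)
    have "\<tau> = sqrt (\<tau>\<^sup>2)" using \<open>\<tau> > 0\<close> by simp
    also have "\<dots> < sqrt (D \<tau>)" unfolding real_sqrt_less_iff using \<open>\<tau> > 0\<close> by (simp add: D_def)
    finally have "g \<tau> < 1" using D[OF \<open>\<tau> > 0\<close>] by (simp add: g_def)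
    then show "r \<in> {0<..<1}" using \<open>g \<tau> > 0\<close> r by simp
  next
    fix r :: real assume r: "r \<in> {0<..<1}"
    \<comment> \<open>To invert, put w = (\<tau> + 1/2) / sqrt D next to r = \<tau> / sqrt D. The
      formula for 1 + r^2 gives w in terms of r, and w - r = 1 / (2 sqrt D) then gives \<tau> = r
      sqrt D.\<close>
    define w where "w = sqrt ((1 + r\<^sup>2) / 2)"
    have w2: "w\<^sup>2 = (1 + r\<^sup>2) / 2" by (simp add: w_def)
    have "r\<^sup>2 < 1" using r by (simp add: power_less_one_iff)
    then have "r\<^sup>2 < w\<^sup>2" unfolding w2 by (simp add: field_simps)
    then have wr: "r < w" by (rule power_less_imp_less_base) (simp add: w_def)
    define \<tau> where "\<tau> = r / (2 * (w - r))"
    have \<tau>: "\<tau> > 0" using r wr by (simp add: \<tau>_def)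
    have "D \<tau> = (1 / (2 * (w - r)))\<^sup>2"
    proof -
      define d where "d = 2 * (w - r)"
      have d: "d \<noteq> 0" and w: "w = r + d / 2" using wr by (auto simp: d_def field_simps)
      have "D \<tau> = r / d * (r / d) + 2 * (r / d) + 1 / 2" by (simp add: D_def \<tau>_def d_def power2_eq_square)
      also have "\<dots> = (r * r + 2 * r * d + d * d / 2) / (d * d)" using d by (simp add: field_simps)
      also have "r * r + 2 * r * d + d * d / 2 = 1"
        using w2 unfolding w by (simp add: power2_eq_square field_simps)
      finally show ?thesis unfolding d_def[symmetric] by (simp add: power2_eq_square)
    qed
    then have "sqrt (D \<tau>) = 1 / (2 * (w - r))" using wr by simp
    then have "g \<tau> = r" using wr by (simp add: g_def \<tau>_def)
    then show "r \<in> g ` {0<..}" using \<tau> by auto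
  qed
  have inj: "inj_on g {0<..}"
  proof (rule inj_onI)
    fix a b :: real assume ab: "a \<in> {0<..}" "b \<in> {0<..}" "g a = g b"
    then have "(g a)\<^sup>2 = (g b)\<^sup>2" by simp
    then have "a\<^sup>2 / D a = b\<^sup>2 / D b" using ab D[of a] D[of b] by (simp add: g_def power_divide)
    then have "a\<^sup>2 * D b = b\<^sup>2 * D a" using ab D[of a] D[of b] by (simp add: field_simps)
    then have "(a - b) * (2 * a * b + (a + b) / 2) = 0" by (simp add: D_def power2_eq_square field_simps)
    moreover have "2 * a * b + (a + b) / 2 > 0" using ab by (simp add: add_pos_pos)
    ultimately show "a = b" by simp
  qed
  have der: "(g has_field_derivative g' \<tau>) (at \<tau>)" if "\<tau> \<in> {0<..}" for \<tau>
  proof -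
    have pos: "D \<tau> > 0" using D that by simp
    have dD: "(D has_field_derivative 2 * \<tau> + 2) (at \<tau>)"
      unfolding D_def [abs_def] by (auto intro!: derivative_eq_intros)
    have "(g has_field_derivative (1 * sqrt (D \<tau>) - \<tau> * (inverse (sqrt (D \<tau>)) / 2 * (2 * \<tau> + 2))) / (sqrt (D \<tau>) * sqrt (D \<tau>))) (at \<tau>)"
      unfolding g_def [abs_def] using pos
      by (intro DERIV_divide DERIV_ident DERIV_chain2[OF DERIV_real_sqrt dD]) auto
    moreover have "(1 * sqrt (D \<tau>) - \<tau> * (inverse (sqrt (D \<tau>)) / 2 * (2 * \<tau> + 2))) / (sqrt (D \<tau>) * sqrt (D \<tau>)) = g' \<tau>"
    proof -
      have "(1 * sqrt (D \<tau>) - \<tau> * (inverse (sqrt (D \<tau>)) / 2 * (2 * \<tau> + 2))) / (sqrt (D \<tau>) * sqrt (D \<tau>))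
          = (sqrt (D \<tau>) * sqrt (D \<tau>) - \<tau> * (\<tau> + 1)) / (sqrt (D \<tau>) * (sqrt (D \<tau>) * sqrt (D \<tau>)))"
        using pos by (simp add: divide_simps) (simp add: algebra_simps)
      also have "\<dots> = (D \<tau> - \<tau> * (\<tau> + 1)) / (D \<tau> * sqrt (D \<tau>))" using pos by simp
      also have "D \<tau> - \<tau> * (\<tau> + 1) = \<tau> + 1 / 2" by (simp add: D_def power2_eq_square algebra_simps)
      finally show ?thesis by (simp only: g'_def)
    qed
    ultimately show ?thesis by (simp only:)
  qed
  have cf: "continuous_on {0<..<1} ?f" by (rule continuous_on_half_beta) auto
  have cg': "continuous_on {0<..} g'"
    unfolding g'_def D_def by (intro continuous_intros) (auto simp: add_pos_pos order_less_imp_not_eq2)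
  have eq: "\<bar>g' \<tau>\<bar> *\<^sub>R ?f (g \<tau>) = inverse (2 powr (s / 2 + 1)) *
      (of_real \<tau> powr (s - 1) / of_real (1 / 4 + 1 * \<tau> + 1 / 2 * \<tau>\<^sup>2) powr ((1 + s) / 2))" if \<tau>: "\<tau> > 0" for \<tau>
  proof -
    have pos: "D \<tau> > 0" using D \<tau> by simp
    have h: "\<tau> + 1 / 2 > 0" using \<tau> by simp
    have "1 + (g \<tau>)\<^sup>2 = (2 * (\<tau> + 1 / 2)\<^sup>2) / D \<tau>"
    proof -
      have "1 + (g \<tau>)\<^sup>2 = (D \<tau> + \<tau>\<^sup>2) / D \<tau>" using pos by (simp add: g_def power_divide add_divide_distrib)
      also have "D \<tau> + \<tau>\<^sup>2 = 2 * (\<tau> + 1 / 2)\<^sup>2" by (simp add: D_def power2_eq_square algebra_simps)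
      finally show ?thesis .
    qed
    then have "complex_of_real (1 + (g \<tau>)\<^sup>2) powr (1 / 2) = (2 powr (1 / 2) * of_real (\<tau> + 1 / 2)) / of_real (D \<tau>) powr (1 / 2)"
      using pos h powr_of_real_square[of "\<tau> + 1 / 2" "1 / 2"] powr_of_real_mult[of 2 "(\<tau> + 1 / 2)\<^sup>2" "1 / 2"]
      by (simp add: powr_of_real_divide[of "2 * (\<tau> + 1 / 2)\<^sup>2" "D \<tau>"] del: of_real_mult of_real_divide of_real_add of_real_power of_real_1)
    moreover have "complex_of_real (g \<tau>) powr (s - 1) = of_real \<tau> powr (s - 1) / of_real (D \<tau>) powr ((s - 1) / 2)"
      unfolding g_def using pos \<tau> by (simp add: powr_of_real_divide powr_of_real_sqrt del: of_real_divide)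
    moreover have "complex_of_real \<bar>g' \<tau>\<bar> = of_real (\<tau> + 1 / 2) / (of_real (D \<tau>) * of_real (D \<tau>) powr (1 / 2))"
      unfolding g'_def using pos h by (simp add: of_real_sqrt_eq_powr del: of_real_add)
    moreover have "complex_of_real (1 / 4 + 1 * \<tau> + 1 / 2 * \<tau>\<^sup>2) powr ((1 + s) / 2) = of_real (D \<tau>) powr ((1 + s) / 2) / 2 powr ((1 + s) / 2)"
    proof -
      have "1 / 4 + 1 * \<tau> + 1 / 2 * \<tau>\<^sup>2 = D \<tau> / 2" by (simp add: D_def field_simps)
      then show ?thesis using powr_of_real_divide[OF pos, of 2 "(1 + s) / 2"] by (simp only: of_real_numeral)
    qed
    moreover have "of_real (D \<tau>) powr ((1 + s) / 2) = of_real (D \<tau>) * of_real (D \<tau>) powr ((s - 1) / 2)"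
    proof -
      have "of_real (D \<tau>) powr (1 + (s - 1) / 2) = of_real (D \<tau>) powr 1 * of_real (D \<tau>) powr ((s - 1) / 2)"
        by (rule powr_add)
      moreover have "1 + (s - 1) / 2 = (1 + s) / 2" by (simp add: field_simps)
      ultimately show ?thesis using pos by simp
    qed
    moreover have "(2::complex) powr (s / 2 + 1) = 2 powr ((1 + s) / 2) * 2 powr (1 / 2)"
      unfolding powr_add[symmetric] by (simp add: field_simps)
    moreover have "h / (D * d) * ((T / m) / ((w * h) / d)) = inverse (p * w) * (T / ((D * m) / p))"
      if "h \<noteq> 0" "D \<noteq> 0" "d \<noteq> 0" "m \<noteq> 0" "w \<noteq> 0" "p \<noteq> 0" for h D d T m w p :: complex
      using that by (simp add: field_simps)
    note this[of "of_real (\<tau> + 1 / 2)" "of_real (D \<tau>)" "of_real (D \<tau>) powr (1 / 2)" "of_real (D \<tau>) powr ((s - 1) / 2)"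
        "2 powr (1 / 2)" "2 powr ((1 + s) / 2)"]
    moreover have "complex_of_real (\<tau> + 1 / 2) \<noteq> 0" "complex_of_real (D \<tau>) \<noteq> 0"
      using pos h by (simp_all only: of_real_eq_0_iff)
    moreover have "(2 :: complex) powr x \<noteq> 0" "complex_of_real (D \<tau>) powr x \<noteq> 0" for x
      using pos by simp_all
    ultimately show ?thesis
      by (simp only: scaleR_conv_of_real not_False_eq_True simp_thms)
  qed
  have iL: "set_integrable lborel {0<..} (\<lambda>\<tau>. of_real \<tau> powr (s - 1) / complex_of_real (1 / 4 + 1 * \<tau> + 1 / 2 * \<tau>\<^sup>2) powr ((1 + s) / 2))"
    by (rule gauss_double_integral(1)) (use s in auto)
  have "set_integrable lborel {0<..} (\<lambda>\<tau>. \<bar>g' \<tau>\<bar> *\<^sub>R ?f (g \<tau>))"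
  proof -
    have "set_integrable lborel {0<..} (\<lambda>\<tau>. inverse (2 powr (s / 2 + 1)) *
        (of_real \<tau> powr (s - 1) / complex_of_real (1 / 4 + 1 * \<tau> + 1 / 2 * \<tau>\<^sup>2) powr ((1 + s) / 2)))"
      by (intro set_integrable_mult_right impI iL)
    then show ?thesis
      by (rule set_integrable_cong[THEN iffD1, rotated -1]) (use eq in auto)
  qed
  then show int: "set_integrable lborel {0<..<1} ?f"
    using set_integral_change_of_variables(1)[OF _ _ img inj der cf cg'] by simp
  have "half_beta (1 / 2) s = (LINT \<tau>:{0<..}|lborel. \<bar>g' \<tau>\<bar> *\<^sub>R ?f (g \<tau>))"
    unfolding half_beta_def
    by (rule set_integral_change_of_variables(2)[OF _ _ img inj der cf cg' int, symmetric]) auto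
  moreover have "(LINT \<tau>:{0<..}|lborel. \<bar>g' \<tau>\<bar> *\<^sub>R ?f (g \<tau>)) = (LINT \<tau>:{0<..}|lborel. inverse (2 powr (s / 2 + 1)) *
      (of_real \<tau> powr (s - 1) / complex_of_real (1 / 4 + 1 * \<tau> + 1 / 2 * \<tau>\<^sup>2) powr ((1 + s) / 2)))"
    by (rule set_lebesgue_integral_cong) (use eq in auto)
  ultimately have "half_beta (1 / 2) s = inverse (2 powr (s / 2 + 1)) * (LINT \<tau>:{0<..}|lborel.
      of_real \<tau> powr (s - 1) / complex_of_real (1 / 4 + 1 * \<tau> + 1 / 2 * \<tau>\<^sup>2) powr ((1 + s) / 2))"
    by (simp only: set_integral_mult_right)
  then show "(LINT \<tau>:{0<..}|lborel. of_real \<tau> powr (s - 1) / of_real (1 / 4 + 1 * \<tau> + 1 / 2 * \<tau>\<^sup>2) powr ((1 + s) / 2))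
      = 2 powr (s / 2 + 1) * half_beta (1 / 2) s"
    by (simp only: mult.assoc[symmetric]) simp
qed

text \<open>The double integral with \<open>\<alpha> = 1 / 4\<close>, \<open>\<gamma> = 1\<close>,
  \<open>\<kappa> = 1 / 2\<close> and \<open>\<beta> = 1\<close>.\<close>

lemma pcf_moment_0:
  assumes s: "Re s > 0"
  shows "pcf_moment s 0 = Gamma ((s + 1) / 2) * 2 powr (s / 2) * half_beta (1 / 2) s"
proof -
  have "pcf_moment s 0 = (LINT x:{0<..}|lborel. of_real x powr (1 - 1) * exp (- of_real (1 / 4) * of_real x ^ 2) * gauss_int s (of_real (1 / 2)) (of_real (1 * x)))"
    unfolding pcf_moment_def by (rule set_lebesgue_integral_cong) (auto simp: pcf_int_def)
  also have "\<dots> = Gamma ((1 + s) / 2) / 2 * (2 powr (s / 2 + 1) * half_beta (1 / 2) s)"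
    unfolding half_beta_substitution(2)[OF s, symmetric]
    by (rule gauss_double_integral(2)) (use s in auto)
  finally show ?thesis by (simp add: powr_add add.commute)
qed

text \<open>The inversion r -> 1/r exchanges (0, 1) with (1, \<infinity>) and \<open>s\<close> with
  \<open>2 * k - s = t\<close>, so the two halves add up to the complete integral over the positive
  axis.\<close>

lemma half_beta_add:
  assumes s: "Re s > 0" and t: "Re t > 0"
  defines "k \<equiv> (t + s) / 2"
  shows "set_integrable lborel {0<..<1} (\<lambda>r. of_real r powr (s - 1) / of_real (1 + r\<^sup>2) powr k)"
    and "half_beta k s + half_beta k t = Gamma (s / 2) * Gamma (t / 2) / (2 * Gamma k)"
proof -
  let ?f = "\<lambda>s r. of_real r powr (s - 1) / complex_of_real (1 + r\<^sup>2) powr k"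
  have pos: "1 + r\<^sup>2 > 0" for r :: real by (simp add: add_pos_nonneg)
  have k: "Re k > 0" using s t by (simp add: k_def)
  have q: "complex_of_real (1 / 2 + 0 * r + 1 / 2 * r\<^sup>2) powr k = of_real (1 + r\<^sup>2) powr k / 2 powr k" for r
  proof -
    have "1 / 2 + 0 * r + 1 / 2 * r\<^sup>2 = (1 + r\<^sup>2) / 2" by (simp add: field_simps)
    then show ?thesis using powr_of_real_divide[OF pos[of r], of 2 k] by (simp only: of_real_numeral)
  qed
  have di: "set_integrable lborel {0<..} (\<lambda>r. of_real r powr (s - 1) / of_real (1 / 2 + 0 * r + 1 / 2 * r\<^sup>2) powr k)"
    unfolding k_def by (rule gauss_double_integral(1)) (use s t in auto)
  have int: "set_integrable lborel {0<..} (?f s)"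
  proof -
    have "set_integrable lborel {0<..} (\<lambda>r. inverse (2 powr k) * (of_real r powr (s - 1) / of_real (1 / 2 + 0 * r + 1 / 2 * r\<^sup>2) powr k))"
      by (intro set_integrable_mult_right impI di)
    then show ?thesis unfolding q by (simp add: divide_inverse mult_ac)
  qed
  then show int01: "set_integrable lborel {0<..<1} (?f s)"
    by (rule set_integrable_subset) auto
  have int1: "set_integrable lborel {1<..} (?f s)"
    using int by (rule set_integrable_subset) auto
  \<comment> \<open>With \<open>\<gamma> = 0\<close> the inner integral no longer depends on
    \<open>x\<close>, so the double integral factors into two values at 0: the beta-Gamma
    relation.\<close>
  have total: "(LINT r:{0<..}|lborel. ?f s r) = Gamma (s / 2) * Gamma (t / 2) / (2 * Gamma k)"
  proof -
    have "(LINT x:{0<..}|lborel. of_real x powr (t - 1) * exp (- of_real (1 / 2) * of_real x ^ 2) * gauss_int s (of_real (1 / 2)) (of_real (0 * x)))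
      = Gamma k / 2 * (LINT r:{0<..}|lborel. of_real r powr (s - 1) / of_real (1 / 2 + 0 * r + 1 / 2 * r\<^sup>2) powr k)"
      unfolding k_def by (rule gauss_double_integral(2)) (use s t in auto)
    moreover have "(LINT x:{0<..}|lborel. of_real x powr (t - 1) * exp (- of_real (1 / 2) * of_real x ^ 2) * gauss_int s (of_real (1 / 2)) (of_real (0 * x)))
      = gauss_int t (1 / 2) 0 * gauss_int s (1 / 2) 0"
      unfolding gauss_int_def[of t] set_integral_mult_left[symmetric] by simp
    moreover have "(LINT r:{0<..}|lborel. of_real r powr (s - 1) / of_real (1 / 2 + 0 * r + 1 / 2 * r\<^sup>2) powr k) = 2 powr k * (LINT r:{0<..}|lborel. ?f s r)"
      unfolding q set_integral_mult_right[symmetric] by (simp add: field_simps)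
    moreover have "gauss_int s' (1 / 2) 0 = 2 powr (s' / 2 - 1) * Gamma (s' / 2)" if "Re s' > 0" for s'
      using pcf_int_at_0[OF that] by (simp add: pcf_int_def)
    moreover have "(2 :: complex) powr k = 4 * (2 powr (t / 2 - 1) * 2 powr (s / 2 - 1))"
    proof -
      have "(2 :: complex) powr k = 2 powr (t / 2) * 2 powr (s / 2)"
        unfolding powr_add[symmetric] k_def by (simp add: add_divide_distrib)
      then show ?thesis by (simp add: powr_diff)
    qed
    ultimately have "2 powr (t / 2 - 1) * Gamma (t / 2) * (2 powr (s / 2 - 1) * Gamma (s / 2))
        = Gamma k / 2 * (4 * (2 powr (t / 2 - 1) * 2 powr (s / 2 - 1)) * (LINT r:{0<..}|lborel. ?f s r))"
      using s t by (simp only:)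
    then have "(2 powr (t / 2 - 1) * 2 powr (s / 2 - 1)) * (Gamma (t / 2) * Gamma (s / 2))
        = (2 powr (t / 2 - 1) * 2 powr (s / 2 - 1)) * (2 * Gamma k * (LINT r:{0<..}|lborel. ?f s r))"
      by (simp add: mult_ac)
    then have "Gamma (t / 2) * Gamma (s / 2) = 2 * Gamma k * (LINT r:{0<..}|lborel. ?f s r)"
      by (subst (asm) mult_cancel_left) simp
    then show ?thesis using Gamma_nonzero_Re_pos[OF k] by (simp add: field_simps)
  qed
  have inv: "\<bar>- 1 / r\<^sup>2\<bar> *\<^sub>R ?f s (1 / r) = ?f t r" if r: "r > 0" for r
  proof -
    have "1 + (1 / r)\<^sup>2 = (1 + r\<^sup>2) / r\<^sup>2" using r by (simp add: field_simps)
    then have "complex_of_real (1 + (1 / r)\<^sup>2) powr k = of_real (1 + r\<^sup>2) powr k / of_real r powr (2 * k)"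
      using powr_of_real_divide[OF pos[of r], of "r\<^sup>2" k] powr_of_real_square[OF r, of k] r by (simp only: zero_less_power)
    moreover have "complex_of_real (1 / r) powr (s - 1) = 1 / of_real r powr (s - 1)"
      using powr_of_real_divide[of 1 r "s - 1"] r by simp
    moreover have "complex_of_real r powr (t - 1) = of_real r powr (2 * k) / (of_real r powr (s - 1) * of_real r ^ 2)"
    proof -
      have "complex_of_real r powr (2 * k) = of_real r powr (t - 1) * (of_real r powr (s - 1) * of_real r powr 2)"
        unfolding powr_add[symmetric] by (rule arg_cong[of _ _ "(powr) (of_real r)"]) (simp add: k_def)
      then show ?thesis using r by (simp add: field_simps)
    qed
    moreover have "complex_of_real \<bar>- 1 / r\<^sup>2\<bar> = 1 / of_real r ^ 2" by simp
    moreover have "1 / x * (1 / p / (E / q)) = q / (p * x) / E" for x p E q :: complex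
      by simp
    ultimately show ?thesis by (simp only: scaleR_conv_of_real)
  qed
  have "(LINT r:{1<..}|lborel. ?f s r) = half_beta k t"
  proof -
    have "(LINT r:{0<..<1}|lborel. \<bar>- 1 / r\<^sup>2\<bar> *\<^sub>R ?f s (1 / r)) = (LINT r:{1<..}|lborel. ?f s r)"
    proof (rule set_integral_change_of_variables(2)[OF _ _ _ _ _ _ _ int1])
      show "(\<lambda>r. 1 / r) ` {0<..<1} = {1::real<..}"
      proof safe
        fix x :: real assume "x > 1"
        then have "x = 1 / (1 / x)" "1 / x \<in> {0<..<1}" by auto
        then show "x \<in> (\<lambda>r. 1 / r) ` {0<..<1}" by blast
      qed auto
      show "inj_on (\<lambda>r::real. 1 / r) {0<..<1}" by (auto simp: inj_on_def)
      show "((\<lambda>r. 1 / r) has_field_derivative - 1 / r\<^sup>2) (at r)" if "r \<in> {0<..<1}" for r :: real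
        using that by (auto intro!: derivative_eq_intros simp: power2_eq_square)
      show "continuous_on {1<..} (?f s)"
        by (rule continuous_on_half_beta) auto
      show "continuous_on {0<..<1} (\<lambda>r::real. - 1 / r\<^sup>2)" by (intro continuous_intros) auto
    qed auto
    moreover have "(LINT r:{0<..<1}|lborel. \<bar>- 1 / r\<^sup>2\<bar> *\<^sub>R ?f s (1 / r)) = half_beta k t"
      unfolding half_beta_def by (rule set_lebesgue_integral_cong) (use inv in auto)
    ultimately show ?thesis by simp
  qed
  moreover have "(LINT r:{0<..}|lborel. ?f s r) = (LINT r:({0<..<1} \<union> {1<..})|lborel. ?f s r)"
    by (rule set_integral_discrete_difference[where X = "{1}"]) auto
  moreover have "\<dots> = half_beta k s + (LINT r:{1<..}|lborel. ?f s r)"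
    unfolding half_beta_def by (rule set_integral_Un[OF _ int01 int1]) auto
  ultimately show "half_beta k s + half_beta k t = Gamma (s / 2) * Gamma (t / 2) / (2 * Gamma k)"
    using total by simp
qed

text \<open>The right-hand side is the value at r = 1 of r^(s+1) / (1 + r^2)^(1/2). Its purpose is
  to raise the exponent from 1/2 to 3/2, where \<open>half_beta_add\<close> can pair
  \<open>s + 1\<close> with \<open>t + 1\<close>.\<close>

lemma half_beta_parts:
  assumes s: "0 < Re s" "Re s < 2"
  shows "s * half_beta (1 / 2) (s + 1) + half_beta (3 / 2) (s + 1) = 1 / 2 powr (1 / 2)"
proof -
  let ?f = "\<lambda>k r. of_real r powr (s + 1 - 1) / complex_of_real (1 + r\<^sup>2) powr k"
  let ?h = "\<lambda>r. s * ?f (1 / 2) r + ?f (3 / 2) r"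
  let ?F = "\<lambda>r. of_real r powr (s + 1) / complex_of_real (1 + r\<^sup>2) powr (1 / 2)"
  have i1: "set_integrable lborel {0<..<1} (\<lambda>r. s * ?f (1 / 2) r)"
    using half_beta_substitution(1)[of "s + 1"] s by (intro set_integrable_mult_right impI) simp
  \<comment> \<open>The partner parameter \<open>2 - s\<close> makes the sum 3, that is
    \<open>k = 3 / 2\<close>; its real part is positive because \<open>Re s < 2\<close>.\<close>
  have i2: "set_integrable lborel {0<..<1} (?f (3 / 2))"
    using half_beta_add(1)[of "s + 1" "2 - s"] s by simp
  note npos = one_plus_square_notin_nonpos_Reals(1,2) and nz = one_plus_square_notin_nonpos_Reals(3)
  have "(LBINT r=ereal 0..ereal 1. ?h r) = 1 / 2 powr (1 / 2) - 0"
  proof (rule interval_integral_FTC_integrable)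
    fix r assume r: "ereal 0 < ereal r" "ereal r < ereal 1"
    have "((\<lambda>u. u powr (s + 1) / (1 + u ^ 2) powr (1 / 2)) has_field_derivative ?h r) (at (of_real r))"
    proof -
      let ?u = "complex_of_real r"
      have sq: "(1 + ?u ^ 2) powr (1 / 2) * (1 + ?u ^ 2) powr (1 / 2) = 1 + ?u ^ 2"
        unfolding powr_add[symmetric] using nz[of r] by simp
      \<comment> \<open>The quotient rule with the powers as atoms: \<open>X\<close> is 1 + u^2,
        \<open>S\<close> its square root and \<open>P\<close> the power u^s.\<close>
      have alg: "((s + 1) * P * S - P * u * (1 / 2 * (S / X) * (2 * u))) / (S * S) = s * (P / S) + P / (S * X)"
        if "S * S = X" "X = 1 + u\<^sup>2" "X \<noteq> 0" for S X P u :: complex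
      proof -
        have "S \<noteq> 0" using that by auto
        have "((s + 1) * P * S - P * u * (1 / 2 * (S / X) * (2 * u))) / (S * S) = P * S * ((s + 1) * X - u\<^sup>2) / (X * X)"
          using that(1,3) by (simp add: field_simps power2_eq_square)
        also have "(s + 1) * X - u\<^sup>2 = s * X + 1" by (simp add: that(2) algebra_simps)
        also have "P * S * (s * X + 1) / (X * X) = P * (s * X + 1) / (S * X)"
          using \<open>S \<noteq> 0\<close> \<open>X \<noteq> 0\<close> that(1)[symmetric] by (simp add: field_simps)
        also have "\<dots> = s * (P / S) + P / (S * X)"
          using \<open>S \<noteq> 0\<close> \<open>X \<noteq> 0\<close> by (simp add: field_simps)
        finally show ?thesis .
      qed
      have "((\<lambda>u. u powr (s + 1) / (1 + u ^ 2) powr (1 / 2)) has_field_derivative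
          (((s + 1) * ?u powr (s + 1 - 1) * (1 + ?u ^ 2) powr (1 / 2) - ?u powr (s + 1) * (1 / 2 * (1 + ?u ^ 2) powr (1 / 2 - 1) * (2 * ?u)))
            / ((1 + ?u ^ 2) powr (1 / 2) * (1 + ?u ^ 2) powr (1 / 2)))) (at ?u)"
        using r npos(2)[of r] nz[of r] by (intro DERIV_divide) (auto intro!: derivative_eq_intros)
      moreover have "?u powr (s + 1) = ?u powr s * ?u" using r by (simp add: powr_add)
      moreover have "(1 + ?u ^ 2) powr (3 / 2) = (1 + ?u ^ 2) powr (1 / 2) * (1 + ?u ^ 2)"
        using powr_add[of "1 + ?u ^ 2" "1 / 2" 1] nz[of r] by simp
      moreover have "(1 + ?u ^ 2) powr (1 / 2 - 1) = (1 + ?u ^ 2) powr (1 / 2) / (1 + ?u ^ 2)"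
        using powr_diff[of "1 + ?u ^ 2" "1 / 2" 1] nz[of r] by simp
      ultimately show ?thesis
        by (simp only: add_diff_cancel_right' of_real_add of_real_1 of_real_power alg[OF sq refl nz])
    qed
    from has_vector_derivative_real_field[OF this]
    show "(?F has_vector_derivative ?h r) (at r)" by simp
    have "continuous_on {0<..<1} ?h"
      using npos nz by (intro continuous_intros) auto
    then show "isCont ?h r"
      using r by (simp add: continuous_on_eq_continuous_at)
  next
    show "set_integrable lborel (einterval (ereal 0) (ereal 1)) ?h"
      using set_integral_add(1)[OF i1 i2] by (simp add: einterval_eq)
    have c: "(?F \<longlongrightarrow> ?F r) (at r within {0..1})" if "r \<in> {0..1}" for r
    proof -
      have "continuous_on {0..1} ?F"
        using npos nz s by (intro continuous_intros continuous_on_powr_complex) auto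
      then show ?thesis using that by (auto simp: continuous_on_def)
    qed
    have "(?F \<longlongrightarrow> ?F 0) (at_right 0)"
      using c[of 0] by (simp add: at_within_Icc_at_right)
    then show "((?F \<circ> real_of_ereal) \<longlongrightarrow> 0) (at_right (ereal 0))"
      by (simp add: ereal_tendsto_simps)
    have "(?F \<longlongrightarrow> ?F 1) (at_left 1)"
      using c[of 1] by (simp add: at_within_Icc_at_left)
    then show "((?F \<circ> real_of_ereal) \<longlongrightarrow> 1 / 2 powr (1 / 2)) (at_left (ereal 1))"
      by (simp add: ereal_tendsto_simps)
  qed simp
  then have "(LINT r:{0<..<1}|lborel. ?h r) = 1 / 2 powr (1 / 2)"
    by (simp add: interval_lebesgue_integral_def einterval_eq)
  then show ?thesis
    unfolding half_beta_def using i1 i2 by (simp only: set_integral_add set_integral_mult_right)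
qed

text \<open>The boundary term of \<open>pcf_moment_1\<close> is exactly what
  \<open>half_beta_parts\<close> absorbs, so a single incomplete beta integral remains.\<close>

lemma pcf_moment_1_half_beta:
  assumes s: "0 < Re s" "Re s < 2"
  shows "pcf_moment s 1 = Gamma (s / 2) * 2 powr ((s + 1) / 2) * half_beta (3 / 2) (s + 1)"
proof -
  have s1: "Re (s + 1) > 0" and s0: "s / 2 \<noteq> 0" using s by auto
  have G: "Gamma ((s + 1 + 1) / 2) = s / 2 * Gamma (s / 2)"
  proof -
    have "s / 2 \<notin> \<int>\<^sub>\<le>\<^sub>0" by (rule Re_pos_not_nonpos_Ints) (use s in simp)
    moreover have "(s + 1 + 1) / 2 = s / 2 + 1" by simp
    ultimately show ?thesis by (metis Gamma_plus1)
  qed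
  have p: "(2::complex) powr ((s + 1) / 2) = 2 powr (s / 2) * 2 powr (1 / 2)"
    by (simp add: powr_add add_divide_distrib)
  have r: "half_beta (3 / 2) (s + 1) = 1 / 2 powr (1 / 2) - s * half_beta (1 / 2) (s + 1)"
    using half_beta_parts[OF s] by (simp add: algebra_simps)
  have "pcf_moment s 1 = 2 * (2 powr (s / 2 - 1) * Gamma (s / 2)) - 2 * (s / 2 * Gamma (s / 2) * 2 powr ((s + 1) / 2) * half_beta (1 / 2) (s + 1))"
    by (simp only: pcf_moment_1[OF s(1)] pcf_int_at_0[OF s(1)] pcf_moment_0[OF s1] G)
  also have "(2::complex) powr (s / 2 - 1) = 2 powr (s / 2) / 2" by (simp add: powr_diff)
  finally show ?thesis unfolding p r by (simp add: right_diff_distrib)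
qed

section \<open>The terminating hypergeometric sum\<close>

text \<open>The hypergeometric equation at the point 1/2, written as a contiguous relation.\<close>

lemma hypergeo_reg_half_rec:
  assumes N: "\<And>k. k \<ge> N \<Longrightarrow> pochhammer (\<alpha> + 1) k * pochhammer (\<beta> + 1) k = (0 :: complex)"
  shows "hypergeo_reg \<alpha> \<beta> c (1 / 2) = (c - (\<alpha> + \<beta> + 1) / 2) * hypergeo_reg (\<alpha> + 1) (\<beta> + 1) (c + 1) (1 / 2)
    + (\<alpha> + 1) * (\<beta> + 1) / 4 * hypergeo_reg (\<alpha> + 2) (\<beta> + 2) (c + 2) (1 / 2)"
proof -
  define u where "u k = pochhammer (\<alpha> + 1) k * pochhammer (\<beta> + 1) k * (1 / 2) ^ k * rGamma (c + 1 + of_nat k) / fact k" for k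
  define v where "v k = pochhammer \<alpha> k * pochhammer \<beta> k * (1 / 2) ^ k * rGamma (c + of_nat k) / fact k" for k
  define w where "w k = pochhammer (\<alpha> + 2) k * pochhammer (\<beta> + 2) k * (1 / 2) ^ k * rGamma (c + 2 + of_nat k) / fact k" for k
  have u0: "u k = 0" if "k \<ge> N" for k using N[OF that] by (simp add: u_def)
  have u_Suc: "(\<alpha> + 1 + of_nat k) * (\<beta> + 1 + of_nat k) * u k = 2 * of_nat (Suc k) * (c + of_nat (Suc k)) * u (Suc k)" for k
  proof -
    have "rGamma (c + 1 + of_nat k) = (c + of_nat (Suc k)) * rGamma (c + 1 + of_nat (Suc k))"
      using rGamma_plus1[of "c + 1 + of_nat k"] by (simp add: algebra_simps)
    then show ?thesis
      by (simp add: u_def pochhammer_rec' divide_simps del: of_nat_Suc)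
  qed
  have v_0: "v 0 = c * u 0"
    using rGamma_plus1[of c] by (simp add: u_def v_def)
  have v_Suc: "v (Suc k) = (c + of_nat (Suc k)) * u (Suc k) - (\<alpha> + \<beta> + of_nat (Suc k)) / 2 * u k" for k
  proof -
    have "2 * of_nat (Suc k) * v (Suc k) = \<alpha> * \<beta> * u k"
      by (simp add: u_def v_def pochhammer_rec divide_simps add.assoc del: of_nat_Suc) (simp add: algebra_simps)
    \<comment> \<open>\<open>\<alpha> * \<beta>\<close> is rewritten so that the first product is
      the one in the term recursion \<open>u_Suc\<close>; the second has a factor
      \<open>Suc k\<close>, which cancels.\<close>
    also have "\<dots> = (\<alpha> + 1 + of_nat k) * (\<beta> + 1 + of_nat k) * u k - of_nat (Suc k) * (\<alpha> + \<beta> + of_nat (Suc k)) * u k"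
      by (simp add: algebra_simps)
    also have "\<dots> = 2 * of_nat (Suc k) * ((c + of_nat (Suc k)) * u (Suc k) - (\<alpha> + \<beta> + of_nat (Suc k)) / 2 * u k)"
      unfolding u_Suc by (simp add: algebra_simps)
    finally show ?thesis by (simp del: of_nat_Suc)
  qed
  have w_Suc: "(\<alpha> + 1) * (\<beta> + 1) / 4 * w k = of_nat (Suc k) / 2 * u (Suc k)" for k
    by (simp add: u_def w_def pochhammer_rec divide_simps add.assoc del: of_nat_Suc) (simp add: algebra_simps)
  have "(\<Sum>k. u k) = (\<Sum>k<Suc N. u k)"
    by (rule suminf_finite) (auto intro: u0)
  moreover have "(\<Sum>k. v k) = (\<Sum>k<Suc N. v k)"
  proof (rule suminf_finite)
    fix k assume "k \<notin> {..<Suc N}"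
    then obtain m where "k = Suc m" "m \<ge> N" by (cases k) auto
    then show "v k = 0" using u0[of m] u0[of "Suc m"] by (simp add: v_Suc)
  qed simp
  \<comment> \<open>When the coefficient vanishes the series of \<open>w\<close> need not terminate,
    but the factor 0 kills it; otherwise the vanishing of \<open>u\<close> carries over to
    \<open>w\<close>.\<close>
  moreover have "(\<alpha> + 1) * (\<beta> + 1) / 4 * (\<Sum>k. w k) = (\<alpha> + 1) * (\<beta> + 1) / 4 * (\<Sum>k<N. w k)"
  proof (cases "(\<alpha> + 1) * (\<beta> + 1) = 0")
    case False
    have "(\<Sum>k. w k) = (\<Sum>k<N. w k)"
    proof (rule suminf_finite)
      fix k assume "k \<notin> {..<N}"
      then show "w k = 0" using u0[of "Suc k"] w_Suc[of k] False by auto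
    qed simp
    then show ?thesis by simp
  qed simp
  moreover have "(\<Sum>k<Suc N. v k) = (c - (\<alpha> + \<beta> + 1) / 2) * (\<Sum>k<Suc N. u k) + (\<alpha> + 1) * (\<beta> + 1) / 4 * (\<Sum>k<N. w k)"
  proof -
    have "(\<Sum>k<Suc N. v k) = c * u 0 + (\<Sum>k<N. (c + of_nat (Suc k)) * u (Suc k)) - (\<Sum>k<N. (\<alpha> + \<beta> + of_nat (Suc k)) / 2 * u k)"
      by (simp only: sum.lessThan_Suc_shift v_0 v_Suc sum_subtractf) simp
    also have "c * u 0 + (\<Sum>k<N. (c + of_nat (Suc k)) * u (Suc k)) = (\<Sum>k<Suc N. (c + of_nat k) * u k)"
      by (simp add: sum.lessThan_Suc_shift del: sum.lessThan_Suc)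
    also have "(\<Sum>k<N. (\<alpha> + \<beta> + of_nat (Suc k)) / 2 * u k) = (\<Sum>k<Suc N. (\<alpha> + \<beta> + of_nat (Suc k)) / 2 * u k)"
      using u0[of N] by simp
    also have "(\<Sum>k<Suc N. (c + of_nat k) * u k) - (\<Sum>k<Suc N. (\<alpha> + \<beta> + of_nat (Suc k)) / 2 * u k)
        = (\<Sum>k<Suc N. (c - (\<alpha> + \<beta> + 1) / 2) * u k + of_nat k / 2 * u k)"
      unfolding sum_subtractf[symmetric] by (rule sum.cong) (simp_all add: field_simps)
    also have "\<dots> = (c - (\<alpha> + \<beta> + 1) / 2) * (\<Sum>k<Suc N. u k) + (\<Sum>k<Suc N. of_nat k / 2 * u k)"
      by (simp only: sum.distrib sum_distrib_left)
    also have "(\<Sum>k<Suc N. of_nat k / 2 * u k) = (\<Sum>k<N. of_nat (Suc k) / 2 * u (Suc k))"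
      by (simp add: sum.lessThan_Suc_shift del: sum.lessThan_Suc)
    also have "\<dots> = (\<alpha> + 1) * (\<beta> + 1) / 4 * (\<Sum>k<N. w k)"
      by (simp only: sum_distrib_left w_Suc)
    finally show ?thesis .
  qed
  ultimately show ?thesis
    unfolding hypergeo_reg_def u_def[symmetric] v_def[symmetric] w_def[symmetric] by (simp only:)
qed

section \<open>The coefficient of W_2: recursion and initial values\<close>

lemma exp_half_pi_i: "exp (of_real pi * \<i> / 2) = \<i>" "exp (\<i> * of_real pi / 2) = \<i>"
  using cis_conv_exp[of "pi / 2"] by (simp_all add: mult.commute)

definition stokes_coeff :: "complex \<Rightarrow> nat \<Rightarrow> complex" where
  "stokes_coeff b R = \<i> * exp (- (3 * of_nat R * of_real pi * \<i> / 4)) * Lambda R b"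

text \<open>Raising \<open>R\<close> by 2 multiplies the elementary prefactor by i * 8 * (-1) = -8
  i, while the contiguous relation gives F the coefficients b/2 and R (R - 1) / 16. Hence -8 i * b/2
  = -4 i b and (-8 i)^2 / 16 = -4.\<close>

lemma stokes_coeff_rec:
  "stokes_coeff b (R + 2) = - 4 * \<i> * b * stokes_coeff b R - 4 * of_nat R * of_nat (R - 1) * stokes_coeff b (R - 2)"
proof -
  define F where "F n = hypergeo_reg (1 / 2 - of_nat n / 2) (- of_nat n / 2) (b / 2 - of_nat n / 2 + 3 / 4) (1 / 2)" for n
  define L where "L n = \<i> * exp (- (3 * of_nat n * of_real pi * \<i> / 4)) * (2 powr (- b / 2 + 3 / 2 * of_nat n + 1 / 4) * of_real (sqrt pi) *
     exp ((b / 2 + of_nat n / 2 - 3 / 4) * of_real pi * \<i>) * Gamma (b + 1 / 2))" for n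
  have Y: "stokes_coeff b n = L n * F n" for n
    by (simp add: stokes_coeff_def Lambda_def L_def F_def)
  have L2: "L (n + 2) = - 8 * \<i> * L n" for n
  proof -
    have "exp (- (3 * of_nat (n + 2) * of_real pi * \<i> / 4)) = exp (- (3 * of_nat n * of_real pi * \<i> / 4)) * exp (- (of_real pi * \<i> / 2) - of_real pi * \<i>)"
      unfolding exp_add[symmetric] by (rule arg_cong[of _ _ exp]) (simp add: field_simps)
    also have "exp (- (of_real pi * \<i> / 2) - of_real pi * \<i>) = \<i>"
      by (simp only: exp_diff exp_minus exp_pi_i exp_half_pi_i) simp
    finally have 1: "exp (- (3 * of_nat (n + 2) * of_real pi * \<i> / 4)) = exp (- (3 * of_nat n * of_real pi * \<i> / 4)) * \<i>" .
    have "(2::complex) powr (- b / 2 + 3 / 2 * of_nat (n + 2) + 1 / 4) = 2 powr (- b / 2 + 3 / 2 * of_nat n + 1 / 4) * 2 powr (of_nat 3)"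
      unfolding powr_add[symmetric] by (simp add: field_simps)
    also have "(2::complex) powr (of_nat 3) = 8" by (subst powr_nat) simp
    finally have 2: "(2::complex) powr (- b / 2 + 3 / 2 * of_nat (n + 2) + 1 / 4) = 2 powr (- b / 2 + 3 / 2 * of_nat n + 1 / 4) * 8" .
    have "exp ((b / 2 + of_nat (n + 2) / 2 - 3 / 4) * of_real pi * \<i>) = exp ((b / 2 + of_nat n / 2 - 3 / 4) * of_real pi * \<i>) * exp (of_real pi * \<i>)"
      unfolding exp_add[symmetric] by (rule arg_cong[of _ _ exp]) (simp add: field_simps)
    then have 3: "exp ((b / 2 + of_nat (n + 2) / 2 - 3 / 4) * of_real pi * \<i>) = - exp ((b / 2 + of_nat n / 2 - 3 / 4) * of_real pi * \<i>)"
      by (simp add: exp_pi_i mult.commute)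
    show ?thesis unfolding L_def 1 2 3 by simp
  qed
  have F2: "F (R + 2) = b / 2 * F R + of_nat R * of_nat (R - 1) / 16 * F (R - 2)"
  proof -
    let ?\<alpha> = "1 / 2 - of_nat (R + 2) / 2 :: complex" and ?\<beta> = "- of_nat (R + 2) / 2 :: complex"
      and ?c = "b / 2 - of_nat (R + 2) / 2 + 3 / 4"
    have \<alpha>: "?\<alpha> + 1 = 1 / 2 - of_nat R / 2" and \<beta>: "?\<beta> + 1 = - of_nat R / 2" and c: "?c + 1 = b / 2 - of_nat R / 2 + 3 / 4"
      by (simp_all add: field_simps)
    \<comment> \<open>Depending on the parity of \<open>R\<close>, one of -R/2 and (1 - R)/2 is a
      nonpositive integer, so the sum terminates.\<close>
    have N: "pochhammer (?\<alpha> + 1) k * pochhammer (?\<beta> + 1) k = 0" if "k \<ge> R + 1" for k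
    proof (cases "even R")
      case True
      then obtain m where "R = 2 * m" by (elim evenE)
      then show ?thesis using that unfolding \<beta> by (simp add: pochhammer_of_nat_eq_0_iff)
    next
      case False
      then obtain m where "R = 2 * m + 1" by (elim oddE)
      then have "1 / 2 - of_nat R / 2 = - (of_nat m :: complex)" by (simp add: field_simps)
      then show ?thesis using that \<open>R = 2 * m + 1\<close> unfolding \<alpha> by (simp add: pochhammer_of_nat_eq_0_iff)
    qed
    have "F (R + 2) = (?c - (?\<alpha> + ?\<beta> + 1) / 2) * F R + (?\<alpha> + 1) * (?\<beta> + 1) / 4 * hypergeo_reg (?\<alpha> + 2) (?\<beta> + 2) (?c + 2) (1 / 2)"
      unfolding F_def using hypergeo_reg_half_rec[of "R + 1" ?\<alpha> ?\<beta> ?c, OF N] unfolding \<alpha> \<beta> c .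
    moreover have "?c - (?\<alpha> + ?\<beta> + 1) / 2 = b / 2" by (simp add: field_simps)
    moreover have "(?\<alpha> + 1) * (?\<beta> + 1) / 4 * hypergeo_reg (?\<alpha> + 2) (?\<beta> + 2) (?c + 2) (1 / 2) = of_nat R * of_nat (R - 1) / 16 * F (R - 2)"
    proof (cases "R \<ge> 2")
      case True
      then have *: "?\<alpha> + 2 = 1 / 2 - of_nat (R - 2) / 2" "?\<beta> + 2 = - of_nat (R - 2) / 2" "?c + 2 = b / 2 - of_nat (R - 2) / 2 + 3 / 4"
        by (simp_all add: of_nat_diff field_simps)
      have "(?\<alpha> + 1) * (?\<beta> + 1) / 4 = of_nat R * of_nat (R - 1) / 16"
        unfolding \<alpha> \<beta> using True by (simp add: of_nat_diff field_simps)
      then show ?thesis unfolding * F_def by (simp only:)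
    next
      case False
      then have "R = 0 \<or> R = 1" by auto
      then show ?thesis unfolding \<alpha> \<beta> by auto
    qed
    ultimately show ?thesis by (simp only:)
  qed
  show ?thesis
  proof (cases "R \<ge> 2")
    case True
    then obtain m where m: "R = m + 2" by (metis le_add_diff_inverse2)
    have "L (R + 2) = - 8 * \<i> * L R" "L R = - 8 * \<i> * L (R - 2)" using L2[of R] L2[of m] m by auto
    then show ?thesis unfolding Y F2 by (simp add: field_simps)
  next
    case False
    then have "R = 0 \<or> R = 1" by auto
    then show ?thesis unfolding Y F2 L2 by (auto simp: mult_ac)
  qed
qed

text \<open>Covers both initial values: for \<open>R = 0\<close> the second upper parameter
  vanishes, for \<open>R = 1\<close> the first.\<close>

lemma hypergeo_reg_0:
  assumes "\<alpha> = 0 \<or> \<beta> = 0"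
  shows "hypergeo_reg \<alpha> \<beta> c z = rGamma c"
proof -
  have "hypergeo_reg \<alpha> \<beta> c z = (\<Sum>k\<in>{0}. pochhammer \<alpha> k * pochhammer \<beta> k * z ^ k * rGamma (c + of_nat k) / fact k)"
    unfolding hypergeo_reg_def using assms by (intro suminf_finite) (auto simp: pochhammer_0_left)
  then show ?thesis by simp
qed

lemma stokes_coeff_0:
  "stokes_coeff (s - 1 / 2) 0 = - \<i> * of_real (sqrt pi) * Gamma s * rGamma ((s + 1) / 2) * exp (\<i> * (of_real pi * s / 2)) * 2 powr ((1 - s) / 2)"
proof -
  have 1: "hypergeo_reg (1 / 2 - of_nat 0 / 2) (- of_nat 0 / 2) ((s - 1 / 2) / 2 - of_nat 0 / 2 + 3 / 4) (1 / 2) = rGamma ((s + 1) / 2)"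
    by (subst hypergeo_reg_0) (auto intro!: arg_cong[of _ _ rGamma] simp: field_simps)
  have 2: "- (s - 1 / 2) / 2 + 3 / 2 * of_nat 0 + 1 / 4 = (1 - s) / 2" by (simp add: field_simps)
  have "exp (((s - 1 / 2) / 2 + of_nat 0 / 2 - 3 / 4) * of_real pi * \<i>) = exp (\<i> * (of_real pi * s / 2)) * exp (- (of_real pi * \<i>))"
    unfolding exp_add[symmetric] by (rule arg_cong[of _ _ exp]) (simp add: field_simps)
  then have 3: "exp (((s - 1 / 2) / 2 + of_nat 0 / 2 - 3 / 4) * of_real pi * \<i>) = - exp (\<i> * (of_real pi * s / 2))"
    by (simp only: exp_minus exp_pi_i) simp
  show ?thesis
    unfolding stokes_coeff_def Lambda_def 1 2 3 by simp
qed

lemma stokes_coeff_1: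
  "stokes_coeff (s - 1 / 2) 1 = exp (- (3 * of_real pi * \<i> / 4)) * of_real (sqrt pi) * Gamma s * rGamma (s / 2) * exp (\<i> * (of_real pi * s / 2)) * 2 powr (2 - s / 2)"
proof -
  have 1: "hypergeo_reg (1 / 2 - of_nat 1 / 2) (- of_nat 1 / 2) ((s - 1 / 2) / 2 - of_nat 1 / 2 + 3 / 4) (1 / 2) = rGamma (s / 2)"
    by (subst hypergeo_reg_0) (auto intro!: arg_cong[of _ _ rGamma] simp: field_simps)
  have 2: "- (s - 1 / 2) / 2 + 3 / 2 * of_nat 1 + 1 / 4 = 2 - s / 2" by (simp add: field_simps)
  have "exp (((s - 1 / 2) / 2 + of_nat 1 / 2 - 3 / 4) * of_real pi * \<i>) = exp (\<i> * (of_real pi * s / 2)) * exp (- (of_real pi * \<i> / 2))"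
    unfolding exp_add[symmetric] by (rule arg_cong[of _ _ exp]) (simp add: field_simps)
  then have 3: "exp (((s - 1 / 2) / 2 + of_nat 1 / 2 - 3 / 4) * of_real pi * \<i>) = - \<i> * exp (\<i> * (of_real pi * s / 2))"
    by (simp only: exp_minus exp_half_pi_i) simp
  show ?thesis
    unfolding stokes_coeff_def Lambda_def 1 2 3 by (simp add: mult_ac)
qed

section \<open>The connection formula\<close>

text \<open>With \<theta> = pi s / 2, reflection gives pi / cos \<theta> and pi / sin \<theta> for
  the two products, and e^(i \<theta>) (sin \<theta> + i cos \<theta>) = i. This turns the Wronskian
  \<open>A\<close>, a sum of Gamma products, into one product of four Gammas.\<close>

lemma Gamma_half_products:
  fixes s :: complex
  assumes s: "0 < Re s" "Re s < 1"
  defines "t \<equiv> 1 - s"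
  shows "of_real pi * exp (\<i> * (of_real pi * s / 2)) *
      (Gamma ((s + 1) / 2) * Gamma (t / 2) + \<i> * (Gamma (s / 2) * Gamma ((t + 1) / 2)))
    = \<i> * (Gamma (s / 2) * Gamma ((s + 1) / 2) * Gamma (t / 2) * Gamma ((t + 1) / 2))"
proof -
  define \<theta> where "\<theta> = of_real pi * s / 2"
  have e1: "1 - s / 2 = (t + 1) / 2" and e2: "1 - (s + 1) / 2 = t / 2" by (simp_all add: t_def field_simps)
  have 1: "Gamma (s / 2) * Gamma ((t + 1) / 2) = of_real pi / sin \<theta>"
    using Gamma_reflection_complex[of "s / 2"] unfolding e1 \<theta>_def by simp
  have "sin (of_real pi * ((s + 1) / 2)) = cos \<theta>"
  proof -
    have "of_real pi * ((s + 1) / 2) = of_real pi / 2 - (- \<theta>)" by (simp add: \<theta>_def field_simps)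
    then have "sin (of_real pi * ((s + 1) / 2)) = sin (of_real pi / 2 - (- \<theta>))" by (rule arg_cong)
    also have "\<dots> = cos (- \<theta>)" using sin_cos_eq[of "- \<theta> - 0"] cos_sin_eq[of "- \<theta>"] by simp
    finally show ?thesis by simp
  qed
  then have 2: "Gamma ((s + 1) / 2) * Gamma (t / 2) = of_real pi / cos \<theta>"
    using Gamma_reflection_complex[of "(s + 1) / 2"] unfolding e2 by simp
  have "Gamma (s / 2) \<noteq> 0" "Gamma ((t + 1) / 2) \<noteq> 0" "Gamma ((s + 1) / 2) \<noteq> 0" "Gamma (t / 2) \<noteq> 0"
    using s by (auto intro!: Gamma_nonzero_Re_pos simp: t_def)
  then have nz: "sin \<theta> \<noteq> 0" "cos \<theta> \<noteq> 0" using 1 2 by auto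
  have "exp (\<i> * \<theta>) * (sin \<theta> + \<i> * cos \<theta>) = \<i>"
  proof -
    have "sin \<theta> + \<i> * cos \<theta> = \<i> * exp (- (\<i> * \<theta>))"
    proof -
      have "exp (- (\<i> * \<theta>)) = cos \<theta> - \<i> * sin \<theta>" using exp_Euler[of "- \<theta>"] by simp
      then show ?thesis by (simp only:) (simp add: right_diff_distrib)
    qed
    then show ?thesis by (simp add: exp_minus)
  qed
  note euler = this
  have "of_real pi / cos \<theta> + \<i> * (of_real pi / sin \<theta>) = of_real pi * (sin \<theta> + \<i> * cos \<theta>) / (sin \<theta> * cos \<theta>)"
    using nz by (simp add: field_simps)
  then have "of_real pi * exp (\<i> * \<theta>) * (of_real pi / cos \<theta> + \<i> * (of_real pi / sin \<theta>))
      = of_real pi * of_real pi / (sin \<theta> * cos \<theta>) * (exp (\<i> * \<theta>) * (sin \<theta> + \<i> * cos \<theta>))"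
    by simp
  then have "of_real pi * exp (\<i> * \<theta>) * (of_real pi / cos \<theta> + \<i> * (of_real pi / sin \<theta>))
      = \<i> * ((of_real pi / sin \<theta>) * (of_real pi / cos \<theta>))"
    unfolding euler by simp
  moreover have "Gamma (s / 2) * Gamma ((s + 1) / 2) * Gamma (t / 2) * Gamma ((t + 1) / 2)
      = (Gamma (s / 2) * Gamma ((t + 1) / 2)) * (Gamma ((s + 1) / 2) * Gamma (t / 2))"
    by (simp only: mult_ac)
  ultimately show ?thesis
    by (simp only: 1 2 \<theta>_def[symmetric])
qed

text \<open>\<open>\<omega>\<close>, \<open>A\<close> and \<open>C\<close> are the Wronskians at 0
  of the unnormalised W_0, W_2, W_3, and the bracket is what remains of the integrals from infinity.
  Both sides obey the same step-2 recursion, so \<open>R = 0\<close> and \<open>R = 1\<close>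
  decide.\<close>

lemma pcf_moment_stokes_coeff:
  fixes s c d :: complex
  assumes s: "0 < Re s" "Re s < 1" and cd: "c = exp (- (of_real pi * \<i> / 4))" "d = exp (of_real pi * \<i> / 4)"
  defines "t \<equiv> 1 - s"
  defines "v0 \<equiv> pcf_int s 0" and "v1 \<equiv> deriv (pcf_int s) 0" and "y0 \<equiv> pcf_int t 0" and "y1 \<equiv> deriv (pcf_int t) 0"
  defines "\<omega> \<equiv> - 2 * c * v0 * v1" and "A \<equiv> - c * (y0 * v1 + \<i> * y1 * v0)" and "C \<equiv> c * (\<i> * v0 * y1 - v1 * y0)"
  shows "(- (A * d ^ (R + 1) * pcf_moment s R) - C * (- d) ^ (R + 1) * pcf_moment s R
      + \<omega> * (- \<i> * d) ^ (R + 1) * pcf_moment t R) * Gamma s = \<omega> * A * stokes_coeff (s - 1 / 2) R"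
    and "\<omega> \<noteq> 0" and "A \<noteq> 0"
proof -
  define \<kappa> where "\<kappa> n = - A * d ^ (n + 1) - C * (- d) ^ (n + 1)" for n
  define \<mu> where "\<mu> n = \<omega> * (- \<i> * d) ^ (n + 1)" for n
  define X where "X n = \<kappa> n * pcf_moment s n + \<mu> n * pcf_moment t n" for n
  define b where "b = s - 1 / 2"
  have t: "Re t > 0" "Re t < 1" using s by (auto simp: t_def)
  have d2: "d * d = \<i>" and cd1: "c * d = 1" and c2: "c * c = - \<i>"
    unfolding cd exp_add[symmetric] by (simp_all add: exp_half_pi_i exp_minus mult.commute)
  \<comment> \<open>Matches the phase in \<open>stokes_coeff_1\<close>.\<close>
  have c3: "c = \<i> * exp (- (3 * of_real pi * \<i> / 4))"
  proof -
    have "\<i> * exp (- (3 * of_real pi * \<i> / 4)) = exp (of_real pi * \<i> / 2) * exp (- (3 * of_real pi * \<i> / 4))"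
      by (simp only: exp_half_pi_i)
    also have "\<dots> = c" unfolding exp_add[symmetric] cd(1) by (rule arg_cong[of _ _ exp]) (simp add: field_simps)
    finally show ?thesis ..
  qed
  \<comment> \<open>The factors i for \<open>\<kappa>\<close> and -i for \<open>\<mu>\<close>
    compensate \<open>t - 1 / 2 = - (s - 1 / 2)\<close>, so both moment recursions contribute the
    same coefficient of \<open>X n\<close>.\<close>
  have \<kappa>2: "\<kappa> (n + 2) = \<i> * \<kappa> n" for n
  proof -
    have "d ^ (n + 2 + 1) = \<i> * d ^ (n + 1)" "(- d) ^ (n + 2 + 1) = \<i> * (- d) ^ (n + 1)"
      by (simp_all add: d2[symmetric])
    then show ?thesis unfolding \<kappa>_def by (simp only:) (simp add: algebra_simps)
  qed
  have \<mu>2: "\<mu> (n + 2) = - \<i> * \<mu> n" for n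
  proof -
    have "(- \<i> * d) ^ (n + 2 + 1) = - (d * d) * (- \<i> * d) ^ (n + 1)"
      by (simp add: mult_ac)
    then show ?thesis unfolding \<mu>_def d2 by (simp only:) (simp add: algebra_simps)
  qed
  \<comment> \<open>Up to constant factors these are the relation A W_0 + C W_2 = \<omega> W_3
    (unnormalised) at 0: its derivative for \<open>n = 0\<close>, its value for
    \<open>n = 1\<close>.\<close>
  have boundary: "\<kappa> n * (of_nat n * 0 ^ (n - 1) * v0 - 0 ^ n * v1) - \<mu> n * (of_nat n * 0 ^ (n - 1) * y0 - 0 ^ n * y1) = 0" for n
  proof -
    have 0: "\<kappa> 0 * v1 - \<mu> 0 * y1 = 0"
      by (simp add: \<kappa>_def \<mu>_def A_def C_def \<omega>_def algebra_simps)
    have "d ^ 2 = \<i>" by (simp add: power2_eq_square d2)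
    then have dd: "d ^ 2 = \<i>" "(- d) ^ 2 = \<i>" "(- \<i> * d) ^ 2 = - \<i>" by (simp_all add: power_mult_distrib)
    have "\<kappa> 1 * v0 - \<mu> 1 * y0 = (- A - C) * \<i> * v0 + \<omega> * \<i> * y0"
      unfolding \<kappa>_def \<mu>_def one_add_one dd by (simp add: algebra_simps)
    also have "\<dots> = 0" by (simp add: A_def C_def \<omega>_def algebra_simps)
    finally have 1: "\<kappa> 1 * v0 - \<mu> 1 * y0 = 0" .
    consider "n = 0" | "n = 1" | "n \<ge> 2" by linarith
    then show ?thesis
    proof cases
      case 1 then show ?thesis using 0 by simp
    next
      case 2 then show ?thesis using \<open>\<kappa> 1 * v0 - \<mu> 1 * y0 = 0\<close> by simp
    next
      case 3 then show ?thesis by (simp add: power_0_left)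
    qed
  qed
  have X_rec: "X (n + 2) = - 4 * \<i> * b * X n - 4 * of_nat n * of_nat (n - 1) * X (n - 2)" for n
  proof -
    let ?m = "of_nat n * of_nat (n - 1) :: complex"
    let ?B = "of_nat n * 0 ^ (n - 1) * v0 - 0 ^ n * v1" and ?B' = "of_nat n * 0 ^ (n - 1) * y0 - 0 ^ n * y1"
    have rec: "p = - 4 * x * q + 4 * m * r + 4 * y" if "p / 4 + x * q - m * r = y" for p x q m r y :: complex
    proof -
      have "4 * (p / 4 + x * q - m * r) = 4 * y" using that by simp
      then show ?thesis by (simp add: algebra_simps)
    qed
    have tb: "t - 1 / 2 = - b" by (simp add: t_def b_def)
    have M: "pcf_moment s (n + 2) = - 4 * b * pcf_moment s n + 4 * ?m * pcf_moment s (n - 2) + 4 * ?B"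
      using pcf_moment_rec[OF s(1), of n] unfolding b_def v0_def v1_def by (rule rec)
    have M': "pcf_moment t (n + 2) = 4 * b * pcf_moment t n + 4 * ?m * pcf_moment t (n - 2) + 4 * ?B'"
      using rec[OF pcf_moment_rec[OF t(1), of n]] unfolding y0_def y1_def tb by simp
    have "X (n + 2) = \<i> * \<kappa> n * (- 4 * b * pcf_moment s n + 4 * ?m * pcf_moment s (n - 2) + 4 * ?B)
        - \<i> * \<mu> n * (4 * b * pcf_moment t n + 4 * ?m * pcf_moment t (n - 2) + 4 * ?B')"
      unfolding X_def \<kappa>2 \<mu>2 M M' by simp
    also have "\<dots> = - 4 * \<i> * b * X n + 4 * (?m * (\<i> * \<kappa> n * pcf_moment s (n - 2) - \<i> * \<mu> n * pcf_moment t (n - 2)))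
        + 4 * \<i> * (\<kappa> n * ?B - \<mu> n * ?B')"
      unfolding X_def by (simp add: algebra_simps)
    also have "?m * (\<i> * \<kappa> n * pcf_moment s (n - 2) - \<i> * \<mu> n * pcf_moment t (n - 2)) = - ?m * X (n - 2)"
    proof (cases "n \<ge> 2")
      case True
      then obtain k where k: "n = k + 2" by (metis le_add_diff_inverse2)
      show ?thesis unfolding k \<kappa>2 \<mu>2 X_def by (simp add: algebra_simps)
    next
      case False
      then have "n = 0 \<or> n = 1" by auto
      then show ?thesis by auto
    qed
    finally show ?thesis unfolding boundary by simp
  qed
  define g1 g2 g3 g4 where "g1 = Gamma (s / 2)" and "g2 = Gamma ((s + 1) / 2)" and "g3 = Gamma (t / 2)" and "g4 = Gamma ((t + 1) / 2)"
  define r where "r = complex_of_real (sqrt pi)"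
  define e where "e = exp (\<i> * (of_real pi * s / 2))"
  have r2: "r * r = of_real pi" and r0: "r \<noteq> 0" by (simp_all add: r_def flip: of_real_mult)
  have g0: "g1 \<noteq> 0" "g2 \<noteq> 0"
    unfolding g1_def g2_def using s by (auto intro!: Gamma_nonzero_Re_pos)
  have key: "r * e * (g2 * g3 + \<i> * (g1 * g4)) = \<i> * (g1 * g2 * g3 * g4) / r"
  proof -
    have "r * r * e * (g2 * g3 + \<i> * (g1 * g4)) = \<i> * (g1 * g2 * g3 * g4)"
      using Gamma_half_products[OF s]
      unfolding r2 g1_def g2_def g3_def g4_def e_def t_def .
    then show ?thesis using r0 by (simp add: field_simps)
  qed
  have half: "2 powr x * 2 powr y = (1 :: complex)" if "x + y = 0" for x y :: complex
    unfolding powr_add[symmetric] that by simp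
  have two: "2 powr x * 2 powr y = (2 :: complex)" if "x + y = 1" for x y :: complex
    unfolding powr_add[symmetric] that by simp
  have v0: "v0 = 2 powr (s / 2 - 1) * g1" and y0: "y0 = 2 powr (t / 2 - 1) * g3"
    unfolding v0_def y0_def g1_def g3_def by (simp_all add: pcf_int_at_0 s t)
  have v1: "v1 = - (2 powr ((s + 1) / 2 - 1) * g2)" and y1: "y1 = - (2 powr ((t + 1) / 2 - 1) * g4)"
    unfolding v1_def y1_def g2_def g4_def using s t pcf_int_at_0[of "s + 1"] pcf_int_at_0[of "t + 1"]
    by (simp_all add: deriv_pcf_int)
  have A: "A = c / 2 * (g2 * g3 + \<i> * (g1 * g4))"
  proof -
    have 1: "2 powr (t / 2 - 1) * 2 powr ((s + 1) / 2 - 1) = (1 / 2 * 2 powr 0 :: complex)"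
      "2 powr ((t + 1) / 2 - 1) * 2 powr (s / 2 - 1) = (1 / 2 * 2 powr 0 :: complex)"
      by (simp_all add: powr_diff t_def powr_minus_divide flip: powr_add) (simp_all add: field_simps flip: powr_add)
    have "y0 * v1 = - ((2 powr (t / 2 - 1) * 2 powr ((s + 1) / 2 - 1)) * (g2 * g3))" unfolding y0 v1 by simp
    moreover have "y1 * v0 = - ((2 powr ((t + 1) / 2 - 1) * 2 powr (s / 2 - 1)) * (g1 * g4))" unfolding y1 v0 by simp
    ultimately show ?thesis unfolding A_def mult.assoc[of \<i>] 1 by (simp add: algebra_simps)
  qed
  define K where "K = g2 * g3 + \<i> * (g1 * g4)"
  have X0: "X 0 * Gamma s = \<omega> * A * stokes_coeff b 0"
  proof -
    let ?m = "pcf_moment s 0" and ?m' = "pcf_moment t 0"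
    have H: "half_beta (1 / 2) s + half_beta (1 / 2) t = g1 * g3 / (2 * r)"
      using half_beta_add(2)[OF s(1) t(1)] Gamma_one_half_complex
      by (simp add: t_def g1_def g3_def r_def)
    \<comment> \<open>The weights are such that both terms carry the same Gamma factors
      \<open>g2 * g4\<close> and, because \<open>s + t = 1\<close>, powers of 2 with product 1; only
      the sum of the two incomplete integrals is left.\<close>
    have "y1 * ?m = - ((2 powr ((t + 1) / 2 - 1) * 2 powr (s / 2)) * (g2 * g4 * half_beta (1 / 2) s))"
      unfolding y1 pcf_moment_0[OF s(1)] g2_def[symmetric] by simp
    moreover have "v1 * ?m' = - ((2 powr ((s + 1) / 2 - 1) * 2 powr (t / 2)) * (g2 * g4 * half_beta (1 / 2) t))"
      unfolding v1 pcf_moment_0[OF t(1)] g4_def[symmetric] by simp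
    moreover have "2 powr ((t + 1) / 2 - 1) * 2 powr (s / 2) = (1 :: complex)" "2 powr ((s + 1) / 2 - 1) * 2 powr (t / 2) = (1 :: complex)"
      by (rule half, simp add: t_def field_simps)+
    ultimately have "y1 * ?m + v1 * ?m' = - (g2 * g4) * (half_beta (1 / 2) s + half_beta (1 / 2) t)"
      by (simp add: algebra_simps)
    then have m: "y1 * ?m + v1 * ?m' = - (g1 * g2 * g3 * g4) / (2 * r)" unfolding H by simp
    have "X 0 = (c * d) * (2 * \<i> * v0 * (y1 * ?m + v1 * ?m'))"
      by (simp add: X_def \<kappa>_def \<mu>_def A_def C_def \<omega>_def algebra_simps)
    then have X: "X 0 = - \<i> * v0 * (g1 * g2 * g3 * g4 / r)" unfolding cd1 m by simp
    have v: "v1 * 2 powr ((1 - s) / 2) = - g2"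
    proof -
      have "v1 * 2 powr ((1 - s) / 2) = - (2 powr ((s + 1) / 2 - 1) * 2 powr ((1 - s) / 2)) * g2" unfolding v1 by simp
      also have "2 powr ((s + 1) / 2 - 1) * 2 powr ((1 - s) / 2) = (1 :: complex)" by (rule half) (simp add: field_simps)
      finally show ?thesis by simp
    qed
    have "\<omega> * A * stokes_coeff b 0 = (c * c) * \<i> * v0 * (v1 * 2 powr ((1 - s) / 2)) * inverse g2 * Gamma s * (r * e * K)"
      unfolding b_def stokes_coeff_0 A \<omega>_def K_def rGamma_inverse_Gamma g2_def[symmetric] r_def[symmetric] e_def[symmetric]
      by (simp add: mult_ac)
    also have "\<dots> = X 0 * Gamma s"
      unfolding v c2 key[folded K_def] X using g0 by simp
    finally show ?thesis ..
  qed
  have X1: "X 1 * Gamma s = \<omega> * A * stokes_coeff b 1"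
  proof -
    let ?m = "pcf_moment s 1" and ?m' = "pcf_moment t 1"
    have st1: "Re (s + 1) > 0" "Re (t + 1) > 0" and st2: "Re s < 2" "Re t < 2" using s t by auto
    have "Gamma (3 / 2) = (r / 2 :: complex)"
      using Gamma_plus1[of "1 / 2 :: complex"] Gamma_one_half_complex by (simp add: r_def Re_pos_not_nonpos_Ints)
    moreover have "(t + 1 + (s + 1)) / 2 = 3 / 2" by (simp add: t_def)
    ultimately have H: "half_beta (3 / 2) (s + 1) + half_beta (3 / 2) (t + 1) = g2 * g4 / r"
      using half_beta_add(2)[OF st1] by (simp only: g2_def[symmetric] g4_def[symmetric]) simp
    have "y0 * ?m = (2 powr (t / 2 - 1) * 2 powr ((s + 1) / 2)) * (g1 * g3 * half_beta (3 / 2) (s + 1))"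
      unfolding y0 pcf_moment_1_half_beta[OF s(1) st2(1)] g1_def[symmetric] by simp
    moreover have "v0 * ?m' = (2 powr (s / 2 - 1) * 2 powr ((t + 1) / 2)) * (g1 * g3 * half_beta (3 / 2) (t + 1))"
      unfolding v0 pcf_moment_1_half_beta[OF t(1) st2(2)] g3_def[symmetric] by simp
    moreover have "2 powr (t / 2 - 1) * 2 powr ((s + 1) / 2) = (1 :: complex)" "2 powr (s / 2 - 1) * 2 powr ((t + 1) / 2) = (1 :: complex)"
      by (rule half, simp add: t_def field_simps)+
    ultimately have "y0 * ?m + v0 * ?m' = (g1 * g3) * (half_beta (3 / 2) (s + 1) + half_beta (3 / 2) (t + 1))"
      by (simp add: algebra_simps)
    then have m: "y0 * ?m + v0 * ?m' = g1 * g2 * g3 * g4 / r" unfolding H by simp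
    have "X 1 = (d * d) * (2 * c * v1 * (y0 * ?m + v0 * ?m'))"
      by (simp add: X_def \<kappa>_def \<mu>_def A_def C_def \<omega>_def algebra_simps)
    then have X: "X 1 = 2 * \<i> * c * v1 * (g1 * g2 * g3 * g4 / r)" unfolding d2 m by simp
    have v: "v0 * 2 powr (2 - s / 2) = 2 * g1"
    proof -
      have "v0 * 2 powr (2 - s / 2) = (2 powr (s / 2 - 1) * 2 powr (2 - s / 2)) * g1" unfolding v0 by simp
      also have "2 powr (s / 2 - 1) * 2 powr (2 - s / 2) = (2 :: complex)" by (rule two) (simp add: field_simps)
      finally show ?thesis .
    qed
    have "\<omega> * A * stokes_coeff b 1 = - (c * c) * v1 * (v0 * 2 powr (2 - s / 2)) * inverse g1 * exp (- (3 * of_real pi * \<i> / 4)) * Gamma s * (r * e * K)"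
      unfolding b_def stokes_coeff_1 A \<omega>_def K_def rGamma_inverse_Gamma g1_def[symmetric] r_def[symmetric] e_def[symmetric]
      by (simp add: mult_ac)
    also have "\<dots> = 2 * \<i> * (\<i> * exp (- (3 * of_real pi * \<i> / 4))) * v1 * (g1 * g2 * g3 * g4 / r) * Gamma s"
      unfolding v c2 key[folded K_def] using g0 by simp
    also have "\<dots> = X 1 * Gamma s" unfolding X c3[symmetric] by simp
    finally show ?thesis ..
  qed
  have "X n * Gamma s = \<omega> * A * stokes_coeff b n" for n
  proof (induction n rule: less_induct)
    case (less n)
    consider "n = 0" | "n = 1" | k where "n = k + 2"
      by (metis One_nat_def Suc_1 add.commute add_Suc_right less_2_cases_iff not_less le_add_diff_inverse2)
    then show ?case
    proof cases
      case 3
      have "X (k + 2) * Gamma s = - 4 * \<i> * b * (X k * Gamma s) - 4 * of_nat k * of_nat (k - 1) * (X (k - 2) * Gamma s)"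
        unfolding X_rec by (simp add: algebra_simps)
      also have "\<dots> = \<omega> * A * stokes_coeff b (k + 2)"
        using less 3 unfolding stokes_coeff_rec by (simp add: algebra_simps)
      finally show ?thesis using 3 by simp
    qed (use X0 X1 in simp_all)
  qed
  from this[of R] show "(- (A * d ^ (R + 1) * pcf_moment s R) - C * (- d) ^ (R + 1) * pcf_moment s R
      + \<omega> * (- \<i> * d) ^ (R + 1) * pcf_moment t R) * Gamma s = \<omega> * A * stokes_coeff (s - 1 / 2) R"
    unfolding X_def \<kappa>_def \<mu>_def b_def by (simp add: algebra_simps)
  have "c \<noteq> 0" using cd1 by auto
  then show "\<omega> \<noteq> 0" unfolding \<omega>_def v0 v1 using g0 by simp
  have "g3 \<noteq> 0" "g4 \<noteq> 0"
    unfolding g3_def g4_def using t by (auto intro!: Gamma_nonzero_Re_pos)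
  \<comment> \<open>The sum \<open>K\<close> cannot vanish because \<open>key\<close> equates it, up
    to nonzero factors, with a product of Gamma values.\<close>
  then have "K \<noteq> 0" using key[folded K_def] g0 r0 by auto
  then show "A \<noteq> 0" unfolding A K_def[symmetric] using \<open>c \<noteq> 0\<close> by simp
qed

text \<open>A fourth root of -1 as scaling factor reverses the sign of z^2 / 4 and so passes to the
  equation of the W_j.\<close>

lemma ode_solution_pcf_int_cmult_arg:
  assumes "Re s > 0" "c ^ 4 = - 1"
  shows "ode_solution (\<lambda>z. c\<^sup>2 * (s - 1 / 2) - z\<^sup>2 / 4) (\<lambda>z. pcf_int s (c * z))"
proof -
  have "c\<^sup>2 * ((c * z)\<^sup>2 / 4 + (s - 1 / 2)) = c\<^sup>2 * (s - 1 / 2) - z\<^sup>2 / 4" for z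
  proof -
    have "c\<^sup>2 * ((c * z)\<^sup>2 / 4 + (s - 1 / 2)) = c ^ 4 * (z\<^sup>2 / 4) + c\<^sup>2 * (s - 1 / 2)"
      by (simp add: power_mult_distrib distrib_left power4_eq_xxxx power2_eq_square)
    then show ?thesis by (simp add: assms(2))
  qed
  then show ?thesis
    using ode_solution_cmult_arg(1)[OF ode_solution_pcf_int[OF assms(1)], of c] by simp
qed

section \<open>Comparison of the two particular solutions\<close>

lemma wronskian_divide:
  assumes "f field_differentiable at z" "g field_differentiable at z"
  shows "wronskian (\<lambda>z. f z / k) (\<lambda>z. g z / l) z = wronskian f g z / (k * l)"
  using assms by (simp add: wronskian_def deriv_cdivide_right diff_divide_distrib)

theorem mainTheorem10:
  fixes a :: real and R :: nat and z :: complex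
  assumes "a > 0"
  shows "pcfW_inhom R 0 2 (of_real a) z =
           pcfW_inhom R 2 3 (of_real a) z +
           \<i> * exp (- (3 * of_nat R * of_real pi * \<i> / 4)) *
             Lambda R (\<i> * of_real a) * pcfW 2 (of_real a) z"
proof -
  define c d where "c = exp (- (of_real pi * \<i> / 4))" and "d = exp (of_real pi * \<i> / 4)"
  define s t where "s = \<i> * of_real a + 1 / 2" and "t = 1 - s"
  have s: "0 < Re s" "Re s < 1" and t: "0 < Re t" by (auto simp: s_def t_def)
  have c2: "c * c = - \<i>" and cd: "c * d = 1"
    unfolding c_def d_def exp_add[symmetric] by (simp_all add: exp_half_pi_i exp_minus mult.commute)
  \<comment> \<open>The W_j without their Gamma factors; the powers of -i in their arguments turn
    \<open>c\<close> into \<open>c\<close>, \<open>- c\<close> and \<open>\<i> * c\<close>. W_3 has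
    parameter -ia and hence uses \<open>t\<close>.\<close>
  define w0 w2 w3 where "w0 = (\<lambda>z. pcf_int s (c * z))" and "w2 = (\<lambda>z. pcf_int s (- c * z))"
    and "w3 = (\<lambda>z. pcf_int t (\<i> * c * z))"
  have W0: "pcfW 0 (of_real a) = (\<lambda>z. w0 z / Gamma s)" and W2: "pcfW 2 (of_real a) = (\<lambda>z. w2 z / Gamma s)"
    and W3: "pcfW 3 (of_real a) = (\<lambda>z. w3 z / Gamma t)"
  proof -
    have "pcfU (\<i> * of_real a) = (\<lambda>z. pcf_int s z / Gamma s)"
      using pcfU_eq[of "\<i> * of_real a"] by (simp add: s_def)
    then show "pcfW 0 (of_real a) = (\<lambda>z. w0 z / Gamma s)" "pcfW 2 (of_real a) = (\<lambda>z. w2 z / Gamma s)"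
      by (auto simp: pcfW_def w0_def w2_def c_def mult.commute)
    have "pcfU (- (\<i> * of_real a)) = (\<lambda>z. pcf_int t z / Gamma t)"
      using pcfU_eq[of "- (\<i> * of_real a)"] by (simp add: s_def t_def)
    then show "pcfW 3 (of_real a) = (\<lambda>z. w3 z / Gamma t)"
      by (auto simp: pcfW_def w3_def c_def mult_ac power3_eq_cube)
  qed
  define q where "q = (\<lambda>z. - \<i> * (s - 1 / 2) - z\<^sup>2 / 4)"
  have sol: "ode_solution q w0" "ode_solution q w2" "ode_solution q w3"
  proof -
    have c22: "c\<^sup>2 = - \<i>" using c2 by (simp add: power2_eq_square)
    have c4: "c ^ 4 = - 1"
      using power_mult[of c 2 2] by (simp add: c22)
    have "(- c) ^ 4 = - 1" "(\<i> * c) ^ 4 = - 1" by (simp_all add: c4 power_mult_distrib)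
    moreover have "(\<i> * c)\<^sup>2 * (t - 1 / 2) = - \<i> * (s - 1 / 2)"
      by (simp add: power_mult_distrib c22 t_def algebra_simps)
    ultimately show "ode_solution q w0" "ode_solution q w2" "ode_solution q w3"
      using ode_solution_pcf_int_cmult_arg[OF s(1), of c] ode_solution_pcf_int_cmult_arg[OF s(1), of "- c"]
        ode_solution_pcf_int_cmult_arg[OF t, of "\<i> * c"] c4
      by (simp_all add: q_def w0_def w2_def w3_def c22)
  qed
  have diff: "w0 field_differentiable at z" "w2 field_differentiable at z" "w3 field_differentiable at z" for z
    using ode_solution_has_field_derivative(1)[OF sol(1)] ode_solution_has_field_derivative(1)[OF sol(2)]
      ode_solution_has_field_derivative(1)[OF sol(3)] by (auto simp: field_differentiable_def)
  define v0 v1 y0 y1 where "v0 = pcf_int s 0" and "v1 = deriv (pcf_int s) 0" and "y0 = pcf_int t 0" and "y1 = deriv (pcf_int t) 0"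
  define \<omega> A C where "\<omega> = - 2 * c * v0 * v1" and "A = - c * (y0 * v1 + \<i> * y1 * v0)" and "C = c * (\<i> * v0 * y1 - v1 * y0)"
  have at_0: "w0 0 = v0" "w2 0 = v0" "w3 0 = y0" "deriv w0 0 = c * v1" "deriv w2 0 = - c * v1" "deriv w3 0 = \<i> * c * y1"
    unfolding w0_def w2_def w3_def
    using ode_solution_cmult_arg(2)[OF ode_solution_pcf_int[OF s(1)], of c 0]
      ode_solution_cmult_arg(2)[OF ode_solution_pcf_int[OF s(1)], of "- c" 0]
      ode_solution_cmult_arg(2)[OF ode_solution_pcf_int[OF t], of "\<i> * c" 0]
    by (simp_all add: v0_def v1_def y0_def y1_def)
  have wr: "wronskian w0 w2 z = \<omega>" "wronskian w3 w2 z = A" "wronskian w0 w3 z = C" "wronskian w2 w3 z = - A" for z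
    using ode_solution_wronskian_constant[OF sol(1,2), of z 0] ode_solution_wronskian_constant[OF sol(3,2), of z 0]
      ode_solution_wronskian_constant[OF sol(1,3), of z 0] ode_solution_wronskian_constant[OF sol(2,3), of z 0]
    by (simp_all add: wronskian_def at_0 \<omega>_def A_def C_def algebra_simps)
  \<comment> \<open>Cramer's rule: with the coefficients written as Wronskians at \<open>z\<close>
    itself, this is a polynomial identity in the values and first derivatives.\<close>
  have connection: "\<omega> * w3 z = A * w0 z + C * w2 z" for z
    unfolding wr(1)[of z, symmetric] wr(2)[of z, symmetric] wr(3)[of z, symmetric] wronskian_def
    by (simp add: algebra_simps)
  obtain P where P: "\<And>z. (P has_field_derivative z ^ R * pcf_int s z) (at z)" "P 0 = 0"
    "((\<lambda>x. P (of_real x)) \<longlongrightarrow> pcf_moment s R) at_top"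
    using pcf_moment_primitive[OF s(1)] by blast
  obtain Q where Q: "\<And>z. (Q has_field_derivative z ^ R * pcf_int t z) (at z)" "Q 0 = 0"
    "((\<lambda>x. Q (of_real x)) \<longlongrightarrow> pcf_moment t R) at_top"
    using pcf_moment_primitive[OF t] by blast
  define J0 J2 J3 where "J0 = d ^ (R + 1) * (P (c * z) - pcf_moment s R)"
    and "J2 = (- d) ^ (R + 1) * (P (- c * z) - pcf_moment s R)"
    and "J3 = (- \<i> * d) ^ (R + 1) * (Q (\<i> * c * z) - pcf_moment t R)"
  have I: "integral_from_infinity d z (\<lambda>t. t ^ R * (w0 t / Gamma s)) = J0 / Gamma s"
    "integral_from_infinity (- d) z (\<lambda>t. t ^ R * (w2 t / Gamma s)) = J2 / Gamma s"
    "integral_from_infinity (- \<i> * d) z (\<lambda>u. u ^ R * (w3 u / Gamma t)) = J3 / Gamma t"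
  proof -
    have P': "((\<lambda>z. P z / Gamma s) has_field_derivative z ^ R * (pcf_int s z / Gamma s)) (at z)" for z
      using DERIV_cdivide[OF P(1)] by simp
    have Q': "((\<lambda>z. Q z / Gamma t) has_field_derivative z ^ R * (pcf_int t z / Gamma t)) (at z)" for z
      using DERIV_cdivide[OF Q(1)] by simp
    have G: "Gamma s \<noteq> 0" "Gamma t \<noteq> 0" using Gamma_nonzero_Re_pos s(1) t by auto
    note P'' = integral_from_infinity_cmult_arg[OF P' tendsto_divide[OF P(3) tendsto_const G(1)]]
    note Q'' = integral_from_infinity_cmult_arg[OF Q' tendsto_divide[OF Q(3) tendsto_const G(2)]]
    have cd': "- c * (- d) = 1" "\<i> * c * (- \<i> * d) = 1" using cd by (simp_all add: mult_ac)
    show "integral_from_infinity d z (\<lambda>t. t ^ R * (w0 t / Gamma s)) = J0 / Gamma s"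
      using P''[OF cd, of z] unfolding w0_def J0_def by (simp add: diff_divide_distrib right_diff_distrib)
    show "integral_from_infinity (- d) z (\<lambda>t. t ^ R * (w2 t / Gamma s)) = J2 / Gamma s"
      using P''[OF cd'(1), of z] unfolding w2_def J2_def by (simp add: diff_divide_distrib right_diff_distrib)
    show "integral_from_infinity (- \<i> * d) z (\<lambda>u. u ^ R * (w3 u / Gamma t)) = J3 / Gamma t"
      using Q''[OF cd'(2), of z] unfolding w3_def J3_def by (simp add: diff_divide_distrib right_diff_distrib)
  qed
  define X where "X = - (A * d ^ (R + 1) * pcf_moment s R) - C * (- d) ^ (R + 1) * pcf_moment s R
      + \<omega> * (- \<i> * d) ^ (R + 1) * pcf_moment t R"
  \<comment> \<open>By the connection formula the same combination of the primitives has derivative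
    0, and it vanishes at 0 by their normalisation; only the limits at infinity, the moments,
    survive.\<close>
  have J: "A * J0 + C * J2 - \<omega> * J3 = X"
  proof -
    let ?\<Phi> = "\<lambda>z. A * (d ^ (R + 1) * P (c * z)) + C * ((- d) ^ (R + 1) * P (- c * z))
      - \<omega> * ((- \<i> * d) ^ (R + 1) * Q (\<i> * c * z))"
    have scale: "((\<lambda>z. d' ^ (R + 1) * F (c' * z)) has_field_derivative z ^ R * f (c' * z)) (at z)"
      if F: "\<And>z. (F has_field_derivative z ^ R * f z) (at z)" and "c' * d' = 1" for F f c' d' and z :: complex
    proof -
      have "((\<lambda>z. d' ^ (R + 1) * F (c' * z)) has_field_derivative d' ^ (R + 1) * ((c' * z) ^ R * f (c' * z) * c')) (at z)"
        by (rule DERIV_cmult[OF DERIV_chain'[OF DERIV_cmult_Id F]])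
      moreover have "d' ^ (R + 1) * ((c' * z) ^ R * f (c' * z) * c') = (c' * d') ^ (R + 1) * (z ^ R * f (c' * z))"
        by (simp add: power_mult_distrib mult_ac)
      ultimately show ?thesis by (simp only: that(2) power_one mult_1)
    qed
    have cd': "- c * (- d) = 1" "\<i> * c * (- \<i> * d) = 1" using cd by (simp_all add: mult_ac)
    have "(?\<Phi> has_field_derivative A * (x ^ R * w0 x) + C * (x ^ R * w2 x) - \<omega> * (x ^ R * w3 x)) (at x)" for x
      unfolding w0_def w2_def w3_def
      by (intro DERIV_diff DERIV_add DERIV_cmult scale P(1) Q(1) cd cd')
    moreover have "A * (x ^ R * w0 x) + C * (x ^ R * w2 x) - \<omega> * (x ^ R * w3 x) = x ^ R * (A * w0 x + C * w2 x - \<omega> * w3 x)" for x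
      by (simp add: algebra_simps)
    ultimately have "(?\<Phi> has_field_derivative 0) (at x)" for x
      by (simp only: connection diff_self mult_zero_right)
    then have "\<exists>k. \<forall>x\<in>UNIV. ?\<Phi> x = k"
      by (intro has_field_derivative_zero_constant convex_UNIV) auto
    then obtain k where k: "?\<Phi> x = k" for x by blast
    have "?\<Phi> z = ?\<Phi> 0" by (simp only: k)
    also have "\<dots> = 0" by (simp add: P(2) Q(2))
    finally show ?thesis
      unfolding X_def J0_def J2_def J3_def by (simp add: algebra_simps)
  qed
  have X: "X * Gamma s = \<omega> * A * stokes_coeff (\<i> * of_real a) R"
    using pcf_moment_stokes_coeff(1)[OF s c_def d_def, of R]
    unfolding t_def[symmetric] v0_def[symmetric] v1_def[symmetric] y0_def[symmetric] y1_def[symmetric]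
      \<omega>_def[symmetric] A_def[symmetric] C_def[symmetric] X_def[symmetric] by (simp add: s_def)
  have nz: "\<omega> \<noteq> 0" "A \<noteq> 0"
    using pcf_moment_stokes_coeff(2,3)[OF s c_def d_def]
    unfolding t_def v0_def v1_def y0_def y1_def \<omega>_def A_def .
  have G: "Gamma s \<noteq> 0" "Gamma t \<noteq> 0" using Gamma_nonzero_Re_pos s(1) t by auto
  have dir: "exp (of_real pi * \<i> / 4) * \<i> ^ 0 = d" "exp (of_real pi * \<i> / 4) * \<i> ^ 2 = - d" "exp (of_real pi * \<i> / 4) * \<i> ^ 3 = - \<i> * d"
    by (simp_all add: d_def power3_eq_cube)
  have W02: "pcfW_inhom R 0 2 (of_real a) z = (w2 z * J0 - w0 z * J2) / \<omega>"
    unfolding pcfW_inhom_def W0 W2 dir I wronskian_divide[OF diff(1,2)] wr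
    using G nz by (simp add: field_simps)
  have W23: "pcfW_inhom R 2 3 (of_real a) z = - ((w3 z * J2 - w2 z * J3) / A)"
    unfolding pcfW_inhom_def W2 W3 dir I wronskian_divide[OF diff(2,3)] wr
    using G nz by (simp add: field_simps)
  have "(w2 z * J0 - w0 z * J2) / \<omega> + (w3 z * J2 - w2 z * J3) / A = X / (\<omega> * A) * w2 z"
  proof -
    have "(w2 z * J0 - w0 z * J2) / \<omega> + (w3 z * J2 - w2 z * J3) / A
        = (A * w2 z * J0 - A * w0 z * J2 + \<omega> * w3 z * J2 - \<omega> * w2 z * J3) / (\<omega> * A)"
      using nz by (simp add: field_simps)
    \<comment> \<open>Replacing \<open>\<omega> * w3 z\<close> cancels the terms in
      \<open>w0 z * J2\<close>, and everything left contains \<open>w2 z\<close>.\<close>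
    also have "A * w2 z * J0 - A * w0 z * J2 + \<omega> * w3 z * J2 - \<omega> * w2 z * J3 = (A * J0 + C * J2 - \<omega> * J3) * w2 z"
      unfolding connection by (simp add: algebra_simps)
    finally show ?thesis unfolding J by simp
  qed
  moreover have "X / (\<omega> * A) = stokes_coeff (\<i> * of_real a) R / Gamma s"
    using X G nz by (simp add: field_simps)
  ultimately have "stokes_coeff (\<i> * of_real a) R * (w2 z / Gamma s) = (w2 z * J0 - w0 z * J2) / \<omega> + (w3 z * J2 - w2 z * J3) / A"
    by simp
  then show ?thesis
    unfolding W02 W23 W2 stokes_coeff_def[symmetric] by simp
qed

end
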